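(* Let $\mathcal X$ be an infinite dimensional complex Banach space and let $A\in B(\mathcal X)$. Let $L_A,R_A\in B(B(\mathcal X))$ be the operators $L_A(T)=AT$, $R_A(T)=TA$. Then the following statements hold. (i) The operators $L_A$ and $R_A$ satisfy $a$-Browder's theorem. (ii) $A$ satisfies $a$-Browder's theorem and $\Pi^a(A)=\Pi^a(L_A)$ if and only if $\sigma_{SBF_+^-}(A)=\sigma_{SBF_+^-}(L_A)$. (iii) If $\mathcal X$ is an infinite dimensional complex Hilbert space, then $A^*$ satisfies $a$-Browder's theorem if and only if $\sigma_{SBF_+^-}(A^* )=(\sigma_{SBF_+^-}(R_A))^*$.
   Context: For a complex Banach space $\mathcal Z$, $B(\mathcal Z)$ is the Banach algebra of bounded linear operators on $\mathcal Z$. For $T\in B(\mathcal Z)$, $N(T)$, $R(T)$ are the null space and range; $T-\lambda$ means $T-\lambda I$; $\alpha(T)=\dim N(T)$, $\beta(T)=\dim \mathcal Z/R(T)$. $T$ is bounded below if $N(T)=0$ and $R(T)$ is closed; $\sigma_a(T)=\{\lambda\in\mathbb C:T-\lambda\text{ is not bounded below}\}$. $T$ is upper semi-Fredholm if $R(T)$ is closed and $\alpha(T)<\infty$, with index $\mathrm{ind}(T)=\alpha(T)-\beta(T)\in\mathbb Z\cup\{-\infty\}$. $\sigma_{aw}(T)=\{\lambda\in\sigma_a(T): T-\lambda\text{ is not upper semi-Fredholm or }0<\mathrm{ind}(T-\lambda)\}$. $T$ is upper semi B-Fredholm if for some $n\in\mathbb N$ the range $R(T^n)$ is closed and the induced operator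 $T_n=T|_{R(T^n)}\in B(R(T^n))$ is upper semi-Fredholm; its index is $\mathrm{ind}(T)=\mathrm{ind}(T_n)$ (independent of such $n$). $\sigma_{SBF_+^-}(T)=\{\lambda\in\mathbb C: T-\lambda\text{ is not upper semi B-Fredholm or }0<\mathrm{ind}(T-\lambda)\}$. The ascent $\mathrm{asc}(T)$ is the smallest non-negative integer $n$ with $N(T^n)=N(T^{n+1})$, or $\infty$ if none exists. For $K\subseteq\mathbb C$, $\mathrm{iso}\,K$ is the set of isolated points of $K$, and $K^*$ (for a set $K$ of complex numbers) denotes its complex conjugate $\{\bar z:z\in K\}$. $\Pi^a(T)=\{\lambda\in\mathrm{iso}\,\sigma_a(T): a=\mathrm{asc}(T-\lambda)<\infty\text{ and }R((T-\lambda)^{a+1})\text{ is closed}\}$ and $\Pi^a_0(T)=\{\lambda\in\Pi^a(T):\alpha(T-\lambda)<\infty\}$. $T$ satisfies $a$-Browder's theorem if $\sigma_{aw}(T)=\sigma_a(T)\setminus\Pi^a_0(T)$. In (iii), $A^*$ is the Hilbert space adjoint of $A$. *)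

theory Defs
  imports "HOL-Analysis.Analysis"
begin

section \<open>Complex Banach spaces\<close>

class complex_normed_vector = real_normed_vector +
  fixes scaleC :: "complex \<Rightarrow> 'a \<Rightarrow> 'a"  (infixr "*\<^sub>C" 75)
  assumes scaleC_add_right: "c *\<^sub>C (x + y) = c *\<^sub>C x + c *\<^sub>C y"
    and scaleC_add_left: "(c + d) *\<^sub>C x = c *\<^sub>C x + d *\<^sub>C x"
    and scaleC_scaleC: "c *\<^sub>C (d *\<^sub>C x) = (c * d) *\<^sub>C x"
    and scaleR_scaleC: "r *\<^sub>R x = complex_of_real r *\<^sub>C x"
    and norm_scaleC: "norm (c *\<^sub>C x) = cmod c * norm x"

class complex_banach = complex_normed_vector + complete_space

subclass (in complex_banach) banach ..

lemma scaleC_one: "1 *\<^sub>C x = (x :: 'a::complex_normed_vector)"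
  using scaleR_scaleC[of 1 x] by simp

interpretation complex_vector: vector_space "scaleC :: complex \<Rightarrow> 'a \<Rightarrow> 'a::complex_normed_vector"
  by unfold_locales (simp_all add: scaleC_add_right scaleC_add_left scaleC_scaleC scaleC_one)

lemma bounded_linear_scaleC: "bounded_linear (\<lambda>x. c *\<^sub>C (x :: 'a::complex_normed_vector))"
  by (rule bounded_linear_intro[where K = "cmod c"])
     (simp_all add: scaleC_add_right scaleR_scaleC scaleC_scaleC norm_scaleC mult.commute)


section \<open>The Banach algebra of bounded complex-linear operators\<close>

typedef (overloaded) 'a bop =
  "{f :: 'a::complex_normed_vector \<Rightarrow>\<^sub>L 'a. \<forall>c x. blinfun_apply f (c *\<^sub>C x) = c *\<^sub>C blinfun_apply f x}"
  morphisms blinfun_of_bop bop_of_blinfun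
  by (rule exI[of _ 0]) simp

setup_lifting type_definition_bop

lift_definition app :: "'a::complex_normed_vector bop \<Rightarrow> 'a \<Rightarrow> 'a" is blinfun_apply .

lift_definition blinfun_scaleC :: "complex \<Rightarrow> 'a::complex_normed_vector \<Rightarrow>\<^sub>L 'a" is "(*\<^sub>C)"
  by (rule bounded_linear_scaleC)

lemma bop_eqI: "(\<And>x. app S x = app T x) \<Longrightarrow> S = T"
  by transfer (rule blinfun_eqI)

instantiation bop :: (complex_normed_vector) real_normed_vector
begin

lift_definition norm_bop :: "'a bop \<Rightarrow> real" is norm .

lift_definition minus_bop :: "'a bop \<Rightarrow> 'a bop \<Rightarrow> 'a bop" is "(-)"
  by (simp add: blinfun.diff_left complex_vector.scale_right_diff_distrib)

lift_definition uminus_bop :: "'a bop \<Rightarrow> 'a bop" is uminus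
  by (simp add: blinfun.minus_left)

lift_definition zero_bop :: "'a bop" is 0
  by simp

lift_definition plus_bop :: "'a bop \<Rightarrow> 'a bop \<Rightarrow> 'a bop" is "(+)"
  by (simp add: blinfun.add_left scaleC_add_right)

lift_definition scaleR_bop :: "real \<Rightarrow> 'a bop \<Rightarrow> 'a bop" is "(*\<^sub>R)"
  by (simp add: blinfun.scaleR_left scaleR_scaleC scaleC_scaleC mult.commute)

definition dist_bop :: "'a bop \<Rightarrow> 'a bop \<Rightarrow> real"
  where "dist_bop S T = norm (S - T)"

definition sgn_bop :: "'a bop \<Rightarrow> 'a bop"
  where "sgn_bop T = inverse (norm T) *\<^sub>R T"

definition uniformity_bop :: "('a bop \<times> 'a bop) filter"
  where "uniformity_bop = (INF e\<in>{0 <..}. principal {(x, y). dist x y < e})"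

definition open_bop :: "'a bop set \<Rightarrow> bool"
  where "open_bop S = (\<forall>x\<in>S. \<forall>\<^sub>F (x', y) in uniformity. x' = x \<longrightarrow> y \<in> S)"

instance
  apply standard
  unfolding dist_bop_def open_bop_def sgn_bop_def uniformity_bop_def
  apply (rule refl | (transfer, force simp: algebra_simps norm_triangle_ineq))+
  done

end

instantiation bop :: (complex_normed_vector) complex_normed_vector
begin

lift_definition scaleC_bop :: "complex \<Rightarrow> 'a bop \<Rightarrow> 'a bop" is "\<lambda>c f. blinfun_scaleC c o\<^sub>L f"
  by (simp add: blinfun_scaleC.rep_eq scaleC_scaleC mult.commute)

lemma norm_blinfun_scaleC_compose: "norm (blinfun_scaleC c o\<^sub>L f) \<le> cmod c * norm f"
proof (rule norm_blinfun_bound)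
  fix x
  show "norm (blinfun_apply (blinfun_scaleC c o\<^sub>L f) x) \<le> cmod c * norm f * norm x"
    using norm_blinfun[of f x]
    by (simp add: blinfun_scaleC.rep_eq norm_scaleC mult.assoc mult_left_mono)
qed simp

instance
proof
  fix c d :: complex and r :: real and S T :: "'a bop"
  show "c *\<^sub>C (S + T) = c *\<^sub>C S + c *\<^sub>C T"
    by transfer (auto intro!: blinfun_eqI simp: blinfun_scaleC.rep_eq blinfun.add_left scaleC_add_right)
  show "(c + d) *\<^sub>C S = c *\<^sub>C S + d *\<^sub>C S"
    by transfer (auto intro!: blinfun_eqI simp: blinfun_scaleC.rep_eq blinfun.add_left scaleC_add_left)
  show *: "c *\<^sub>C (d *\<^sub>C S) = (c * d) *\<^sub>C S" for c d
    by transfer (auto intro!: blinfun_eqI simp: blinfun_scaleC.rep_eq scaleC_scaleC)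
  show scR: "r *\<^sub>R S = complex_of_real r *\<^sub>C S" for r and S :: "'a bop"
    by transfer (auto intro!: blinfun_eqI simp: blinfun_scaleC.rep_eq blinfun.scaleR_left scaleR_scaleC)
  have le: "norm (c *\<^sub>C S) \<le> cmod c * norm S" for c and S :: "'a bop"
    by transfer (rule norm_blinfun_scaleC_compose)
  show "norm (c *\<^sub>C S) = cmod c * norm S"
  proof (cases "c = 0")
    case True
    then show ?thesis using le[of 0 S] by simp
  next
    case False
    have "S = inverse c *\<^sub>C (c *\<^sub>C S)"
      using False scR[of 1 S] by (simp add: *)
    then have "norm S \<le> cmod (inverse c) * norm (c *\<^sub>C S)"
      using le[of "inverse c" "c *\<^sub>C S"] by simp
    then have "cmod c * norm S \<le> norm (c *\<^sub>C S)"
      using False by (simp add: norm_inverse divide_inverse[symmetric] pos_le_divide_eq mult.commute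
          flip: divide_inverse_commute)
    with le[of c S] show ?thesis by simp
  qed
qed

end

instantiation bop :: (complex_normed_vector) "{real_normed_algebra, monoid_mult}"
begin

lift_definition times_bop :: "'a bop \<Rightarrow> 'a bop \<Rightarrow> 'a bop" is "(o\<^sub>L)"
  by simp

lift_definition one_bop :: "'a bop" is id_blinfun
  by simp

instance
proof
  fix r :: real and S T U :: "'a bop"
  show "S * T * U = S * (T * U)"
    by transfer (auto intro!: blinfun_eqI)
  show "1 * S = S"
    by transfer (auto intro!: blinfun_eqI)
  show "S * 1 = S"
    by transfer (auto intro!: blinfun_eqI)
  show "(S + T) * U = S * U + T * U"
    by transfer (auto intro!: blinfun_eqI simp: blinfun.add_left)
  show "S * (T + U) = S * T + S * U"
    by transfer (auto intro!: blinfun_eqI simp: blinfun.add_left blinfun.add_right)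
  show "r *\<^sub>R S * T = r *\<^sub>R (S * T)"
    by transfer (auto intro!: blinfun_eqI simp: blinfun.scaleR_left)
  show "S * r *\<^sub>R T = r *\<^sub>R (S * T)"
    by transfer (auto intro!: blinfun_eqI simp: blinfun.scaleR_left blinfun.scaleR_right)
  show "norm (S * T) \<le> norm S * norm T"
    by transfer (rule norm_blinfun_compose)
qed

end

instance bop :: (complex_banach) complex_banach
proof
  fix X :: "nat \<Rightarrow> 'a bop"
  assume "Cauchy X"
  have dist_eq: "dist S T = dist (blinfun_of_bop S) (blinfun_of_bop T)" for S T :: "'a bop"
    by (simp add: dist_norm norm_bop.rep_eq minus_bop.rep_eq)
  have "Cauchy (\<lambda>n. blinfun_of_bop (X n))"
    using \<open>Cauchy X\<close> by (simp add: Cauchy_def dist_eq)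
  then obtain f where f: "(\<lambda>n. blinfun_of_bop (X n)) \<longlonglongrightarrow> f"
    by (auto simp: Cauchy_convergent_iff convergent_def)
  have lim: "(\<lambda>n. blinfun_apply (blinfun_of_bop (X n)) x) \<longlonglongrightarrow> blinfun_apply f x" for x
    by (intro tendsto_intros f)
  have "blinfun_apply f (c *\<^sub>C x) = c *\<^sub>C blinfun_apply f x" for c x
  proof (rule LIMSEQ_unique[OF lim])
    have "(\<lambda>n. c *\<^sub>C blinfun_apply (blinfun_of_bop (X n)) x) \<longlonglongrightarrow> c *\<^sub>C blinfun_apply f x"
      by (rule bounded_linear.tendsto[OF bounded_linear_scaleC lim])
    then show "(\<lambda>n. blinfun_apply (blinfun_of_bop (X n)) (c *\<^sub>C x)) \<longlonglongrightarrow> c *\<^sub>C blinfun_apply f x"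
      using blinfun_of_bop[of "X _"] by simp
  qed
  then have "blinfun_of_bop (bop_of_blinfun f) = f"
    by (simp add: bop_of_blinfun_inverse)
  then have "X \<longlonglongrightarrow> bop_of_blinfun f"
    using f by (simp add: tendsto_iff dist_eq)
  then show "convergent X"
    by (auto simp: convergent_def)
qed

definition left_mult :: "'a::complex_normed_vector bop \<Rightarrow> 'a bop bop" where
  "left_mult A = bop_of_blinfun (blinfun_mult_right A)"

definition right_mult :: "'a::complex_normed_vector bop \<Rightarrow> 'a bop bop" where
  "right_mult A = bop_of_blinfun (blinfun_mult_left A)"

lemma scaleC_mult_bop:
  fixes S T :: "'a::complex_normed_vector bop"
  shows "c *\<^sub>C S * T = c *\<^sub>C (S * T)" and "S * c *\<^sub>C T = c *\<^sub>C (S * T)"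
  by (transfer; auto intro!: blinfun_eqI simp: blinfun_scaleC.rep_eq)+

lemma app_left_mult: "app (left_mult A) T = A * T"
  by (simp add: left_mult_def app.rep_eq bop_of_blinfun_inverse scaleC_mult_bop)

lemma app_right_mult: "app (right_mult A) T = T * A"
  by (simp add: right_mult_def app.rep_eq bop_of_blinfun_inverse scaleC_mult_bop)

lemma app_times: "app (S * T) x = app S (app T x)"
  by transfer simp

lemma app_one: "app 1 x = x"
  by transfer simp

lemma app_diff: "app (S - T) x = app S x - app T x"
  by transfer (simp add: blinfun.diff_left)

lemma app_scaleC: "app (c *\<^sub>C T) x = c *\<^sub>C app T x"
  by transfer (simp add: blinfun_scaleC.rep_eq)


section \<open>Dimensions\<close>

definition cdim :: "'a::complex_normed_vector set \<Rightarrow> enat" where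
  "cdim V = (if \<exists>B. finite B \<and> V \<subseteq> complex_vector.span B
             then enat (complex_vector.dim V) else \<infinity>)"

text \<open>For a subspace \<open>N\<close> of \<open>M\<close>, the cosets \<open>b + N\<close> with \<open>b \<in> B\<close> are pairwise distinct and form a
  finite basis of the quotient \<open>M / N\<close>.\<close>

definition quotient_basis :: "'a::complex_normed_vector set \<Rightarrow> 'a set \<Rightarrow> 'a set \<Rightarrow> bool" where
  "quotient_basis M N B \<longleftrightarrow> finite B \<and> B \<subseteq> M \<and>
     (\<forall>c. (\<Sum>b\<in>B. c b *\<^sub>C b) \<in> N \<longrightarrow> (\<forall>b\<in>B. c b = 0)) \<and>
     (\<forall>x\<in>M. \<exists>c. x - (\<Sum>b\<in>B. c b *\<^sub>C b) \<in> N)"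

definition quotient_cdim :: "'a::complex_normed_vector set \<Rightarrow> 'a set \<Rightarrow> enat" where
  "quotient_cdim M N = (if \<exists>B. quotient_basis M N B
                        then enat (card (SOME B. quotient_basis M N B)) else \<infinity>)"


section \<open>Semi-Fredholm operators\<close>

definition null_space :: "'a::complex_normed_vector bop \<Rightarrow> 'a set" where
  "null_space T = {x. app T x = 0}"

text \<open>In this section \<open>M\<close> is a closed \<open>T\<close>-invariant subspace, and the notions are those of the
  restriction of \<open>T\<close> to an operator on the Banach space \<open>M\<close>. The case \<open>M = UNIV\<close> is \<open>T\<close> itself.\<close>

definition alpha_on :: "'a::complex_normed_vector set \<Rightarrow> 'a bop \<Rightarrow> enat" where
  "alpha_on M T = cdim (M \<inter> null_space T)"

definition beta_on :: "'a::complex_normed_vector set \<Rightarrow> 'a bop \<Rightarrow> enat" where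
  "beta_on M T = quotient_cdim M (app T ` M)"

definition upper_semi_fredholm_on :: "'a::complex_normed_vector set \<Rightarrow> 'a bop \<Rightarrow> bool" where
  "upper_semi_fredholm_on M T \<longleftrightarrow> closedin (top_of_set M) (app T ` M) \<and> alpha_on M T < \<infinity>"

text \<open>Only meaningful when \<open>alpha_on M T < \<infinity>\<close>; the value is then an integer or \<open>- \<infinity>\<close>.\<close>

definition index_on :: "'a::complex_normed_vector set \<Rightarrow> 'a bop \<Rightarrow> ereal" where
  "index_on M T = ereal_of_enat (alpha_on M T) - ereal_of_enat (beta_on M T)"

abbreviation alpha :: "'a::complex_normed_vector bop \<Rightarrow> enat" where
  "alpha \<equiv> alpha_on UNIV"

abbreviation upper_semi_fredholm :: "'a::complex_normed_vector bop \<Rightarrow> bool" where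
  "upper_semi_fredholm \<equiv> upper_semi_fredholm_on UNIV"

abbreviation index :: "'a::complex_normed_vector bop \<Rightarrow> ereal" where
  "index \<equiv> index_on UNIV"

definition semi_B_fredholm_at :: "nat \<Rightarrow> 'a::complex_normed_vector bop \<Rightarrow> bool" where
  "semi_B_fredholm_at n T \<longleftrightarrow>
     closed (range (app (T ^ n))) \<and> upper_semi_fredholm_on (range (app (T ^ n))) T"

definition upper_semi_B_fredholm :: "'a::complex_normed_vector bop \<Rightarrow> bool" where
  "upper_semi_B_fredholm T \<longleftrightarrow> (\<exists>n. semi_B_fredholm_at n T)"

text \<open>The index does not depend on the admissible \<open>n\<close>; the least one is used.\<close>

definition B_index :: "'a::complex_normed_vector bop \<Rightarrow> ereal" where
  "B_index T = index_on (range (app (T ^ (LEAST n. semi_B_fredholm_at n T)))) T"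


section \<open>Parts of the spectrum\<close>

definition bounded_below :: "'a::complex_normed_vector bop \<Rightarrow> bool" where
  "bounded_below T \<longleftrightarrow> null_space T = {0} \<and> closed (range (app T))"

definition sigma_a :: "'a::complex_normed_vector bop \<Rightarrow> complex set" where
  "sigma_a T = {\<mu>. \<not> bounded_below (T - \<mu> *\<^sub>C 1)}"

definition sigma_aw :: "'a::complex_normed_vector bop \<Rightarrow> complex set" where
  "sigma_aw T = {\<mu> \<in> sigma_a T.
     \<not> upper_semi_fredholm (T - \<mu> *\<^sub>C 1) \<or> 0 < index (T - \<mu> *\<^sub>C 1)}"

definition sigma_SBF :: "'a::complex_normed_vector bop \<Rightarrow> complex set" where
  "sigma_SBF T = {\<mu>. \<not> upper_semi_B_fredholm (T - \<mu> *\<^sub>C 1) \<or> 0 < B_index (T - \<mu> *\<^sub>C 1)}"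

definition ascent :: "'a::complex_normed_vector bop \<Rightarrow> enat" where
  "ascent T = (if \<exists>n. null_space (T ^ n) = null_space (T ^ Suc n)
               then enat (LEAST n. null_space (T ^ n) = null_space (T ^ Suc n)) else \<infinity>)"

definition Pi_a :: "'a::complex_normed_vector bop \<Rightarrow> complex set" where
  "Pi_a T = {\<mu>. \<mu> isolated_in sigma_a T \<and>
     (\<exists>a. ascent (T - \<mu> *\<^sub>C 1) = enat a \<and> closed (range (app ((T - \<mu> *\<^sub>C 1) ^ (a + 1)))))}"

definition Pi_a0 :: "'a::complex_normed_vector bop \<Rightarrow> complex set" where
  "Pi_a0 T = {\<mu> \<in> Pi_a T. alpha (T - \<mu> *\<^sub>C 1) < \<infinity>}"

definition a_Browder :: "'a::complex_normed_vector bop \<Rightarrow> bool" where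
  "a_Browder T \<longleftrightarrow> sigma_aw T = sigma_a T - Pi_a0 T"


section \<open>Hilbert spaces\<close>

text \<open>A Banach space is a Hilbert space if its norm comes from an inner product; here \<open>ip\<close> is such
  an inner product, linear in the first argument. Positive definiteness is contained in the last
  clause.\<close>

definition hilbert_inner :: "('a::complex_banach \<Rightarrow> 'a \<Rightarrow> complex) \<Rightarrow> bool" where
  "hilbert_inner ip \<longleftrightarrow>
     (\<forall>x y z. ip (x + y) z = ip x z + ip y z) \<and>
     (\<forall>c x y. ip (c *\<^sub>C x) y = c * ip x y) \<and>
     (\<forall>x y. ip y x = cnj (ip x y)) \<and>
     (\<forall>x. ip x x = complex_of_real ((norm x)\<^sup>2))"

text \<open>The operator \<open>B\<close> below exists by the Riesz representation theorem, and is unique.\<close>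

definition hilbert_adjoint ::
    "('a::complex_banach \<Rightarrow> 'a \<Rightarrow> complex) \<Rightarrow> 'a bop \<Rightarrow> 'a bop" where
  "hilbert_adjoint ip A = (THE B. \<forall>x y. ip (app A x) y = ip x (app B y))"

end

theory Submission
  imports Defs
begin

text \<open>Call \<open>T\<close> left Drazin invertible if, for some \<open>n\<close>, the ranges \<open>R(T^n)\<close> and \<open>R(T^(n+1))\<close> are
  closed and \<open>T\<close> is injective on \<open>R(T^n)\<close>. Such a \<open>T\<close> is bounded below on \<open>R(T^n)\<close>, hence \<open>T - \<mu>\<close> is
  bounded below for small \<open>\<mu> \<noteq> 0\<close>, and \<open>\<Pi>\<^sup>a(T)\<close> consists of the points \<open>\<mu> \<in> \<sigma>\<^sub>a(T)\<close> with
  \<open>T - \<mu>\<close> left Drazin invertible (\<open>Pi_a_eq\<close>).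

  The main step is that \<open>a\<close>-Browder's theorem for \<open>T\<close> is equivalent to
  \<open>\<sigma>\<^bsub>SBF\<^esub>(T) = \<sigma>\<^sub>a(T) - \<Pi>\<^sup>a(T)\<close> (\<open>a_Browder_iff\<close>). Left Drazin invertible operators are upper semi
  B-Fredholm of index at most \<open>0\<close>, because the sign of the index is the same on all ranges \<open>R(T^n)\<close> of finite
  nullity (\<open>alpha_le_beta_image_iff\<close>) and the kernel is trivial on a far range; so one inclusion
  always holds. For the other one let \<open>T - \<mu>\<close> be upper semi B-Fredholm of index at most \<open>0\<close> and
  restrict it to a range \<open>R((T - \<mu>)^n)\<close> on which the kernel has become stable. There the operator is
  a finite-rank perturbation of one that is bounded below, so the operators \<open>T - \<mu> - \<nu>\<close> are
  upper semi-Fredholm of index at most \<open>0\<close> for small \<open>\<nu> \<noteq> 0\<close> (\<open>index_nonpos_perturbation\<close>). If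
  the stable kernel is nonzero, its vectors continue to null vectors of \<open>T - \<mu> - \<nu>\<close>
  (\<open>null_vector_perturbation\<close>), and \<open>a\<close>-Browder's theorem would make each point of a punctured disc
  in \<open>\<sigma>\<^sub>a(T)\<close> isolated in \<open>\<sigma>\<^sub>a(T)\<close>.

  For \<open>\<Phi> = L\<^sub>A\<close> or \<open>\<Phi> = R\<^sub>A\<close> the spaces \<open>N(\<Phi> - \<mu>) \<inter> R((\<Phi> - \<mu>)^n)\<close> are one-sided ideals of
  \<open>B(X)\<close>, hence zero or infinite-dimensional. So upper semi B-Fredholm implies left Drazin invertible,
  which gives the equality \<open>\<sigma>\<^bsub>SBF\<^esub>(\<Phi>) = \<sigma>\<^sub>a(\<Phi>) - \<Pi>\<^sup>a(\<Phi>)\<close> and with it the first claim. Testing on rank-one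
  operators yields \<open>\<sigma>\<^sub>a(L\<^sub>A) = \<sigma>\<^sub>a(A)\<close> and \<open>\<Pi>\<^sup>a(L\<^sub>A) \<subseteq> \<Pi>\<^sup>a(A)\<close>, and the second claim compares
  \<open>\<sigma>\<^bsub>SBF\<^esub>(A)\<close> with the two differences \<open>\<sigma>\<^sub>a(A) - \<Pi>\<^sup>a(A) \<subseteq> \<sigma>\<^sub>a(A) - \<Pi>\<^sup>a(L\<^sub>A)\<close>. On a Hilbert space kernels have
  closed complements, so \<open>\<Pi>\<^sup>a(B) = \<Pi>\<^sup>a(L\<^sub>B)\<close> for every \<open>B\<close>, and taking adjoints turns \<open>R\<^sub>A\<close> into left
  multiplication by \<open>A\<^sup>*\<close>; this is the third claim.\<close>

section \<open>Linear algebra modulo a subspace\<close>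

abbreviation cspan :: "'a::complex_normed_vector set \<Rightarrow> 'a set" where
  "cspan \<equiv> complex_vector.span"

abbreviation csubspace :: "'a::complex_normed_vector set \<Rightarrow> bool" where
  "csubspace \<equiv> complex_vector.subspace"

text \<open>Linear independence in the quotient by the span of \<open>V\<close>, expressed through spans in the ambient
  space, so that elements of the quotient never have to be formed.\<close>

definition indep_mod :: "'a::complex_normed_vector set \<Rightarrow> 'a set \<Rightarrow> bool" where
  "indep_mod V E \<longleftrightarrow> (\<forall>e\<in>E. e \<notin> cspan ((E - {e}) \<union> V))"

lemma indep_mod_empty: "indep_mod {} E \<longleftrightarrow> complex_vector.independent E"
  by (simp add: indep_mod_def complex_vector.dependent_def)

lemma indep_mod_subset: "indep_mod V E \<Longrightarrow> F \<subseteq> E \<Longrightarrow> indep_mod V F"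
  unfolding indep_mod_def
  by (meson Diff_mono Un_mono complex_vector.span_mono order_refl subsetD)

lemma indep_mod_antimono: "indep_mod V E \<Longrightarrow> U \<subseteq> V \<Longrightarrow> indep_mod U E"
  unfolding indep_mod_def by (meson Un_mono complex_vector.span_mono order_refl subsetD)

lemma indep_mod_insert:
  assumes "indep_mod V E" and "x \<notin> cspan (E \<union> V)"
  shows "indep_mod V (insert x E)"
  unfolding indep_mod_def
proof
  fix e assume e: "e \<in> insert x E"
  have xE: "x \<notin> E" using assms(2) complex_vector.span_base by blast
  show "e \<notin> cspan (insert x E - {e} \<union> V)"
  proof (cases "e = x")
    case True then show ?thesis using assms(2) xE by simp
  next
    case False
    then have eE: "e \<in> E" using e by simp
    have *: "insert x E - {e} \<union> V = insert x ((E - {e}) \<union> V)" using False by auto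
    show ?thesis
    proof
      assume "e \<in> cspan (insert x E - {e} \<union> V)"
      then have "x \<in> cspan (insert e ((E - {e}) \<union> V))"
        using complex_vector.in_span_insert[of e x "(E - {e}) \<union> V"] assms(1) eE
        unfolding * indep_mod_def by blast
      moreover have "insert e ((E - {e}) \<union> V) = E \<union> V" using eE by auto
      ultimately show False using assms(2) by simp
    qed
  qed
qed

lemma span_exchange_one:
  assumes "finite F" "e \<in> cspan (F \<union> Q)" "e \<notin> cspan Q"
  shows "\<exists>f\<in>F. f \<in> cspan (insert e ((F - {f}) \<union> Q))"
  using assms
proof (induction F rule: finite_induct)
  case empty then show ?case by simp
next
  case (insert g F)
  show ?case
  proof (cases "e \<in> cspan (F \<union> Q)")
    case True
    then obtain f where f: "f \<in> F" "f \<in> cspan (insert e ((F - {f}) \<union> Q))"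
      using insert by blast
    have "insert e ((F - {f}) \<union> Q) \<subseteq> insert e ((insert g F - {f}) \<union> Q)" by auto
    then show ?thesis using f complex_vector.span_mono by (metis insertI2 subsetD)
  next
    case False
    have "e \<in> cspan (insert g (F \<union> Q))" using insert.prems(1) by simp
    then have "g \<in> cspan (insert e (F \<union> Q))"
      using False by (rule complex_vector.in_span_insert)
    then show ?thesis using insert.hyps by auto
  qed
qed

text \<open>The Steinitz exchange lemma in the quotient by the span of \<open>V\<close>.\<close>

lemma exchange_mod:
  assumes "finite E" "finite B" "indep_mod V E" "E \<subseteq> cspan (B \<union> V)"
  shows "\<exists>F\<subseteq>B. card E + card F \<le> card B \<and> B \<subseteq> cspan (E \<union> F \<union> V)"
  using assms
proof (induction E rule: finite_induct)
  case empty then show ?case by (auto intro!: exI[of _ B] complex_vector.span_base)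
next
  case (insert e E)
  have "indep_mod V E" using insert.prems indep_mod_subset by blast
  then obtain F where F: "F \<subseteq> B" "card E + card F \<le> card B" "B \<subseteq> cspan (E \<union> F \<union> V)"
    using insert by auto
  have "e \<notin> cspan (E \<union> V)"
    using insert.prems(2) insert.hyps(2) unfolding indep_mod_def by auto
  moreover have "B \<union> V \<subseteq> cspan (E \<union> F \<union> V)"
    using F(3) complex_vector.span_superset[of "E \<union> F \<union> V"] by blast
  then have "cspan (B \<union> V) \<subseteq> cspan (E \<union> F \<union> V)"
    by (rule complex_vector.span_minimal) simp
  then have "e \<in> cspan (F \<union> (E \<union> V))" using insert.prems(3) by (auto simp: Un_ac)
  moreover have finF: "finite F" using F(1) insert.prems(1) finite_subset by blast
  ultimately obtain f where f: "f \<in> F" "f \<in> cspan (insert e ((F - {f}) \<union> (E \<union> V)))"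
    using span_exchange_one[of F e "E \<union> V"] by blast
  let ?S = "insert e E \<union> (F - {f}) \<union> V"
  have S: "insert e ((F - {f}) \<union> (E \<union> V)) = ?S" by auto
  have "E \<union> F \<union> V \<subseteq> cspan ?S"
    using f(2) complex_vector.span_superset[of ?S] unfolding S by blast
  then have "cspan (E \<union> F \<union> V) \<subseteq> cspan ?S"
    by (rule complex_vector.span_minimal) simp
  then have "B \<subseteq> cspan ?S" using F(3) by blast
  moreover have "card (insert e E) + card (F - {f}) \<le> card B"
    using F(2) f(1) finF insert.hyps card_gt_0_iff[of F] by (simp add: card_Diff_singleton) fastforce
  ultimately show ?case using F(1) by (intro exI[of _ "F - {f}"]) auto
qed

lemma indep_mod_card_le:
  assumes "finite E" "finite B" "indep_mod V E" "E \<subseteq> cspan (B \<union> V)"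
  shows "card E \<le> card B"
  using exchange_mod[OF assms] by auto

text \<open>Adding elements of \<open>M\<close> outside the current span either continues up to \<open>a\<close> elements or stops
  at a family that spans.\<close>

lemma indep_mod_family_or_spanning:
  "(\<exists>E\<subseteq>M. finite E \<and> card E = a \<and> indep_mod V E) \<or>
   (\<exists>B\<subseteq>M. finite B \<and> indep_mod V B \<and> M \<subseteq> cspan (B \<union> V))"
proof (induction a)
  case 0 show ?case by (rule disjI1, rule exI[of _ "{}"]) (auto simp: indep_mod_def)
next
  case (Suc a)
  show ?case
  proof (cases "\<exists>B\<subseteq>M. finite B \<and> indep_mod V B \<and> M \<subseteq> cspan (B \<union> V)")
    case False
    then obtain E where E: "E \<subseteq> M" "finite E" "card E = a" "indep_mod V E" using Suc by auto
    then obtain x where x: "x \<in> M" "x \<notin> cspan (E \<union> V)" using False by blast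
    have "x \<notin> E" using x(2) complex_vector.span_base[of x "E \<union> V"] by auto
    then have "insert x E \<subseteq> M \<and> finite (insert x E) \<and> card (insert x E) = Suc a \<and>
        indep_mod V (insert x E)"
      using E x(1) indep_mod_insert[OF E(4) x(2)] by simp
    then show ?thesis by blast
  qed simp
qed

text \<open>Turns inequalities between nullity and deficiency into statements about families of equal size.\<close>

lemma enat_le_iff_all: "a \<le> (b::enat) \<longleftrightarrow> (\<forall>n. enat n \<le> a \<longrightarrow> enat n \<le> b)"
proof -
  have "\<forall>n. enat n \<le> a \<longrightarrow> enat n \<le> b \<Longrightarrow> a \<le> b"
    by (cases a; cases b) (auto, metis Suc_n_not_le_n)
  then show ?thesis by (auto intro: order_trans)
qed

text \<open>The two dimension functions are \<open>enat\<close>-valued and defined by case distinctions. Describing them by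
  the sizes of independent families treats finite and infinite values alike.\<close>

lemma le_cdim_iff:
  assumes "csubspace V"
  shows "enat a \<le> cdim V \<longleftrightarrow> (\<exists>E\<subseteq>V. finite E \<and> card E = a \<and> complex_vector.independent E)"
proof (cases "\<exists>B. finite B \<and> V \<subseteq> cspan B")
  case True
  then obtain B where B: "finite B" "V \<subseteq> cspan B" by blast
  obtain C where C: "C \<subseteq> V" "complex_vector.independent C" "V \<subseteq> cspan C"
      "card C = complex_vector.dim V"
    using complex_vector.basis_exists by blast
  have finC: "finite C"
    using complex_vector.independent_span_bound[OF B(1) C(2)] C(1) B(2) by blast
  have cd: "cdim V = enat (card C)" using True C(4) by (simp add: cdim_def)
  show ?thesis
  proof
    assume "enat a \<le> cdim V"
    then have "a \<le> card C" using cd by simp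
    then obtain E where "E \<subseteq> C" "card E = a" "finite E" using obtain_subset_with_card_n by blast
    then show "\<exists>E\<subseteq>V. finite E \<and> card E = a \<and> complex_vector.independent E"
      using C(1) complex_vector.independent_mono[OF C(2), of E] by auto
  next
    assume "\<exists>E\<subseteq>V. finite E \<and> card E = a \<and> complex_vector.independent E"
    then obtain E where "E \<subseteq> V" "card E = a" "complex_vector.independent E" by blast
    then show "enat a \<le> cdim V"
      using complex_vector.independent_span_bound[OF finC, of E] C(3) cd by auto
  qed
next
  case False
  then have "\<nexists>B. B \<subseteq> V \<and> finite B \<and> indep_mod {} B \<and> V \<subseteq> cspan (B \<union> {})" by auto
  then have "\<exists>E\<subseteq>V. finite E \<and> card E = a \<and> indep_mod {} E"
    using indep_mod_family_or_spanning[of V a "{}"] by blast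
  moreover have "cdim V = \<infinity>" unfolding cdim_def using False by (rule if_not_P)
  ultimately show ?thesis by (simp add: indep_mod_empty)
qed

lemma cspan_Un_subspace:
  assumes V: "csubspace V" and fin: "finite C"
  shows "cspan (C \<union> V) = {(\<Sum>b\<in>C. c b *\<^sub>C b) + v | c v. v \<in> V}"
  unfolding complex_vector.span_Un complex_vector.span_finite[OF fin]
  using V by (auto simp: complex_vector.span_eq_iff[THEN iffD2])

lemma indep_mod_iff_sum:
  assumes V: "csubspace V" and fin: "finite B"
  shows "indep_mod V B \<longleftrightarrow> (\<forall>c. (\<Sum>b\<in>B. c b *\<^sub>C b) \<in> V \<longrightarrow> (\<forall>b\<in>B. c b = 0))"
proof
  assume ind: "indep_mod V B"
  show "\<forall>c. (\<Sum>b\<in>B. c b *\<^sub>C b) \<in> V \<longrightarrow> (\<forall>b\<in>B. c b = 0)"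
  proof (intro allI impI ballI, rule ccontr)
    fix c b assume s: "(\<Sum>b\<in>B. c b *\<^sub>C b) \<in> V" and b: "b \<in> B" and cb: "c b \<noteq> 0"
    let ?r = "\<Sum>b\<in>B - {b}. c b *\<^sub>C b"
    have "(\<Sum>b\<in>B. c b *\<^sub>C b) = c b *\<^sub>C b + ?r" using fin b by (simp add: sum.remove)
    then have "c b *\<^sub>C b = (\<Sum>b\<in>B. c b *\<^sub>C b) - ?r" by simp
    also have "\<dots> \<in> cspan ((B - {b}) \<union> V)"
    proof (rule complex_vector.span_diff)
      show "(\<Sum>b\<in>B. c b *\<^sub>C b) \<in> cspan ((B - {b}) \<union> V)"
        using s by (auto intro: complex_vector.span_base)
      show "?r \<in> cspan ((B - {b}) \<union> V)"
        by (intro complex_vector.span_sum complex_vector.span_scale complex_vector.span_base) auto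
    qed
    finally have "inverse (c b) *\<^sub>C (c b *\<^sub>C b) \<in> cspan ((B - {b}) \<union> V)"
      by (rule complex_vector.span_scale)
    then have "b \<in> cspan ((B - {b}) \<union> V)" using cb by (simp add: scaleC_scaleC scaleC_one)
    then show False using ind b unfolding indep_mod_def by blast
  qed
next
  assume ind: "\<forall>c. (\<Sum>b\<in>B. c b *\<^sub>C b) \<in> V \<longrightarrow> (\<forall>b\<in>B. c b = 0)"
  show "indep_mod V B"
    unfolding indep_mod_def
  proof (intro ballI notI)
    fix b assume b: "b \<in> B" and "b \<in> cspan ((B - {b}) \<union> V)"
    then obtain c v where c: "b = (\<Sum>b\<in>B - {b}. c b *\<^sub>C b) + v" "v \<in> V"
      using cspan_Un_subspace[OF V, of "B - {b}"] fin by auto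
    let ?c = "c(b := -1)"
    have "(\<Sum>d\<in>B. ?c d *\<^sub>C d) = ?c b *\<^sub>C b + (\<Sum>d\<in>B - {b}. ?c d *\<^sub>C d)"
      using fin b by (simp add: sum.remove)
    also have "(\<Sum>d\<in>B - {b}. ?c d *\<^sub>C d) = (\<Sum>d\<in>B - {b}. c d *\<^sub>C d)"
      by (rule sum.cong) auto
    also have "?c b *\<^sub>C b + \<dots> = - v"
    proof -
      have "?c b *\<^sub>C b = - b" by (simp add: scaleC_one)
      moreover have "(\<Sum>d\<in>B - {b}. c d *\<^sub>C d) = b - v"
        using c(1) by (metis add_diff_cancel_right')
      ultimately show ?thesis by simp
    qed
    finally have "(\<Sum>d\<in>B. ?c d *\<^sub>C d) \<in> V" using c(2) V by (simp add: complex_vector.subspace_neg)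
    then have "?c b = 0" using ind b by blast
    then show False by simp
  qed
qed

lemma quotient_basis_iff:
  assumes V: "csubspace V"
  shows "quotient_basis M V B \<longleftrightarrow> finite B \<and> B \<subseteq> M \<and> indep_mod V B \<and> M \<subseteq> cspan (B \<union> V)"
proof -
  have "M \<subseteq> cspan (B \<union> V) \<longleftrightarrow> (\<forall>x\<in>M. \<exists>c. x - (\<Sum>b\<in>B. c b *\<^sub>C b) \<in> V)" if fin: "finite B"
  proof -
    have "x \<in> cspan (B \<union> V) \<longleftrightarrow> (\<exists>c. x - (\<Sum>b\<in>B. c b *\<^sub>C b) \<in> V)" for x
    proof
      assume "x \<in> cspan (B \<union> V)"
      then obtain c v where "x = (\<Sum>b\<in>B. c b *\<^sub>C b) + v" "v \<in> V" unfolding cspan_Un_subspace[OF V fin] by blast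
      then have "x - (\<Sum>b\<in>B. c b *\<^sub>C b) \<in> V" by simp
      then show "\<exists>c. x - (\<Sum>b\<in>B. c b *\<^sub>C b) \<in> V" by blast
    next
      assume "\<exists>c. x - (\<Sum>b\<in>B. c b *\<^sub>C b) \<in> V"
      then obtain c where "x - (\<Sum>b\<in>B. c b *\<^sub>C b) \<in> V" by blast
      moreover have "x = (\<Sum>b\<in>B. c b *\<^sub>C b) + (x - (\<Sum>b\<in>B. c b *\<^sub>C b))" by simp
      ultimately show "x \<in> cspan (B \<union> V)" unfolding cspan_Un_subspace[OF V fin] by blast
    qed
    then show ?thesis by blast
  qed
  then show ?thesis unfolding quotient_basis_def using indep_mod_iff_sum[OF V] by blast
qed

lemma le_quotient_cdim_iff:
  assumes "csubspace V"
  shows "enat a \<le> quotient_cdim M V \<longleftrightarrow> (\<exists>E\<subseteq>M. finite E \<and> card E = a \<and> indep_mod V E)"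
proof (cases "\<exists>B. quotient_basis M V B")
  case True
  define B where "B = (SOME B. quotient_basis M V B)"
  have "quotient_basis M V B" unfolding B_def using True by (rule someI_ex)
  then have B: "finite B" "B \<subseteq> M" "indep_mod V B" "M \<subseteq> cspan (B \<union> V)"
    by (auto simp: quotient_basis_iff[OF assms])
  have q: "quotient_cdim M V = enat (card B)" using True by (simp add: quotient_cdim_def B_def)
  show ?thesis
  proof
    assume "enat a \<le> quotient_cdim M V"
    then have "a \<le> card B" using q by simp
    then obtain E where "E \<subseteq> B" "card E = a" "finite E" using obtain_subset_with_card_n by blast
    then show "\<exists>E\<subseteq>M. finite E \<and> card E = a \<and> indep_mod V E"
      using B(2) indep_mod_subset[OF B(3), of E] by auto
  next
    assume "\<exists>E\<subseteq>M. finite E \<and> card E = a \<and> indep_mod V E"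
    then obtain E where "E \<subseteq> M" "finite E" "card E = a" "indep_mod V E" by blast
    then show "enat a \<le> quotient_cdim M V"
      using indep_mod_card_le[of E B V] B q by auto
  qed
next
  case False
  then have "\<exists>E\<subseteq>M. finite E \<and> card E = a \<and> indep_mod V E"
    using indep_mod_family_or_spanning[of M a V] by (auto simp: quotient_basis_iff[OF assms])
  then show ?thesis using False by (simp add: quotient_cdim_def)
qed

lemma cdim_mono:
  assumes "csubspace U" "csubspace V" "U \<subseteq> V"
  shows "cdim U \<le> cdim V"
  unfolding enat_le_iff_all[of "cdim U"] le_cdim_iff[OF assms(1)] le_cdim_iff[OF assms(2)]
  using assms(3) by (metis subset_trans)

lemma finite_cdim_basis:
  assumes "csubspace V" "cdim V < \<infinity>"
  obtains E where "finite E" "complex_vector.independent E" "V = cspan E" "cdim V = enat (card E)"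
proof -
  have "\<exists>B. finite B \<and> V \<subseteq> cspan B"
  proof (rule ccontr)
    assume "\<nexists>B. finite B \<and> V \<subseteq> cspan B"
    then have "cdim V = \<infinity>" unfolding cdim_def by (rule if_not_P)
    then show False using assms(2) by simp
  qed
  then obtain B where B: "finite B" "V \<subseteq> cspan B" by blast
  obtain C where C: "C \<subseteq> V" "complex_vector.independent C" "V \<subseteq> cspan C"
      "card C = complex_vector.dim V"
    using complex_vector.basis_exists by blast
  have "finite C"
    using complex_vector.independent_span_bound[OF B(1) C(2)] C(1) B(2) by blast
  moreover have "cspan C = V" using C(1,3) assms(1) complex_vector.span_minimal[of C V] by auto
  moreover have "cdim V = enat (card C)" unfolding cdim_def C(4) using B by auto
  ultimately show thesis using that C(2) by blast
qed

lemma cdim_finite_span: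
  assumes "finite E" "V \<subseteq> cspan E"
  shows "cdim V < \<infinity>"
  using assms unfolding cdim_def by auto

lemma cdim_eq_subspace:
  assumes "csubspace U" "csubspace V" "U \<subseteq> V" "cdim U = cdim V" "cdim V < \<infinity>"
  shows "U = V"
proof -
  obtain E where E: "finite E" "complex_vector.independent E" "U = cspan E" "cdim U = enat (card E)"
    using finite_cdim_basis assms by metis
  have "x \<in> U" if x: "x \<in> V" for x
  proof (rule ccontr)
    assume "x \<notin> U"
    then have "complex_vector.independent (insert x E)" "x \<notin> E"
      using E complex_vector.independent_insertI[of x E] complex_vector.span_base[of x E] by auto
    moreover have "insert x E \<subseteq> V" using x E(3) assms(3) complex_vector.span_superset[of E] by auto
    ultimately have "enat (Suc (card E)) \<le> cdim V"
      using le_cdim_iff[OF assms(2), of "Suc (card E)"] E(1)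
      by (metis card_insert_disjoint finite_insert)
    then show False using E(4) assms(4) by simp
  qed
  then show ?thesis using assms(3) by blast
qed

section \<open>Open mapping and Hahn-Banach\<close>

lemma csubspace_imp_subspace: "csubspace M \<Longrightarrow> subspace M"
  by (simp add: complex_vector.subspace_def subspace_def scaleR_scaleC)

text \<open>By Baire's theorem one of the sets \<open>f ` (M \<inter> cball 0 n)\<close> is dense in a ball of the image.
  Differences move that ball to the origin, so every \<open>y\<close> in the image can be approximated by
  \<open>f x\<close> with \<open>x\<close> of size proportional to \<open>y\<close>; summing successive corrections solves
  \<open>f x = y\<close> exactly.\<close>

lemma open_mapping:
  fixes f :: "'b::banach \<Rightarrow> 'c::banach"
  assumes f: "bounded_linear f" and M: "subspace M" "closed M" and fM: "closed (f ` M)"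
  obtains C where "C > 0" "\<And>y. y \<in> f ` M \<Longrightarrow> \<exists>x\<in>M. f x = y \<and> norm x \<le> C * norm y"
proof -
  interpret f: bounded_linear f by fact
  define Y where "Y = f ` M"
  have Y: "subspace Y" "closed Y"
    using M fM f.linear_axioms by (auto simp: Y_def linear_subspace_image)
  then have Y0: "0 \<in> Y" by (simp add: subspace_0)
  define D where "D n = closure (f ` (M \<inter> cball 0 (real n)))" for n
  have "\<exists>n. \<not> Y \<subseteq> closure (Y - D n)"
  proof (rule ccontr)
    assume neg: "\<not> ?thesis"
    have "top_of_set Y closure_of \<Inter>(range (\<lambda>n. Y - D n)) = topspace (top_of_set Y)"
    proof (rule Baire_category)
      show "completely_metrizable_space (top_of_set Y) \<or>
          locally_compact_space (top_of_set Y) \<and> regular_space (top_of_set Y)"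
        using completely_metrizable_space_closedin[OF completely_metrizable_space_euclidean] Y(2)
        by auto
      show "countable (range (\<lambda>n. Y - D n))" by simp
      fix T assume "T \<in> range (\<lambda>n. Y - D n)"
      then obtain n where T: "T = Y - D n" by blast
      have "closed (D n)" by (simp add: D_def)
      then have "openin (top_of_set Y) T"
        unfolding T by (simp add: Diff_eq openin_open_Int open_Compl)
      moreover have "top_of_set Y closure_of T = Y"
        using neg unfolding T by (auto simp: closure_of_subtopology Int_absorb1)
      ultimately show "openin (top_of_set Y) T \<and> top_of_set Y closure_of T = topspace (top_of_set Y)"
        by simp
    qed
    moreover have "\<Inter>(range (\<lambda>n. Y - D n)) = {}"
    proof -
      have "\<exists>n. y \<in> D n" if y: "y \<in> Y" for y
      proof -
        obtain x where "x \<in> M" "f x = y" using y by (auto simp: Y_def)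
        moreover obtain n where "norm x \<le> real n" using real_arch_simple by blast
        ultimately have "y \<in> f ` (M \<inter> cball 0 (real n))" by auto
        then show ?thesis unfolding D_def using closure_subset by (metis subsetD)
      qed
      then show ?thesis by auto
    qed
    ultimately show False using Y0 by (simp only: closure_of_empty topspace_euclidean_subtopology) simp
  qed
  then obtain n y0 where y0: "y0 \<in> Y" "y0 \<notin> closure (Y - D n)" by blast
  then obtain r where r: "r > 0" "\<And>y. y \<in> Y \<Longrightarrow> dist y y0 < r \<Longrightarrow> y \<in> D n"
    unfolding closure_approachable by blast
  have near: "\<exists>x\<in>M. norm x \<le> 2 * real n \<and> norm (y - f x) < e"
    if y: "y \<in> Y" "norm y < r" and e: "e > 0" for y e
  proof -
    have "y0 + y \<in> D n" using y y0 Y(1) by (intro r(2)) (auto simp: subspace_add dist_norm)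
    then obtain u where u: "u \<in> M" "norm u \<le> real n" "dist (f u) (y0 + y) < e/2"
      unfolding D_def closure_approachable using e by (auto dest!: spec[of _ "e/2"])
    have "y0 \<in> D n" using y0 r by (intro r(2)) auto
    then obtain v where v: "v \<in> M" "norm v \<le> real n" "dist (f v) y0 < e/2"
      unfolding D_def closure_approachable using e by (auto dest!: spec[of _ "e/2"])
    have "y - f (u - v) = (f v - y0) - (f u - (y0 + y))" by (simp add: f.diff)
    then have "norm (y - f (u - v)) \<le> norm (f v - y0) + norm (f u - (y0 + y))"
      by (metis norm_triangle_ineq4)
    also have "\<dots> < e" using u(3) v(3) by (simp add: dist_norm)
    finally show ?thesis using u v M(1) norm_triangle_ineq4[of u v]
      by (intro bexI[of _ "u - v"]) (auto simp: subspace_diff)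
  qed
  define C where "C = 4 * (real n + 1) / r"
  have C: "C > 0" using r(1) by (simp add: C_def)
  have step: "\<exists>x\<in>M. norm x \<le> C * norm y \<and> norm (y - f x) \<le> norm y / 2" if y: "y \<in> Y" for y
  proof (cases "y = 0")
    case True then show ?thesis using subspace_0[OF M(1)] by (intro bexI[of _ 0]) (auto simp: f.zero)
  next
    case False
    define s where "s = r / (2 * norm y)"
    have s: "s > 0" using False r(1) by (simp add: s_def)
    have "s *\<^sub>R y \<in> Y" using y Y(1) by (simp add: subspace_scale)
    moreover have "norm (s *\<^sub>R y) < r" using s r(1) False by (simp add: s_def)
    moreover have "s * norm y / 2 > 0" using s False by simp
    ultimately obtain x where x: "x \<in> M" "norm x \<le> 2 * real n" "norm (s *\<^sub>R y - f x) < s * norm y / 2"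
      using near by blast
    have "s *\<^sub>R (y - f (inverse s *\<^sub>R x)) = s *\<^sub>R y - f x"
      using s by (simp add: f.scaleR scaleR_diff_right)
    then have "s * norm (y - f (inverse s *\<^sub>R x)) < s * norm y / 2"
      using x(3) s by (metis abs_of_pos norm_scaleR)
    then have "norm (y - f (inverse s *\<^sub>R x)) \<le> norm y / 2" using s by (simp add: field_simps)
    moreover have "norm (inverse s *\<^sub>R x) \<le> C * norm y"
    proof -
      have "norm (inverse s *\<^sub>R x) = inverse s * norm x" using s by simp
      also have "\<dots> \<le> inverse s * (2 * (real n + 1))" using x(2) s by (intro mult_left_mono) auto
      also have "\<dots> = C * norm y" using r(1) False by (simp add: s_def C_def field_simps)
      finally show ?thesis .
    qed
    ultimately show ?thesis using x(1) M(1)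
      by (intro bexI[of _ "inverse s *\<^sub>R x"]) (auto simp: subspace_scale)
  qed
  then obtain g where g: "\<And>y. y \<in> Y \<Longrightarrow> g y \<in> M" "\<And>y. y \<in> Y \<Longrightarrow> norm (g y) \<le> C * norm y"
      "\<And>y. y \<in> Y \<Longrightarrow> norm (y - f (g y)) \<le> norm y / 2" by metis
  have "\<exists>x\<in>M. f x = y \<and> norm x \<le> 2 * C * norm y" if y: "y \<in> Y" for y
  proof -
    define z where "z k = ((\<lambda>y. y - f (g y)) ^^ k) y" for k
    have z0: "z 0 = y" and zS: "z (Suc k) = z k - f (g (z k))" for k by (simp_all add: z_def)
    have zY: "z k \<in> Y" for k
    proof (induction k)
      case (Suc k)
      then show ?case unfolding zS using g(1) Y(1) by (intro subspace_diff) (auto simp: Y_def)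
    qed (simp add: z0 y)
    have zn: "norm (z k) \<le> norm y * (1/2)^k" for k
    proof (induction k)
      case (Suc k)
      then show ?case using g(3)[OF zY[of k]] by (simp add: zS)
    qed (simp add: z0)
    have xn: "norm (g (z k)) \<le> C * norm y * (1/2)^k" for k
      using order_trans[OF g(2)[OF zY[of k]] mult_left_mono[OF zn[of k] less_imp_le[OF C]]]
      by (simp add: mult.assoc)
    have sg: "summable (\<lambda>k. C * norm y * (1/2::real)^k)"
      by (intro summable_mult summable_geometric) simp
    have sn: "summable (\<lambda>k. norm (g (z k)))"
      by (rule summable_comparison_test'[OF sg, of 0]) (use xn in auto)
    then have sm: "summable (\<lambda>k. g (z k))" by (rule summable_norm_cancel)
    define x where "x = (\<Sum>k. g (z k))"
    have lim: "(\<lambda>n. \<Sum>k<n. g (z k)) \<longlonglongrightarrow> x" using summable_LIMSEQ[OF sm] by (simp add: x_def)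
    have "(\<Sum>k<n. g (z k)) \<in> M" for n by (intro subspace_sum M g zY)
    then have xM: "x \<in> M" by (rule closed_sequentially[OF M(2) _ lim])
    have fs: "f (\<Sum>k<n. g (z k)) = y - z n" for n
      by (induction n) (simp_all add: f.zero f.add z0 zS)
    have "z \<longlonglongrightarrow> 0"
    proof (rule tendsto_norm_zero_cancel, rule tendsto_sandwich[OF _ _ tendsto_const])
      show "\<forall>\<^sub>F k in sequentially. norm (z k) \<le> norm y * (1/2)^k" using zn by simp
      show "(\<lambda>k. norm y * (1/2)^k) \<longlonglongrightarrow> 0" by (intro tendsto_mult_right_zero LIMSEQ_power_zero) simp
    qed simp
    then have "(\<lambda>n. y - z n) \<longlonglongrightarrow> y - 0" by (intro tendsto_intros)
    moreover have "(\<lambda>n. f (\<Sum>k<n. g (z k))) \<longlonglongrightarrow> f x" by (rule f.tendsto[OF lim])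
    ultimately have "f x = y" unfolding fs using LIMSEQ_unique[of "\<lambda>n. y - z n" "y - 0" "f x"] by simp
    moreover have "norm x \<le> 2 * C * norm y"
    proof -
      have "norm x \<le> (\<Sum>k. norm (g (z k)))" unfolding x_def by (rule summable_norm[OF sn])
      also have "\<dots> \<le> (\<Sum>k. C * norm y * (1/2)^k)" by (rule suminf_le[OF xn sn sg])
      also have "\<dots> = 2 * C * norm y" by (subst suminf_mult) (simp_all add: suminf_geometric)
      finally show ?thesis .
    qed
    ultimately show ?thesis using xM by blast
  qed
  then show thesis using that[of "2 * C"] C by (simp add: Y_def)
qed

definition sublinear :: "('b::real_vector \<Rightarrow> real) \<Rightarrow> bool" where
  "sublinear q \<longleftrightarrow> (\<forall>x y. q (x + y) \<le> q x + q y) \<and> (\<forall>t x. t \<ge> 0 \<longrightarrow> q (t *\<^sub>R x) = t * q x)"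

text \<open>A lower envelope of \<open>q\<close> along the ray in direction \<open>y\<close>; its value at \<open>- y\<close> is at most \<open>- q y\<close>
  if \<open>q 0 = 0\<close>.\<close>

definition tilt :: "('b::real_vector \<Rightarrow> real) \<Rightarrow> 'b \<Rightarrow> 'b \<Rightarrow> real" where
  "tilt q y x = (INF t\<in>{0..}. q (x + t *\<^sub>R y) - t * q y)"

lemma sublinear_zero: "sublinear q \<Longrightarrow> q 0 = 0"
  unfolding sublinear_def by (metis mult_zero_left order_refl scale_zero_left)

lemma sublinear_ge_neg:
  assumes "sublinear q" shows "- q (- x) \<le> q x"
proof -
  have "q (x + - x) \<le> q x + q (- x)" using assms unfolding sublinear_def by blast
  then show ?thesis using sublinear_zero[OF assms] by simp
qed

lemma tilt_lower_bound:
  assumes "sublinear q" "t \<ge> 0"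
  shows "- q (- x) \<le> q (x + t *\<^sub>R y) - t * q y"
proof -
  have "q (t *\<^sub>R y) \<le> q (x + t *\<^sub>R y) + q (- x)"
    using assms(1) unfolding sublinear_def by (metis add.commute add_minus_cancel add.assoc add_diff_cancel_left' uminus_add_conv_diff)
  then show ?thesis using assms unfolding sublinear_def by simp
qed

lemma tilt_le:
  assumes "sublinear q" "t \<ge> 0"
  shows "tilt q y x \<le> q (x + t *\<^sub>R y) - t * q y"
  unfolding tilt_def
  by (rule cINF_lower) (use assms tilt_lower_bound[OF assms(1)] in \<open>auto intro!: bdd_belowI2\<close>)

lemma tilt_greatest:
  "(\<And>t. t \<ge> 0 \<Longrightarrow> c \<le> q (x + t *\<^sub>R y) - t * q y) \<Longrightarrow> c \<le> tilt q y x"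
  unfolding tilt_def by (rule cINF_greatest) auto

lemma sublinear_tilt:
  assumes q: "sublinear q"
  shows "sublinear (tilt q y)"
proof -
  have add: "q (a + b) \<le> q a + q b" and sc: "t \<ge> 0 \<Longrightarrow> q (t *\<^sub>R a) = t * q a" for a b t
    using q unfolding sublinear_def by auto
  have 1: "tilt q y (a + b) \<le> tilt q y a + tilt q y b" for a b
  proof -
    have "tilt q y (a + b) - tilt q y b \<le> q (a + s *\<^sub>R y) - s * q y" if s: "s \<ge> 0" for s
    proof -
      have "tilt q y (a + b) - (q (a + s *\<^sub>R y) - s * q y) \<le> q (b + t *\<^sub>R y) - t * q y"
        if t: "t \<ge> 0" for t
      proof -
        have "tilt q y (a + b) \<le> q ((a + b) + (s + t) *\<^sub>R y) - (s + t) * q y"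
          using tilt_le[OF q] s t by simp
        also have "(a + b) + (s + t) *\<^sub>R y = (a + s *\<^sub>R y) + (b + t *\<^sub>R y)"
          by (simp add: scaleR_add_left)
        finally show ?thesis using add[of "a + s *\<^sub>R y" "b + t *\<^sub>R y"] by (simp add: algebra_simps)
      qed
      then have "tilt q y (a + b) - (q (a + s *\<^sub>R y) - s * q y) \<le> tilt q y b"
        by (rule tilt_greatest)
      then show ?thesis by simp
    qed
    then have "tilt q y (a + b) - tilt q y b \<le> tilt q y a" by (rule tilt_greatest)
    then show ?thesis by simp
  qed
  have le: "u * tilt q y a \<le> tilt q y (u *\<^sub>R a)" if u: "u > 0" for u a
  proof (rule tilt_greatest)
    fix t :: real assume t: "t \<ge> 0"
    have "tilt q y a \<le> q (a + (t / u) *\<^sub>R y) - (t / u) * q y" using tilt_le[OF q, of "t / u" y a] t u by simp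
    then have "u * tilt q y a \<le> u * q (a + (t / u) *\<^sub>R y) - t * q y"
      using u by (simp add: field_simps)
    also have "u * q (a + (t / u) *\<^sub>R y) = q (u *\<^sub>R a + t *\<^sub>R y)"
      using u sc[of u "a + (t / u) *\<^sub>R y"] by (simp add: scaleR_add_right)
    finally show "u * tilt q y a \<le> q (u *\<^sub>R a + t *\<^sub>R y) - t * q y" .
  qed
  have 0: "tilt q y 0 = 0"
  proof (rule antisym)
    show "tilt q y 0 \<le> 0" using tilt_le[OF q, of 0 y 0] sublinear_zero[OF q] by simp
    show "0 \<le> tilt q y 0" by (rule tilt_greatest) (simp add: sc)
  qed
  have 2: "tilt q y (u *\<^sub>R a) = u * tilt q y a" if u: "u \<ge> 0" for u a
  proof (cases "u = 0")
    case False
    with u have u: "u > 0" by simp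
    have "inverse u * tilt q y (u *\<^sub>R a) \<le> tilt q y a"
      using le[of "inverse u" "u *\<^sub>R a"] u by simp
    then have "tilt q y (u *\<^sub>R a) \<le> u * tilt q y a" using u by (simp add: field_simps)
    then show ?thesis using le[OF u, of a] by simp
  qed (simp add: 0)
  show ?thesis unfolding sublinear_def using 1 2 by blast
qed

lemma tilt_le_self: "sublinear q \<Longrightarrow> tilt q y x \<le> q x"
  using tilt_le[of q 0 y x] by simp

text \<open>Zorn's lemma applies because the functionals below \<open>p\<close> are bounded below by \<open>- p (- x)\<close>, so the
  infimum of a chain is finite; it is sublinear because any two members of a chain are comparable.\<close>

lemma ex_minimal_sublinear:
  assumes p: "sublinear p"
  obtains q where "sublinear q" "q \<le> p" "\<And>r. sublinear r \<Longrightarrow> r \<le> q \<Longrightarrow> r = q"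
proof -
  let ?A = "{q. sublinear q \<and> q \<le> p}"
  let ?P = "\<lambda>q r. r \<le> q"
  have "\<exists>m\<in>?A. \<forall>a\<in>?A. ?P m a \<longrightarrow> a = m"
  proof (rule predicate_Zorn)
    show "partial_order_on ?A (relation_of ?P ?A)"
      by (rule partial_order_on_relation_ofI) auto
    fix C assume "C \<in> Chains (relation_of ?P ?A)"
    then have CA: "C \<subseteq> ?A" and ch: "\<And>a b. a \<in> C \<Longrightarrow> b \<in> C \<Longrightarrow> a \<le> b \<or> b \<le> a"
      unfolding Chains_def relation_of_def by blast+
    show "\<exists>u\<in>?A. \<forall>a\<in>C. ?P a u"
    proof (cases "C = {}")
      case True then show ?thesis using p by auto
    next
      case False
      define u where "u x = (INF q\<in>C. q x)" for x
      have bd: "bdd_below ((\<lambda>q. q x) ` C)" for x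
      proof (rule bdd_belowI2)
        fix q assume "q \<in> C"
        then have "sublinear q" "q \<le> p" using CA by auto
        then show "- p (- x) \<le> q x"
          using sublinear_ge_neg[of q x] le_funD[of q p "- x"] by linarith
      qed
      have lower: "u x \<le> q x" if "q \<in> C" for q x unfolding u_def using that bd by (rule cINF_lower[rotated])
      have greatest: "c \<le> u x" if "\<And>q. q \<in> C \<Longrightarrow> c \<le> q x" for c x
        unfolding u_def using False that by (rule cINF_greatest)
      have sub: "q (a + b) \<le> q a + q b" "t \<ge> 0 \<Longrightarrow> q (t *\<^sub>R a) = t * q a" if "q \<in> C" for q a b t
        using CA that unfolding sublinear_def by auto
      have 1: "u (a + b) \<le> u a + u b" for a b
      proof -
        have "u (a + b) - u b \<le> q a" if q: "q \<in> C" for q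
        proof -
          have "u (a + b) - q a \<le> r b" if r: "r \<in> C" for r
          proof (cases "q \<le> r")
            case True
            then show ?thesis using lower[OF q, of "a + b"] sub(1)[OF q, of a b] le_funD[of q r b] by linarith
          next
            case False
            then have "r \<le> q" using ch q r by blast
            then show ?thesis using lower[OF r, of "a + b"] sub(1)[OF r, of a b] le_funD[of r q a] by linarith
          qed
          then have "u (a + b) - q a \<le> u b" by (rule greatest)
          then show ?thesis by simp
        qed
        then have "u (a + b) - u b \<le> u a" by (rule greatest)
        then show ?thesis by simp
      qed
      have le: "t * u a \<le> u (t *\<^sub>R a)" if t: "t \<ge> 0" for t a
        by (rule greatest) (use lower t in \<open>simp add: sub(2) mult_left_mono\<close>)
      have 2: "u (t *\<^sub>R a) = t * u a" if t: "t \<ge> 0" for t a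
      proof (cases "t = 0")
        case True
        have "u 0 \<le> 0" using False lower[of _ 0] sub(2)[of _ 0 0] by force
        then show ?thesis using le[of 0 a] True by simp
      next
        case False
        with t have t: "t > 0" by simp
        have "inverse t * u (t *\<^sub>R a) \<le> u a" using le[of "inverse t" "t *\<^sub>R a"] t by simp
        then have "u (t *\<^sub>R a) \<le> t * u a" using t by (simp add: field_simps)
        then show ?thesis using le[of t a] t by simp
      qed
      obtain q0 where q0: "q0 \<in> C" using False by blast
      then have "q0 \<le> p" using CA by auto
      then have "u \<le> p" using lower[OF q0] by (meson le_funD le_funI order_trans)
      then have "u \<in> ?A" using 1 2 by (auto simp: sublinear_def)
      then show ?thesis using lower by (auto simp: le_fun_def)
    qed
  qed
  then obtain m where "m \<in> ?A" and m: "\<forall>a\<in>?A. a \<le> m \<longrightarrow> a = m" by blast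
  then show thesis using that[of m] by (metis (mono_tags, lifting) mem_Collect_eq order_trans)
qed

text \<open>For a sublinear \<open>q\<close> and a fixed \<open>y\<close> the tilt of \<open>q\<close> is sublinear and lies below \<open>q\<close>. If \<open>q\<close> is
  minimal for the pointwise order, both agree, and the value of the infimum at \<open>t = 1\<close> gives
  \<open>q x \<le> q (x + y) - q y\<close>.\<close>

lemma minimal_sublinear_linear:
  assumes q: "sublinear q" and min: "\<And>r. sublinear r \<Longrightarrow> r \<le> q \<Longrightarrow> r = q"
  shows "linear q"
proof -
  have "tilt q y = q" for y
    using sublinear_tilt[OF q] tilt_le_self[OF q] by (intro min) (auto simp: le_fun_def)
  then have "q x \<le> q (x + y) - q y" for x y using tilt_le[OF q, of 1 y x] by simp
  moreover have sub: "q (x + y) \<le> q x + q y" "t \<ge> 0 \<Longrightarrow> q (t *\<^sub>R x) = t * q x" for x y t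
    using q unfolding sublinear_def by auto
  ultimately have add: "q (x + y) = q x + q y" for x y by (metis add_le_cancel_right diff_add_cancel order_antisym)
  have neg: "q (- x) = - q x" for x
    using add[of x "- x"] sublinear_zero[OF q] by simp
  show ?thesis
  proof (rule linearI)
    fix t x
    show "q (t *\<^sub>R x) = t *\<^sub>R q x"
    proof (cases "t \<ge> 0")
      case False
      then have "q (- (t *\<^sub>R x)) = - t * q x" using sub(2)[of "- t" x] by simp
      then show ?thesis by (simp add: neg)
    qed (simp add: sub(2))
  qed (rule add)
qed

text \<open>A minimal sublinear functional below the tilt of \<open>p\<close> along \<open>e\<close> is linear, and the tilt fixes its
  value at \<open>e\<close>.\<close>

theorem hahn_banach_sublinear:
  fixes p :: "'b::real_vector \<Rightarrow> real"
  assumes p: "sublinear p"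
  obtains \<phi> where "linear \<phi>" "\<And>x. \<phi> x \<le> p x" "\<phi> e = p e"
proof -
  obtain q where q: "sublinear q" "q \<le> tilt p e" "\<And>r. sublinear r \<Longrightarrow> r \<le> q \<Longrightarrow> r = q"
    using ex_minimal_sublinear[OF sublinear_tilt[OF p]] by blast
  have lin: "linear q" by (rule minimal_sublinear_linear) (use q in auto)
  have le: "q x \<le> p x" for x using q(2) tilt_le_self[OF p] by (meson le_funD order_trans)
  \<comment> \<open>The tilt in direction \<open>e\<close> forces \<open>q (- e) \<le> - p e\<close>.\<close>
  have "q (- e) \<le> p (- e + 1 *\<^sub>R e) - 1 * p e"
    using le_funD[OF q(2), of "- e"] tilt_le[OF p, of 1 e "- e"] by linarith
  then have "p e \<le> q e" using sublinear_zero[OF p] linear_neg[OF lin, of e] by simp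
  then show thesis using that[OF lin le] le[of e] by simp
qed

section \<open>Functionals and finite-dimensional subspaces\<close>

definition cfunctional :: "('a::complex_normed_vector \<Rightarrow> complex) \<Rightarrow> bool" where
  "cfunctional f \<longleftrightarrow> bounded_linear f \<and> (\<forall>c x. f (c *\<^sub>C x) = c * f x)"

lemma cspan_subspace: "csubspace W \<Longrightarrow> cspan W = W"
  by (rule complex_vector.span_eq_iff[THEN iffD2])

lemma infdist_approx:
  assumes "W \<noteq> {}" "e > 0"
  obtains w where "w \<in> W" "dist x w < infdist x W + e"
proof -
  have "(INF a\<in>W. dist x a) < infdist x W + e" using assms by (simp add: infdist_notempty)
  then obtain w where "w \<in> W" "dist x w < infdist x W + e"
    using assms(1) by (subst (asm) cINF_less_iff) auto
  then show thesis using that by blast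
qed

lemma infdist_add_le:
  fixes W :: "'a::complex_normed_vector set"
  assumes W: "csubspace W"
  shows "infdist (x + y) W \<le> infdist x W + infdist y W"
proof (rule field_le_epsilon)
  fix e :: real assume e: "e > 0"
  have W0: "W \<noteq> {}" using W complex_vector.subspace_0 by blast
  obtain u where u: "u \<in> W" "dist x u < infdist x W + e/2"
    using infdist_approx[OF W0, of "e/2" x] e by auto
  obtain v where v: "v \<in> W" "dist y v < infdist y W + e/2"
    using infdist_approx[OF W0, of "e/2" y] e by auto
  have "infdist (x + y) W \<le> dist (x + y) (u + v)"
    using W u v by (intro infdist_le complex_vector.subspace_add)
  also have "\<dots> \<le> dist x u + dist y v" by (rule dist_triangle_add)
  finally show "infdist (x + y) W \<le> infdist x W + infdist y W + e" using u v by simp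
qed

lemma infdist_scaleC:
  fixes W :: "'a::complex_normed_vector set"
  assumes W: "csubspace W"
  shows "infdist (c *\<^sub>C x) W = cmod c * infdist x W"
proof -
  have W0: "W \<noteq> {}" using W complex_vector.subspace_0 by blast
  have le: "infdist (c *\<^sub>C x) W \<le> cmod c * infdist x W" for c and x :: 'a
  proof (rule field_le_epsilon)
    fix e :: real assume e: "e > 0"
    define d where "d = e / (cmod c + 1)"
    have d: "d > 0" using e by (simp add: d_def add_nonneg_pos)
    have "(cmod c + 1) * d = e" unfolding d_def using norm_ge_zero[of c] by (simp add: add_nonneg_eq_0_iff)
    then have cd: "cmod c * d \<le> e" using d by (simp add: distrib_right)
    obtain w where w: "w \<in> W" "dist x w < infdist x W + d"
      using infdist_approx[OF W0 d] by blast
    have "infdist (c *\<^sub>C x) W \<le> dist (c *\<^sub>C x) (c *\<^sub>C w)"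
      using W w by (intro infdist_le complex_vector.subspace_scale)
    also have "\<dots> = cmod c * dist x w"
      by (simp add: dist_norm norm_scaleC flip: complex_vector.scale_right_diff_distrib)
    also have "\<dots> \<le> cmod c * (infdist x W + d)" using w(2) by (intro mult_left_mono) auto
    finally show "infdist (c *\<^sub>C x) W \<le> cmod c * infdist x W + e"
      using cd by (simp add: distrib_left)
  qed
  show ?thesis
  proof (cases "c = 0")
    case True
    then show ?thesis using le[of 0 x] infdist_nonneg[of "0 *\<^sub>C x" W] by simp
  next
    case False
    have "infdist x W \<le> inverse (cmod c) * infdist (c *\<^sub>C x) W"
      using le[of "inverse c" "c *\<^sub>C x"] False by (simp add: scaleC_scaleC scaleC_one norm_inverse)
    then have "cmod c * infdist x W \<le> infdist (c *\<^sub>C x) W" using False by (simp add: field_simps)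
    then show ?thesis using le[of c x] by simp
  qed
qed

text \<open>Hahn-Banach for the seminorm \<open>x \<mapsto> dist(x, W)\<close>, which vanishes on \<open>W\<close> only. The real functional
  \<open>\<phi>\<close> becomes complex-linear as \<open>x \<mapsto> \<phi> x - \<i> \<phi> (\<i> x)\<close>.\<close>

lemma ex_separating_functional:
  fixes W :: "'a::complex_normed_vector set"
  assumes W: "csubspace W" "closed W" and e: "e \<notin> W"
  obtains f where "cfunctional f" "f e = 1" "\<And>w. w \<in> W \<Longrightarrow> f w = 0"
proof -
  let ?p = "\<lambda>x. infdist x W"
  have W0: "0 \<in> W" "W \<noteq> {}" using W complex_vector.subspace_0 by blast+
  have "sublinear ?p"
    unfolding sublinear_def using infdist_add_le[OF W(1)] infdist_scaleC[OF W(1)]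
    by (simp add: scaleR_scaleC)
  then obtain \<phi> where lin: "linear \<phi>" and le: "\<And>x. \<phi> x \<le> ?p x" and \<phi>e: "\<phi> e = ?p e"
    using hahn_banach_sublinear[of ?p e] by blast
  have abs_le: "\<bar>\<phi> x\<bar> \<le> ?p x" for x
  proof -
    have "- \<phi> x \<le> ?p (- x)" using le[of "- x"] linear_neg[OF lin] by simp
    also have "?p (- x) = ?p x" using infdist_scaleC[OF W(1), of "-1" x] by (simp add: scaleC_one)
    finally show ?thesis using le[of x] by simp
  qed
  define g where "g x = Complex (\<phi> x) (- \<phi> (\<i> *\<^sub>C x))" for x
  have g_add: "g (x + y) = g x + g y" for x y
    by (simp add: g_def scaleC_add_right linear_add[OF lin] complex_eq_iff)
  have g_R: "g (r *\<^sub>R x) = of_real r * g x" for r x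
  proof -
    have "\<i> *\<^sub>C (r *\<^sub>R x) = r *\<^sub>R (\<i> *\<^sub>C x)" by (simp add: scaleR_scaleC scaleC_scaleC mult.commute)
    then show ?thesis by (simp add: g_def linear_scale[OF lin] complex_eq_iff)
  qed
  have g_i: "g (\<i> *\<^sub>C x) = \<i> * g x" for x
  proof -
    have "\<phi> (\<i> *\<^sub>C (\<i> *\<^sub>C x)) = - \<phi> x"
      by (simp add: scaleC_scaleC scaleC_one linear_neg[OF lin])
    then show ?thesis by (simp add: g_def complex_eq_iff)
  qed
  have g_C: "g (c *\<^sub>C x) = c * g x" for c x
  proof -
    have "c *\<^sub>C x = (of_real (Re c) + \<i> * of_real (Im c)) *\<^sub>C x" by (metis complex_eq)
    then have "c *\<^sub>C x = Re c *\<^sub>R x + \<i> *\<^sub>C (Im c *\<^sub>R x)"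
      by (simp add: scaleC_add_left scaleC_scaleC scaleR_scaleC)
    then have "g (c *\<^sub>C x) = of_real (Re c) * g x + \<i> * (of_real (Im c) * g x)"
      by (simp add: g_add g_i g_R)
    also have "\<dots> = (of_real (Re c) + \<i> * of_real (Im c)) * g x" by (simp add: algebra_simps)
    finally show ?thesis by (metis complex_eq)
  qed
  have g_bound: "norm (g x) \<le> 2 * ?p x" for x
  proof -
    have "norm (g x) \<le> \<bar>\<phi> x\<bar> + \<bar>\<phi> (\<i> *\<^sub>C x)\<bar>" using cmod_le[of "g x"] by (simp add: g_def)
    also have "\<dots> \<le> ?p x + ?p (\<i> *\<^sub>C x)" by (intro add_mono abs_le)
    also have "?p (\<i> *\<^sub>C x) = ?p x" by (simp add: infdist_scaleC[OF W(1)])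
    finally show ?thesis by simp
  qed
  have "?p x \<le> norm x" for x using infdist_le[OF W0(1), of x] by simp
  then have g_bound': "norm (g x) \<le> norm x * 2" for x using g_bound[of x] by (smt (verit))
  have "?p e > 0" using e W W0 by (simp add: infdist_pos_not_in_closed)
  then have ge: "g e \<noteq> 0" using \<phi>e by (auto simp: g_def complex_eq_iff)
  have gW: "g w = 0" if "w \<in> W" for w using g_bound[of w] that by simp
  have "bounded_linear g"
    by (rule bounded_linear_intro[where K = 2])
      (use g_add g_R g_bound' in \<open>auto simp: scaleR_conv_of_real\<close>)
  then have "cfunctional (\<lambda>x. g x / g e)"
    unfolding cfunctional_def using g_C bounded_linear_divide bounded_linear_compose by fastforce
  then show thesis using that[of "\<lambda>x. g x / g e"] ge gW by simp
qed

text \<open>With a functional \<open>f\<close> vanishing on \<open>W\<close> and \<open>f v = 1\<close>, the larger space is the preimage of \<open>W\<close>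
  under the continuous map \<open>x \<mapsto> x - f x v\<close>.\<close>

lemma closed_cspan_insert:
  fixes W :: "'a::complex_normed_vector set"
  assumes W: "csubspace W" "closed W"
  shows "closed (cspan (insert v W))"
proof (cases "v \<in> W")
  case True
  then have "cspan (insert v W) = W" using W by (simp add: insert_absorb cspan_subspace)
  then show ?thesis using W by simp
next
  case False
  then obtain f where f: "cfunctional f" "f v = 1" "\<And>w. w \<in> W \<Longrightarrow> f w = 0"
    using ex_separating_functional[OF W] by blast
  have blf: "bounded_linear f" using f by (simp add: cfunctional_def)
  have fd: "f (x - y) = f x - f y" for x y
    using bounded_linear.linear[OF blf] by (rule linear_diff)
  have fs: "f (c *\<^sub>C x) = c * f x" for c x using f(1) by (simp add: cfunctional_def)
  have "cspan (insert v W) = {x. x - f x *\<^sub>C v \<in> W}"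
  proof safe
    fix x assume "x \<in> cspan (insert v W)"
    then obtain k where k: "x - k *\<^sub>C v \<in> W"
      unfolding complex_vector.span_insert cspan_subspace[OF W(1)] by blast
    have "f (x - k *\<^sub>C v) = 0" using k f(3) by blast
    then have "f x = k" using f(2) by (simp add: fd fs)
    then show "x - f x *\<^sub>C v \<in> W" using k by simp
  next
    fix x assume "x - f x *\<^sub>C v \<in> W"
    then show "x \<in> cspan (insert v W)"
      unfolding complex_vector.span_insert using complex_vector.span_base[of _ W] by blast
  qed
  moreover have "bounded_linear (\<lambda>x. f x *\<^sub>C v)"
  proof -
    have "bounded_linear (\<lambda>c. c *\<^sub>C v)"
      by (rule bounded_linear_intro[where K = "norm v"])
        (simp_all add: scaleC_add_left scaleR_scaleC scaleC_scaleC scaleR_conv_of_real norm_scaleC)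
    then show ?thesis using blf bounded_linear_compose by blast
  qed
  then have "continuous_on UNIV (\<lambda>x. x - f x *\<^sub>C v)"
    by (intro continuous_intros linear_continuous_on)
  then have "closed ((\<lambda>x. x - f x *\<^sub>C v) -` W)" using W(2) continuous_closed_vimage
    by (metis UNIV_I continuous_on_eq_continuous_at open_UNIV)
  ultimately show ?thesis by (simp add: vimage_def)
qed

lemma closed_cspan_Un:
  assumes W: "csubspace W" "closed W" and "finite E"
  shows "closed (cspan (E \<union> W))"
  using assms(3)
proof (induction E rule: finite_induct)
  case empty
  then show ?case using W by (simp add: cspan_subspace)
next
  case (insert v E)
  have "cspan (insert v E \<union> W) = cspan (insert v (cspan (E \<union> W)))"
    by (rule antisym; rule complex_vector.span_minimal)
      (auto intro: complex_vector.span_base dest: complex_vector.span_mono[THEN subsetD, rotated])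
  then show ?case using closed_cspan_insert[OF _ insert.IH] by simp
qed

lemma closed_cspan_finite: "finite E \<Longrightarrow> closed (cspan E)"
  using closed_cspan_Un[of "{0}" E] complex_vector.span_insert_0[of E] by simp

text \<open>Each \<open>e\<close> is separated from the closed span of the other members of the family.\<close>

lemma ex_biorthogonal:
  assumes "finite E" "complex_vector.independent E"
  obtains f where "\<And>e. e \<in> E \<Longrightarrow> cfunctional (f e)" "\<And>e. e \<in> E \<Longrightarrow> f e e = 1"
    "\<And>e d. e \<in> E \<Longrightarrow> d \<in> E \<Longrightarrow> d \<noteq> e \<Longrightarrow> f e d = 0"
proof -
  have "\<exists>f. cfunctional f \<and> f e = 1 \<and> (\<forall>d\<in>E. d \<noteq> e \<longrightarrow> f d = 0)" if e: "e \<in> E" for e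
  proof -
    have "e \<notin> cspan (E - {e})" using assms(2) e by (auto simp: complex_vector.dependent_def)
    moreover have "closed (cspan (E - {e}))" using assms(1) by (simp add: closed_cspan_finite)
    ultimately obtain f where f: "cfunctional f" "f e = 1" "\<And>w. w \<in> cspan (E - {e}) \<Longrightarrow> f w = 0"
      using ex_separating_functional[of "cspan (E - {e})" e] by auto
    have "f d = 0" if "d \<in> E" "d \<noteq> e" for d
      using f(3) complex_vector.span_base[of d "E - {e}"] that by simp
    then show ?thesis using f by blast
  qed
  then show thesis using that by metis
qed

section \<open>Bounded operators\<close>

lemma app_bounded_linear: "bounded_linear (app T)"
  by (simp add: app.rep_eq blinfun.bounded_linear_right)

lemma app_add [simp]: "app T (x + y) = app T x + app T y"
  by (simp add: app.rep_eq blinfun.add_right)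

lemma app_diff_right [simp]: "app T (x - y) = app T x - app T y"
  by (simp add: app.rep_eq blinfun.diff_right)

lemma app_zero [simp]: "app T 0 = 0"
  by (simp add: app.rep_eq blinfun.zero_right)

lemma app_scaleC_right [simp]: "app T (c *\<^sub>C x) = c *\<^sub>C app T x"
  using blinfun_of_bop[of T] by (simp add: app.rep_eq)

declare app_one [simp]

lemma app_module_hom: "module_hom scaleC scaleC (app T)"
  by unfold_locales simp_all

lemma norm_app: "norm (app T x) \<le> norm T * norm x"
  by (simp add: app.rep_eq norm_bop.rep_eq norm_blinfun)

lemma continuous_on_app: "continuous_on S (app T)"
  by (rule linear_continuous_on[OF app_bounded_linear])

lemma norm_bop_le:
  assumes "0 \<le> b" "\<And>x. norm (app T x) \<le> b * norm x" shows "norm T \<le> b"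
  using assms by (simp add: app.rep_eq norm_bop.rep_eq norm_blinfun_bound)

lemma ex_bop:
  assumes "bounded_linear f" "\<And>c x. f (c *\<^sub>C x) = c *\<^sub>C f x"
  obtains T where "\<And>x. app T x = f x"
proof -
  have "blinfun_apply (Blinfun f) = f" using assms(1) by (rule bounded_linear_Blinfun_apply)
  then have "app (bop_of_blinfun (Blinfun f)) x = f x" for x
    using assms(2) by (simp add: app.rep_eq bop_of_blinfun_inverse)
  then show thesis using that by blast
qed

text \<open>The operator \<open>f \<otimes> y\<close> of rank at most one, an unspecified operator unless \<open>f\<close> is a bounded functional.\<close>

definition rank_one :: "'a::complex_normed_vector \<Rightarrow> ('a \<Rightarrow> complex) \<Rightarrow> 'a bop" where
  "rank_one y f = (SOME T. \<forall>x. app T x = f x *\<^sub>C y)"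

lemma app_rank_one:
  assumes "cfunctional f"
  shows "app (rank_one y f) x = f x *\<^sub>C y"
proof -
  have "bounded_linear (\<lambda>c. c *\<^sub>C y)"
    by (rule bounded_linear_intro[where K = "norm y"])
      (simp_all add: scaleC_add_left scaleR_scaleC scaleC_scaleC scaleR_conv_of_real norm_scaleC)
  then have "bounded_linear (\<lambda>x. f x *\<^sub>C y)"
    using assms bounded_linear_compose unfolding cfunctional_def by blast
  then obtain T where "\<And>x. app T x = f x *\<^sub>C y"
    using assms by (elim ex_bop) (auto simp: cfunctional_def scaleC_scaleC)
  then have "\<exists>T. \<forall>x. app T x = f x *\<^sub>C y" by blast
  then show ?thesis unfolding rank_one_def by (rule someI_ex[THEN spec])
qed

lemma bop_mult_rank_one: "cfunctional f \<Longrightarrow> T * rank_one y f = rank_one (app T y) f"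
  by (rule bop_eqI) (simp add: app_times app_rank_one)

lemma csubspace_null_space: "csubspace (null_space T)"
  by (auto simp: complex_vector.subspace_def null_space_def)

lemma closed_null_space: "closed (null_space T)"
  unfolding null_space_def by (rule closed_Collect_eq) (auto intro: continuous_on_app)

lemma csubspace_image: "csubspace M \<Longrightarrow> csubspace (app T ` M)"
  by (rule module_hom.subspace_image[OF app_module_hom])

lemma csubspace_range: "csubspace (range (app T))"
  by (rule csubspace_image) (rule complex_vector.subspace_UNIV)

lemma app_span_image: "app T ` cspan S = cspan (app T ` S)"
  using module_hom.span_image[OF app_module_hom] by metis

lemma app_power_Suc: "app (T ^ Suc n) x = app T (app (T ^ n) x)"
  by (simp add: app_times)

lemma app_power_add: "app (T ^ (m + n)) x = app (T ^ m) (app (T ^ n) x)"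
  by (simp add: power_add app_times)

lemma app_power_commute: "app (T ^ n) (app T x) = app T (app (T ^ n) x)"
  by (metis app_power_Suc app_times power_Suc2)

lemma range_power_Suc: "app T ` range (app (T ^ n)) = range (app (T ^ Suc n))"
  by (auto simp: app_power_Suc image_iff simp del: power_Suc)

lemma range_power_invariant: "app T ` range (app (T ^ n)) \<subseteq> range (app (T ^ n))"
  by (auto simp: app_power_commute[symmetric])

lemma range_power_antimono: "m \<le> n \<Longrightarrow> range (app (T ^ n)) \<subseteq> range (app (T ^ m))"
  using app_power_add[of T m "n - m"] by auto

section \<open>Closed ranges\<close>

text \<open>If \<open>S x + y\<close> sweeps out a closed space directly, the open mapping theorem controls the component
  \<open>y\<close> by \<open>S x + y\<close>, so a limit of elements \<open>S x\<close> has component \<open>y = 0\<close>.\<close>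

lemma closed_range_if_closed_direct_sum:
  fixes S :: "'a::complex_banach bop"
  assumes N: "csubspace N" "closed N" and dir: "range (app S) \<inter> N = {0}"
    and cl: "closed {app S x + y | x y. y \<in> N}"
  shows "closed (range (app S))"
proof -
  define f where "f p = app S (fst p) + snd p" for p :: "'a \<times> 'a"
  have fbl: "bounded_linear f"
    unfolding f_def by (intro bounded_linear_add bounded_linear_snd
        bounded_linear_compose[OF app_bounded_linear] bounded_linear_fst)
  have img: "f ` (UNIV \<times> N) = {app S x + y | x y. y \<in> N}"
    unfolding f_def by (auto simp: image_iff; blast)
  have subN: "subspace N" using N by (simp add: csubspace_imp_subspace)
  obtain C where C: "C > 0"
      "\<And>z. z \<in> f ` (UNIV \<times> N) \<Longrightarrow> \<exists>p\<in>UNIV \<times> N. f p = z \<and> norm p \<le> C * norm z"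
    by (rule open_mapping[OF fbl, of "UNIV \<times> N"])
      (use subN N cl img in \<open>auto intro!: subspace_Times closed_Times\<close>)
  have "z \<in> range (app S)" if u: "\<forall>n. u n \<in> range (app S)" and lim: "u \<longlonglongrightarrow> z" for u z
  proof -
    have N0: "0 \<in> N" using N(1) by (rule complex_vector.subspace_0)
    have inW: "app S x + y \<in> f ` (UNIV \<times> N)" if "y \<in> N" for x y
      using that by (auto simp: img)
    have "u n \<in> f ` (UNIV \<times> N)" for n using u inW[OF N0] by (metis add.right_neutral rangeE)
    then have "z \<in> f ` (UNIV \<times> N)" using closed_sequentially[OF _ _ lim] cl img by metis
    then obtain x y where xy: "z = app S x + y" "y \<in> N" unfolding img by blast
    have "norm y \<le> C * norm (z - u n)" for n
    proof -
      obtain v where v: "u n = app S v" using u by blast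
      have "z - u n = app S (x - v) + y" using xy v by simp
      then have "z - u n \<in> f ` (UNIV \<times> N)" using inW[OF xy(2), of "x - v"] by simp
      then obtain p where p: "p \<in> UNIV \<times> N" "f p = z - u n" "norm p \<le> C * norm (z - u n)"
        using C(2) by blast
      have pN: "snd p \<in> N" using p(1) by auto
      have "app S (fst p - (x - v)) = y - snd p"
        using p(2) \<open>z - u n = app S (x - v) + y\<close> unfolding f_def by (simp add: algebra_simps)
      then have "y - snd p \<in> range (app S) \<inter> N"
        using complex_vector.subspace_diff[OF N(1) xy(2) pN] by (metis IntI rangeI)
      then have "y = snd p" using dir by simp
      then show ?thesis using p(3) norm_snd_le[of "snd p" "fst p"] by simp
    qed
    moreover have "(\<lambda>n. C * norm (z - u n)) \<longlonglongrightarrow> C * norm (z - z)"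
      by (intro tendsto_intros lim)
    ultimately have "norm y \<le> C * norm (z - z)"
      by (intro LIMSEQ_le_const) auto
    then show ?thesis using xy by simp
  qed
  then show ?thesis unfolding closed_sequential_limits by blast
qed

lemma app_open_mapping:
  fixes T :: "'a::complex_banach bop"
  assumes "csubspace M" "closed M" "closed (app T ` M)"
  obtains C where "C > 0" "\<And>y. y \<in> app T ` M \<Longrightarrow> \<exists>x\<in>M. app T x = y \<and> norm x \<le> C * norm y"
  by (rule open_mapping[OF app_bounded_linear csubspace_imp_subspace[OF assms(1)] assms(2,3)])
    (rule that)

lemma bounded_below_estimate:
  fixes T :: "'a::complex_banach bop"
  assumes M: "csubspace M" "closed M" "closed (app T ` M)" and inj: "M \<inter> null_space T = {0}"
  obtains c where "c > 0" "\<And>x. x \<in> M \<Longrightarrow> c * norm x \<le> norm (app T x)"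
proof -
  obtain C where C: "C > 0" "\<And>y. y \<in> app T ` M \<Longrightarrow> \<exists>x\<in>M. app T x = y \<and> norm x \<le> C * norm y"
    using app_open_mapping[OF M] by blast
  have "inverse C * norm x \<le> norm (app T x)" if x: "x \<in> M" for x
  proof -
    obtain z where z: "z \<in> M" "app T z = app T x" "norm z \<le> C * norm (app T x)"
      using C(2)[of "app T x"] x by blast
    have "x - z \<in> M \<inter> null_space T"
      using x z complex_vector.subspace_diff[OF M(1)] by (auto simp: null_space_def)
    then have "x = z" using inj by simp
    then show ?thesis using z(3) C(1) by (simp add: field_simps)
  qed
  then show thesis using that[of "inverse C"] C(1) by simp
qed

lemma closed_image_estimate:
  fixes T :: "'a::complex_banach bop"
  assumes "c > 0" "csubspace M" "closed M" "\<And>x. x \<in> M \<Longrightarrow> c * norm x \<le> norm (app T x)"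
  shows "closed (app T ` M)"
proof -
  have "complete (app T ` M)"
    by (rule complete_isometric_image[OF assms(1) csubspace_imp_subspace[OF assms(2)] app_bounded_linear])
      (use assms in \<open>auto simp: complete_eq_closed\<close>)
  then show ?thesis by (simp add: complete_eq_closed)
qed

text \<open>Enlarging \<open>Z\<close> by the finite-dimensional kernel keeps it closed and does not change its image. For a
  closed subspace that contains the kernel, small differences of images lift to small vectors, so
  convergence of images lifts to convergence in the subspace.\<close>

lemma closed_image_subspace:
  fixes T :: "'a::complex_banach bop"
  assumes M: "csubspace M" "closed M" "closed (app T ` M)"
    and fin: "cdim (M \<inter> null_space T) < \<infinity>"
    and Z: "csubspace Z" "closed Z" "Z \<subseteq> M"
  shows "closed (app T ` Z)"
proof -
  have sub: "csubspace (M \<inter> null_space T)"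
    by (intro complex_vector.subspace_inter M csubspace_null_space)
  obtain E where E: "finite E" "M \<inter> null_space T = cspan E"
    using finite_cdim_basis[OF sub fin] by metis
  define W where "W = cspan (E \<union> Z)"
  have W: "csubspace W" "closed W" "Z \<subseteq> W"
    using closed_cspan_Un[OF Z(1,2) E(1)] complex_vector.span_superset[of "E \<union> Z"] by (auto simp: W_def)
  have EN: "E \<subseteq> M \<inter> null_space T" using E(2) complex_vector.span_superset by metis
  then have WM: "W \<subseteq> M" unfolding W_def by (intro complex_vector.span_minimal) (use Z M in auto)
  have NW: "M \<inter> null_space T \<subseteq> W" unfolding E(2) W_def by (intro complex_vector.span_mono) auto
  have TE: "app T ` E \<subseteq> {0}" using EN by (auto simp: null_space_def)
  have "app T ` W = cspan (app T ` E \<union> app T ` Z)" by (simp add: W_def app_span_image image_Un)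
  also have "\<dots> \<subseteq> app T ` Z"
    using TE complex_vector.subspace_0[OF csubspace_image[OF Z(1), of T]]
    by (intro complex_vector.span_minimal csubspace_image[OF Z(1)]) auto
  finally have img: "app T ` W = app T ` Z" using W(3) by blast
  obtain C where C: "C > 0" "\<And>y. y \<in> app T ` M \<Longrightarrow> \<exists>x\<in>M. app T x = y \<and> norm x \<le> C * norm y"
    using app_open_mapping[OF M] by blast
  have "y \<in> app T ` W" if u: "\<forall>n. u n \<in> app T ` W" and lim: "u \<longlonglongrightarrow> y" for u y
  proof -
    have uM: "u n \<in> app T ` M" for n using u WM by blast
    then have "y \<in> app T ` M" by (rule closed_sequentially[OF M(3) _ lim])
    then obtain x where x: "x \<in> M" "y = app T x" by blast
    have "\<exists>w\<in>W. dist w x \<le> C * norm (u n - y)" for n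
    proof -
      obtain w where w: "w \<in> W" "u n = app T w" using u by blast
      have "w - x \<in> M" using w(1) WM x(1) M(1) by (auto intro: complex_vector.subspace_diff)
      then have "u n - y \<in> app T ` M" using w(2) x(2) by (metis app_diff_right imageI)
      then obtain v where v: "v \<in> M" "app T v = u n - y" "norm v \<le> C * norm (u n - y)"
        using C(2) by blast
      have "w - x - v \<in> M \<inter> null_space T"
        using \<open>w - x \<in> M\<close> v(1,2) w(2) x(2) M(1)
        by (auto intro: complex_vector.subspace_diff simp: null_space_def)
      then have "w - x - v \<in> W" using NW by blast
      then have "w - (w - x - v) \<in> W" by (rule complex_vector.subspace_diff[OF W(1) w(1)])
      also have "w - (w - x - v) = x + v" by (simp add: algebra_simps)
      finally have "x + v \<in> W" .
      then show ?thesis using v(3) by (intro bexI[of _ "x + v"]) (auto simp: dist_norm)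
    qed
    then obtain w where w: "\<And>n. w n \<in> W" "\<And>n. dist (w n) x \<le> C * norm (u n - y)" by metis
    have "w \<longlonglongrightarrow> x"
    proof (rule metric_tendsto_imp_tendsto[of "\<lambda>n. C * norm (u n - y)" 0])
      have "(\<lambda>n. C * norm (u n - y)) \<longlonglongrightarrow> C * norm (y - y)" by (intro tendsto_intros lim)
      then show "(\<lambda>n. C * norm (u n - y)) \<longlonglongrightarrow> 0" by simp
      show "\<forall>\<^sub>F n in sequentially. dist (w n) x \<le> dist (C * norm (u n - y)) 0"
        using w(2) C(1) by (simp add: abs_mult)
    qed
    then have "x \<in> W" by (rule closed_sequentially[OF W(2) w(1)])
    then show ?thesis using x by blast
  qed
  then have "closed (app T ` W)" unfolding closed_sequential_limits by blast
  then show ?thesis by (simp add: img)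
qed

text \<open>The preimage of \<open>R(T^(m+1))\<close> under \<open>T\<close> is \<open>R(T^m) + N(T)\<close>. The subspace \<open>L\<close> of \<open>N(T)\<close> makes it the
  direct sum of \<open>R(T^m)\<close> and \<open>L\<close>.\<close>

lemma closed_range_power_descend:
  fixes T :: "'a::complex_banach bop"
  assumes cl: "closed (range (app (T ^ Suc m)))"
    and L: "csubspace L" "closed L" "L \<subseteq> null_space T" "range (app (T ^ m)) \<inter> L = {0}"
      "null_space T \<subseteq> cspan (L \<union> range (app (T ^ m)))"
  shows "closed (range (app (T ^ m)))"
proof (rule closed_range_if_closed_direct_sum[OF L(1,2,4)])
  have "{app (T ^ m) x + y | x y. y \<in> L} = app T -` range (app (T ^ Suc m))"
  proof (intro subset_antisym subsetI)
    fix z assume "z \<in> {app (T ^ m) x + y | x y. y \<in> L}"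
    then obtain x y where z: "z = app (T ^ m) x + y" "y \<in> L" by blast
    then have "app T y = 0" using L(3) by (auto simp: null_space_def)
    then have "app T z = app (T ^ Suc m) x" by (simp add: app_times z)
    then show "z \<in> app T -` range (app (T ^ Suc m))" by (metis rangeI vimageI2)
  next
    fix z assume "z \<in> app T -` range (app (T ^ Suc m))"
    then obtain u where "app T z = app (T ^ Suc m) u" by blast
    then have "z - app (T ^ m) u \<in> null_space T" by (simp add: null_space_def app_times)
    then have "z - app (T ^ m) u \<in> cspan (L \<union> range (app (T ^ m)))" using L(5) by blast
    then obtain y v where yv: "z - app (T ^ m) u = y + v" "y \<in> L" "v \<in> range (app (T ^ m))"
      unfolding complex_vector.span_Un cspan_subspace[OF L(1)] cspan_subspace[OF csubspace_range] by blast
    then obtain x where "v = app (T ^ m) x" by blast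
    then have "z = app (T ^ m) (u + x) + y" using yv(1) by (simp add: algebra_simps)
    then show "z \<in> {app (T ^ m) x + y | x y. y \<in> L}" using yv(2) by blast
  qed
  moreover have "closed (app T -` range (app (T ^ Suc m)))"
    using closed_vimage[OF cl continuous_on_app] by simp
  ultimately show "closed {app (T ^ m) x + y | x y. y \<in> L}" by simp
qed

section \<open>Left Drazin invertible operators\<close>

text \<open>Left Drazin invertibility in Banach spaces is usually stated as finite ascent \<open>a\<close> with closed
  \<open>R(T^(a+1))\<close>. The form here, with any sufficiently large exponent, is what semi B-Fredholm
  operators deliver; \<open>left_drazin_iff_ascent\<close> relates the two.\<close>

definition left_drazin :: "'a::complex_normed_vector bop \<Rightarrow> bool" where
  "left_drazin T \<longleftrightarrow> (\<exists>n. closed (range (app (T ^ n))) \<and> closed (range (app (T ^ Suc n))) \<and>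
     null_space T \<inter> range (app (T ^ n)) = {0})"

lemma null_space_Suc_eq_iff:
  "null_space (T ^ n) = null_space (T ^ Suc n) \<longleftrightarrow> null_space T \<inter> range (app (T ^ n)) = {0}"
proof
  assume eq: "null_space (T ^ n) = null_space (T ^ Suc n)"
  have "app (T ^ n) x = 0" if "app T (app (T ^ n) x) = 0" for x
    using that eq by (auto simp: null_space_def app_times)
  moreover have "0 \<in> range (app (T ^ n))" by (metis app_zero rangeI)
  ultimately show "null_space T \<inter> range (app (T ^ n)) = {0}" by (auto simp: null_space_def)
next
  assume "null_space T \<inter> range (app (T ^ n)) = {0}"
  then show "null_space (T ^ n) = null_space (T ^ Suc n)"
    by (auto simp: null_space_def app_times)
qed

lemma null_space_range_antimono:
  assumes "null_space T \<inter> range (app (T ^ n)) = {0}" "n \<le> m"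
  shows "null_space T \<inter> range (app (T ^ m)) = {0}"
proof -
  have "0 \<in> range (app (T ^ m))" using rangeI[of "app (T ^ m)" 0] by simp
  moreover have "0 \<in> null_space T" by (simp add: null_space_def)
  ultimately show ?thesis using assms(1) range_power_antimono[OF assms(2), of T] by blast
qed

text \<open>Closedness descends from \<open>R(T^(m+1))\<close> to \<open>R(T^m)\<close> as long as \<open>N(T)\<close> meets \<open>R(T^m)\<close> in zero only, that
  is, for every \<open>m\<close> not below the ascent.\<close>

lemma left_drazin_iff_ascent:
  fixes T :: "'a::complex_banach bop"
  shows "left_drazin T \<longleftrightarrow> (\<exists>a. ascent T = enat a \<and> closed (range (app (T ^ (a + 1)))))"
proof
  have descend: "closed (range (app (T ^ m)))"
    if "closed (range (app (T ^ Suc m)))" and tr: "null_space T \<inter> range (app (T ^ m)) = {0}" for m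
    by (rule closed_range_power_descend[of T m "null_space T"])
      (use that in \<open>auto simp: csubspace_null_space closed_null_space Int_commute intro: complex_vector.span_base\<close>)
  {
    assume "left_drazin T"
    then obtain n where n: "closed (range (app (T ^ Suc n)))" "null_space T \<inter> range (app (T ^ n)) = {0}"
      unfolding left_drazin_def by blast
    define a where "a = (LEAST n. null_space (T ^ n) = null_space (T ^ Suc n))"
    have ex: "null_space (T ^ n) = null_space (T ^ Suc n)" using n(2) null_space_Suc_eq_iff by blast
    then have asc: "ascent T = enat a" unfolding ascent_def a_def by auto
    have a: "null_space T \<inter> range (app (T ^ a)) = {0}"
      using LeastI[of "\<lambda>n. null_space (T ^ n) = null_space (T ^ Suc n)", OF ex] null_space_Suc_eq_iff
      unfolding a_def by blast
    have "a \<le> n" unfolding a_def using ex by (rule Least_le)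
    then have "closed (range (app (T ^ Suc a)))"
    proof (induction rule: inc_induct)
      case (step m)
      show ?case by (rule descend[OF step.IH null_space_range_antimono[OF a]]) (use step in simp)
    qed (rule n(1))
    then show "\<exists>a. ascent T = enat a \<and> closed (range (app (T ^ (a + 1))))" using asc by auto
  }
  assume "\<exists>a. ascent T = enat a \<and> closed (range (app (T ^ (a + 1))))"
  then obtain a where asc: "ascent T = enat a" and cl: "closed (range (app (T ^ Suc a)))" by auto
  have "\<exists>n. null_space (T ^ n) = null_space (T ^ Suc n)"
    using asc unfolding ascent_def by (metis enat.distinct(1))
  then have "null_space (T ^ a) = null_space (T ^ Suc a)"
    using asc unfolding ascent_def by (metis (mono_tags, lifting) LeastI_ex enat.inject)
  then have "null_space T \<inter> range (app (T ^ a)) = {0}" using null_space_Suc_eq_iff by blast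
  then show "left_drazin T" unfolding left_drazin_def using cl descend by blast
qed

section \<open>Index of restrictions\<close>

lemma not_index_pos_iff:
  assumes "alpha_on M T < \<infinity>"
  shows "\<not> 0 < index_on M T \<longleftrightarrow> alpha_on M T \<le> beta_on M T"
  using assms unfolding index_on_def by (cases "alpha_on M T"; cases "beta_on M T") auto

lemma csubspace_M_null: "csubspace M \<Longrightarrow> csubspace (M \<inter> null_space T)"
  by (intro complex_vector.subspace_inter csubspace_null_space)

lemma le_alpha_iff:
  assumes "csubspace M"
  shows "enat a \<le> alpha_on M T \<longleftrightarrow>
    (\<exists>E\<subseteq>M \<inter> null_space T. finite E \<and> card E = a \<and> complex_vector.independent E)"
  unfolding alpha_on_def by (rule le_cdim_iff[OF csubspace_M_null[OF assms]])

lemma le_beta_iff: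
  assumes "csubspace M"
  shows "enat a \<le> beta_on M T \<longleftrightarrow> (\<exists>E\<subseteq>M. finite E \<and> card E = a \<and> indep_mod (app T ` M) E)"
  unfolding beta_on_def by (rule le_quotient_cdim_iff[OF csubspace_image[OF assms]])

lemma beta_less_imp_spanning:
  assumes M: "csubspace M" and lt: "beta_on M T < enat a"
  obtains B where "B \<subseteq> M" "finite B" "card B < a" "M \<subseteq> cspan (B \<union> app T ` M)"
proof -
  have "\<not> enat a \<le> beta_on M T" using lt by simp
  then have "\<not> (\<exists>E\<subseteq>M. finite E \<and> card E = a \<and> indep_mod (app T ` M) E)"
    using le_beta_iff[OF M] by blast
  then obtain B where B: "B \<subseteq> M" "finite B" "indep_mod (app T ` M) B" "M \<subseteq> cspan (B \<union> app T ` M)"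
    using indep_mod_family_or_spanning[of M a "app T ` M"] by blast
  have "enat (card B) \<le> beta_on M T" using le_beta_iff[OF M] B by blast
  then have "enat (card B) < enat a" using lt by (rule le_less_trans)
  then show thesis using that B by simp
qed

text \<open>Passing from \<open>M\<close> to \<open>T M\<close> changes nullity and deficiency by the same finite amount: \<open>T\<close>
  induces a surjection \<open>M / T M \<rightarrow> T M / T (T M)\<close> whose kernel is the image of \<open>N(T) \<inter> M\<close>, of dimension
  \<open>dim (N(T) \<inter> M) - dim (N(T) \<inter> T M)\<close>. In the proof \<open>E\<close> represents a basis of that kernel.\<close>

lemma alpha_le_beta_image_iff:
  assumes M: "csubspace M" and inv: "app T ` M \<subseteq> M" and fin: "alpha_on M T < \<infinity>"
  shows "alpha_on M T \<le> beta_on M T \<longleftrightarrow> alpha_on (app T ` M) T \<le> beta_on (app T ` M) T"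
proof -
  let ?M' = "app T ` M" and ?N = "null_space T"
  have M': "csubspace ?M'" by (rule csubspace_image[OF M])
  have sN: "csubspace (M \<inter> ?N)" "csubspace (?M' \<inter> ?N)" by (rule csubspace_M_null[OF M] csubspace_M_null[OF M'])+
  have le: "alpha_on ?M' T \<le> alpha_on M T"
    unfolding alpha_on_def by (rule cdim_mono) (use sN inv in auto)
  then have fin': "alpha_on ?M' T < \<infinity>" using fin by (rule le_less_trans)
  obtain I' where I': "finite I'" "complex_vector.independent I'" "?M' \<inter> ?N = cspan I'"
      "alpha_on ?M' T = enat (card I')"
    using finite_cdim_basis[OF sN(2)] fin' unfolding alpha_on_def by metis
  have I'sub: "I' \<subseteq> M \<inter> ?N" using I'(3) complex_vector.span_superset[of I'] inv by auto
  obtain I where I: "I' \<subseteq> I" "I \<subseteq> M \<inter> ?N" "complex_vector.independent I" "M \<inter> ?N \<subseteq> cspan I"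
    using complex_vector.maximal_independent_subset_extend[OF I'sub I'(2)] by blast
  obtain J where J: "finite J" "M \<inter> ?N = cspan J" "alpha_on M T = enat (card J)" "complex_vector.independent J"
    using finite_cdim_basis[OF sN(1)] fin unfolding alpha_on_def by metis
  have finI: "finite I" and "card I \<le> card J"
    using complex_vector.independent_span_bound[OF J(1) I(3)] I(2) J(2) by auto
  moreover have "card J \<le> card I"
    using complex_vector.independent_span_bound[OF finI J(4)] I(4) J(2) complex_vector.span_superset[of J] by auto
  ultimately have cI: "alpha_on M T = enat (card I)" using J(3) by simp
  define E where "E = I - I'"
  have E: "finite E" "card I = card I' + card E" "E \<subseteq> M" "E \<subseteq> ?N"
    using finI I(1,2) I'(1) card_mono[OF finI I(1)] by (auto simp: E_def card_Diff_subset)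
  have TE: "app T ` E \<subseteq> {0}" using E(4) by (auto simp: null_space_def)
  have indE: "indep_mod ?M' E"
    unfolding indep_mod_def
  proof (intro ballI notI)
    fix e assume e: "e \<in> E" and "e \<in> cspan ((E - {e}) \<union> ?M')"
    then obtain s t where st: "e = s + t" "s \<in> cspan (E - {e})" "t \<in> ?M'"
      unfolding complex_vector.span_Un cspan_subspace[OF M'] by blast
    have "cspan (E - {e}) \<subseteq> ?N"
      using E(4) by (intro complex_vector.span_minimal csubspace_null_space) auto
    then have "t \<in> ?N" using st e E(4) complex_vector.subspace_diff[OF csubspace_null_space, of e T s] by auto
    then have "t \<in> cspan I'" using st(3) I'(3) by blast
    then have "e \<in> cspan ((E - {e}) \<union> I')" unfolding complex_vector.span_Un using st by blast
    moreover have "(E - {e}) \<union> I' = I - {e}" using e I(1) by (auto simp: E_def)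
    moreover have "e \<in> I" using e by (simp add: E_def)
    ultimately show False using I(3) unfolding complex_vector.dependent_def by auto
  qed
  show ?thesis
  proof
    assume le: "alpha_on M T \<le> beta_on M T"
    show "alpha_on ?M' T \<le> beta_on ?M' T"
    proof (rule ccontr)
      assume "\<not> ?thesis"
      then have "beta_on ?M' T < enat (card I')" using I'(4) by simp
      then obtain B where B: "B \<subseteq> ?M'" "finite B" "card B < card I'" "?M' \<subseteq> cspan (B \<union> app T ` ?M')"
        using beta_less_imp_spanning[OF M'] by blast
      obtain D where D: "D \<subseteq> M" "finite D" "card D \<le> card B" "app T ` D = B"
      proof -
        obtain D where "D \<subseteq> M" "inj_on (app T) D" "B = app T ` D"
          using B(1) by (auto simp: subset_image_inj)
        then show thesis using that[of D] B(2) card_image[of "app T" D] finite_imageD by (metis order_refl)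
      qed
      have span: "M \<subseteq> cspan ((D \<union> E) \<union> ?M')"
      proof
        fix x assume x: "x \<in> M"
        have "app T x \<in> cspan (app T ` (D \<union> ?M'))" using B(4) x D(4) by (auto simp: image_Un)
        then obtain z where z: "z \<in> cspan (D \<union> ?M')" "app T x = app T z"
          unfolding app_span_image[symmetric] by blast
        have "cspan (D \<union> ?M') \<subseteq> M" using D(1) inv M by (intro complex_vector.span_minimal) auto
        then have "x - z \<in> M \<inter> ?N"
          using x z complex_vector.subspace_diff[OF M] by (auto simp: null_space_def)
        then have "x - z \<in> cspan I" using I(4) by blast
        moreover have "I \<subseteq> (D \<union> E) \<union> ?M'"
          using I'(3) complex_vector.span_superset[of I'] by (auto simp: E_def)
        ultimately have "x - z \<in> cspan ((D \<union> E) \<union> ?M')" using complex_vector.span_mono by blast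
        moreover have "z \<in> cspan ((D \<union> E) \<union> ?M')"
          using z(1) complex_vector.span_mono[of "D \<union> ?M'" "(D \<union> E) \<union> ?M'"] by auto
        ultimately have "x - z + z \<in> cspan ((D \<union> E) \<union> ?M')" by (rule complex_vector.span_add)
        then show "x \<in> cspan ((D \<union> E) \<union> ?M')" by simp
      qed
      obtain G where G: "G \<subseteq> M" "finite G" "card G = card I" "indep_mod ?M' G"
        using le le_beta_iff[OF M, of "card I" T] cI by auto
      have "card G \<le> card (D \<union> E)"
        using indep_mod_card_le[OF G(2) _ G(4), of "D \<union> E"] D(2) E(1) G(1) span by auto
      also have "\<dots> \<le> card D + card E" by (rule card_Un_le)
      finally show False using G(3) E(2) B(3) D(3) by simp
    qed
  next
    assume le: "alpha_on ?M' T \<le> beta_on ?M' T"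
    show "alpha_on M T \<le> beta_on M T"
    proof (rule ccontr)
      assume "\<not> ?thesis"
      then have "beta_on M T < enat (card I)" using cI by simp
      then obtain B where B: "B \<subseteq> M" "finite B" "card B < card I" "M \<subseteq> cspan (B \<union> ?M')"
        using beta_less_imp_spanning[OF M] by blast
      obtain F where F: "F \<subseteq> B" "card E + card F \<le> card B" "B \<subseteq> cspan (E \<union> F \<union> ?M')"
        using exchange_mod[OF E(1) B(2) indE] E(3) B(4) by auto
      have finF: "finite F" using F(1) B(2) by (rule finite_subset)
      have "B \<union> ?M' \<subseteq> cspan (E \<union> F \<union> ?M')"
        using F(3) complex_vector.span_superset[of "E \<union> F \<union> ?M'"] by auto
      then have "M \<subseteq> cspan (E \<union> F \<union> ?M')"
        using B(4) complex_vector.span_minimal[OF _ complex_vector.subspace_span] by blast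
      then have "?M' \<subseteq> cspan (app T ` (E \<union> F \<union> ?M'))" unfolding app_span_image[symmetric] by blast
      also have "\<dots> \<subseteq> cspan (app T ` F \<union> app T ` ?M')"
        using TE complex_vector.span_zero[of "app T ` F \<union> app T ` ?M'"]
          complex_vector.span_superset[of "app T ` F \<union> app T ` ?M'"]
        by (intro complex_vector.span_minimal) (auto simp: image_Un)
      finally have span: "?M' \<subseteq> cspan (app T ` F \<union> app T ` ?M')" .
      obtain G where G: "G \<subseteq> ?M'" "finite G" "card G = card I'" "indep_mod (app T ` ?M') G"
        using le le_beta_iff[OF M', of "card I'" T] I'(4) by auto
      have "card G \<le> card (app T ` F)"
        using indep_mod_card_le[OF G(2) _ G(4), of "app T ` F"] finF G(1) span by auto
      also have "\<dots> \<le> card F" by (rule card_image_le[OF finF])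
      finally show False using G(3) E(2) F(2) B(3) by simp
    qed
  qed
qed

section \<open>Small perturbations by scalars\<close>

lemma app_shift: "app (T - \<mu> *\<^sub>C 1) x = app T x - \<mu> *\<^sub>C x"
  by (simp add: app_diff app_scaleC app_one)

lemma shift_shift: "T - \<mu> *\<^sub>C 1 - \<nu> *\<^sub>C 1 = T - (\<mu> + \<nu>) *\<^sub>C 1"
  by (simp add: scaleC_add_left)

lemma app_add_left: "app (S + T) x = app S x + app T x"
  by transfer (simp add: blinfun.add_left)

lemma app_zero_left: "app 0 x = 0"
  by transfer simp

lemma app_sum_left: "app (\<Sum>i\<in>I. S i) x = (\<Sum>i\<in>I. app (S i) x)"
  by (induction I rule: infinite_finite_induct) (simp_all add: app_add_left app_zero_left)

lemma biorthogonal_expansion: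
  assumes E: "finite E" and f: "\<And>e. e \<in> E \<Longrightarrow> cfunctional (f e)" "\<And>e. e \<in> E \<Longrightarrow> f e e = 1"
    "\<And>e d. e \<in> E \<Longrightarrow> d \<in> E \<Longrightarrow> d \<noteq> e \<Longrightarrow> f e d = 0"
    and x: "x \<in> cspan E"
  shows "x = (\<Sum>e\<in>E. f e x *\<^sub>C e)"
proof -
  obtain c where c: "x = (\<Sum>e\<in>E. c e *\<^sub>C e)" using x unfolding complex_vector.span_finite[OF E] by blast
  have "f e x = c e" if e: "e \<in> E" for e
  proof -
    have "f e x = (\<Sum>d\<in>E. c d * f e d)"
      unfolding c using f(1)[OF e] by (simp add: cfunctional_def bounded_linear.linear linear_sum)
    also have "\<dots> = (\<Sum>d\<in>E. if d = e then c d else 0)"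
      by (rule sum.cong) (use f(2,3) e in auto)
    also have "\<dots> = c e" using E e by simp
    finally show ?thesis .
  qed
  then show ?thesis using c by simp
qed

text \<open>An upper semi-Fredholm operator of index at most \<open>0\<close> becomes bounded below after adding a
  finite-rank operator \<open>K\<close> that carries the kernel injectively into a complement of the range. Being
  bounded below survives small perturbations, and \<open>T - \<mu>\<close> agrees with \<open>T + K - \<mu>\<close> on the common
  kernel \<open>M0\<close> of the functionals that define \<open>K\<close>.\<close>

lemma index_nonpos_perturbation:
  fixes T :: "'a::complex_banach bop"
  assumes M: "csubspace M" "closed M" and inv: "app T ` M \<subseteq> M" and cl: "closed (app T ` M)"
    and fin: "alpha_on M T < \<infinity>" and le: "alpha_on M T \<le> beta_on M T"
  obtains \<delta> where "\<delta> > 0"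
    "\<And>\<mu>. cmod \<mu> < \<delta> \<Longrightarrow> closed (app (T - \<mu> *\<^sub>C 1) ` M)"
    "\<And>\<mu>. cmod \<mu> < \<delta> \<Longrightarrow> alpha_on M (T - \<mu> *\<^sub>C 1) \<le> alpha_on M T"
    "\<And>\<mu>. cmod \<mu> < \<delta> \<Longrightarrow> alpha_on M (T - \<mu> *\<^sub>C 1) \<le> beta_on M (T - \<mu> *\<^sub>C 1)"
proof -
  let ?R = "app T ` M"
  have R: "csubspace ?R" by (rule csubspace_image[OF M(1)])
  obtain E where E: "finite E" "complex_vector.independent E" "M \<inter> null_space T = cspan E"
      "alpha_on M T = enat (card E)"
    using finite_cdim_basis[OF csubspace_M_null[OF M(1)]] fin unfolding alpha_on_def by metis
  have EM: "E \<subseteq> M" and TE: "\<And>e. e \<in> E \<Longrightarrow> app T e = 0"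
    using E(3) complex_vector.span_superset[of E] by (auto simp: null_space_def)
  \<comment> \<open>The projection \<open>x \<mapsto> \<Sum>e. f e x e\<close> onto the kernel splits \<open>M\<close> as \<open>M0 \<oplus> span E\<close>.\<close>
  obtain f where f: "\<And>e. e \<in> E \<Longrightarrow> cfunctional (f e)" "\<And>e. e \<in> E \<Longrightarrow> f e e = 1"
      "\<And>e d. e \<in> E \<Longrightarrow> d \<in> E \<Longrightarrow> d \<noteq> e \<Longrightarrow> f e d = 0"
    using ex_biorthogonal[OF E(1,2)] by metis
  have f_diff: "f e (x - y) = f e x - f e y" and f_add: "f e (x + y) = f e x + f e y"
    and f_scale: "f e (c *\<^sub>C x) = c * f e x" and f_zero: "f e 0 = 0" 
    and f_cont: "continuous_on UNIV (f e)" if e: "e \<in> E" for e x y c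
    using f(1)[OF e] unfolding cfunctional_def
    by (auto simp: linear_diff linear_add linear_0 bounded_linear.linear linear_continuous_on)
  \<comment> \<open>The index condition leaves room modulo the range for an independent copy \<open>G\<close> of \<open>E\<close>.\<close>
  obtain G where G: "G \<subseteq> M" "finite G" "card G = card E" "indep_mod ?R G"
    using le le_beta_iff[OF M(1), of "card E" T] E(4) by auto
  obtain g where g: "bij_betw g E G" using finite_same_card_bij[OF E(1) G(2)] G(3) by auto
  have gG: "g e \<in> G" if "e \<in> E" for e using g that by (auto simp: bij_betw_def)
  define K where "K = (\<Sum>e\<in>E. rank_one (g e) (f e))"
  have K: "app K x = (\<Sum>e\<in>E. f e x *\<^sub>C g e)" for x
    unfolding K_def app_sum_left by (rule sum.cong) (simp_all add: app_rank_one f(1))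
  define H where "H = T + K"
  have H: "app H x = app T x + app K x" for x by (simp add: H_def app_add_left)
  have Kspan: "app K x \<in> cspan G" for x
    unfolding K using gG by (intro complex_vector.span_sum complex_vector.span_scale complex_vector.span_base) auto
  have spanGM: "cspan G \<subseteq> M" by (rule complex_vector.span_minimal[OF G(1) M(1)])
  have KE: "app K e = g e" if e: "e \<in> E" for e
  proof -
    have "app K e = (\<Sum>d\<in>E. if d = e then g d else 0)"
      unfolding K by (rule sum.cong) (use f(2,3) e in \<open>auto simp: scaleC_one\<close>)
    then show ?thesis using E(1) e by simp
  qed
  have Kzero: "app K x = 0" if "\<And>e. e \<in> E \<Longrightarrow> f e x = 0" for x
    unfolding K using that by simp
  have Hinj: "M \<inter> null_space H = {0}"
  proof -
    have "x = 0" if x: "x \<in> M" "app H x = 0" for x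
    proof -
      have "app T (- x) = - app T x" using app_diff_right[of T 0 x] by simp
      then have "app K x = app T (- x)" using x(2) unfolding H by (metis add_eq_0_iff)
      moreover have "- x \<in> M" using x(1) M(1) by (rule complex_vector.subspace_neg[rotated])
      ultimately have KR: "app K x \<in> ?R" by simp
      have "app K x = (\<Sum>b\<in>G. f (inv_into E g b) x *\<^sub>C b)"
        unfolding K sum.reindex_bij_betw[OF g, symmetric]
        using g by (intro sum.cong) (auto simp: bij_betw_def)
      then have "\<forall>b\<in>G. f (inv_into E g b) x = 0" using KR G(4) unfolding indep_mod_iff_sum[OF R G(2)] by metis
      then have f0: "f e x = 0" if "e \<in> E" for e
        using that gG[OF that] g by (metis bij_betw_inv_into_left)
      then have "app K x = 0" by (rule Kzero)
      then have "x \<in> cspan E" using x unfolding H E(3)[symmetric] by (simp add: null_space_def)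
      then have "x = (\<Sum>e\<in>E. f e x *\<^sub>C e)" using biorthogonal_expansion[of E f x] E(1) f by simp
      then show ?thesis using f0 by simp
    qed
    moreover have "0 \<in> M" using M(1) by (rule complex_vector.subspace_0)
    ultimately show ?thesis by (auto simp: null_space_def)
  qed
  define M0 where "M0 = {x \<in> M. \<forall>e\<in>E. f e x = 0}"
  have M0: "csubspace M0" "M0 \<subseteq> M"
    using M(1) by (auto simp: M0_def complex_vector.subspace_def f_add f_scale f_zero)
  have "M0 = M \<inter> (\<Inter>e\<in>E. {x. f e x = 0})" by (auto simp: M0_def)
  then have clM0: "closed M0"
    using M(2) f_cont by (auto intro!: closed_Int closed_INT closed_Collect_eq continuous_on_const)
  have ME: "M \<subseteq> cspan (E \<union> M0)"
  proof
    fix x assume x: "x \<in> M"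
    define p where "p = (\<Sum>e\<in>E. f e x *\<^sub>C e)"
    have p: "p \<in> cspan E" unfolding p_def
      by (intro complex_vector.span_sum complex_vector.span_scale complex_vector.span_base)
    have "p \<in> M" using p complex_vector.span_minimal[OF EM M(1)] by blast
    moreover have "f e (x - p) = 0" if e: "e \<in> E" for e
    proof -
      have "f e p = (\<Sum>d\<in>E. f d x * f e d)" unfolding p_def
        using f(1)[OF e] by (simp add: cfunctional_def bounded_linear.linear linear_sum)
      also have "\<dots> = (\<Sum>d\<in>E. if d = e then f d x else 0)"
        by (rule sum.cong) (use f(2,3) e in auto)
      also have "\<dots> = f e x" using E(1) e by simp
      finally show ?thesis by (simp add: f_diff e)
    qed
    ultimately have "x - p \<in> M0" using x complex_vector.subspace_diff[OF M(1)] by (auto simp: M0_def)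
    then have "x - p \<in> cspan M0" by (rule complex_vector.span_base)
    then have "p + (x - p) \<in> cspan (E \<union> M0)" using p unfolding complex_vector.span_Un by blast
    then show "x \<in> cspan (E \<union> M0)" by simp
  qed
  have HM: "app H ` M = cspan (G \<union> ?R)"
  proof
    show "app H ` M \<subseteq> cspan (G \<union> ?R)"
    proof
      fix y assume "y \<in> app H ` M"
      then obtain x where x: "x \<in> M" "y = app T x + app K x" by (auto simp: H)
      have "app T x \<in> cspan (G \<union> ?R)" using x(1) by (intro complex_vector.span_base) auto
      moreover have "app K x \<in> cspan (G \<union> ?R)"
        using Kspan complex_vector.span_mono[of G "G \<union> ?R"] by auto
      ultimately show "y \<in> cspan (G \<union> ?R)" unfolding x(2) by (rule complex_vector.span_add)
    qed
    have "g e \<in> app H ` M" if e: "e \<in> E" for e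
      using e EM by (intro image_eqI[of _ _ e]) (auto simp: H KE TE)
    then have "G \<subseteq> app H ` M" using g by (auto simp: bij_betw_def)
    moreover have "?R \<subseteq> app H ` M"
    proof
      fix y assume "y \<in> ?R"
      then have "y \<in> app T ` cspan (E \<union> M0)" using ME by blast
      then obtain u v where uv: "y = app T (u + v)" "u \<in> cspan E" "v \<in> M0"
        unfolding complex_vector.span_Un cspan_subspace[OF M0(1)] by blast
      have "app T u = 0" using uv(2) E(3) by (auto simp: null_space_def)
      moreover have "app K v = 0" using uv(3) by (intro Kzero) (auto simp: M0_def)
      ultimately have "y = app H v" using uv(1) by (simp add: H)
      then show "y \<in> app H ` M" using uv(3) M0(2) by blast
    qed
    ultimately show "cspan (G \<union> ?R) \<subseteq> app H ` M"
      by (intro complex_vector.span_minimal csubspace_image M(1)) auto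
  qed
  have "closed (app H ` M)" unfolding HM by (rule closed_cspan_Un[OF R cl G(2)])
  then obtain c where c: "c > 0" "\<And>x. x \<in> M \<Longrightarrow> c * norm x \<le> norm (app H x)"
    using bounded_below_estimate[OF M _ Hinj] by blast
  show thesis
  proof (rule that[OF c(1)])
    fix \<mu> assume \<mu>: "cmod \<mu> < c"
    define S where "S = T - \<mu> *\<^sub>C 1"
    define J where "J = H - \<mu> *\<^sub>C 1"
    have SM: "app S ` M \<subseteq> M"
      using inv M(1) unfolding S_def app_shift
      by (auto intro!: complex_vector.subspace_diff complex_vector.subspace_scale)
    have JS: "app J x = app S x + app K x" for x by (simp add: J_def S_def app_shift H)
    have J_est: "(c - cmod \<mu>) * norm x \<le> norm (app J x)" if x: "x \<in> M" for x
    proof -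
      have "c * norm x \<le> norm (app H x)" by (rule c(2)[OF x])
      also have "\<dots> \<le> norm (app J x) + norm (\<mu> *\<^sub>C x)"
        unfolding J_def app_shift
        using norm_triangle_ineq[of "app H x - \<mu> *\<^sub>C x" "\<mu> *\<^sub>C x"] by simp
      finally show ?thesis by (simp add: norm_scaleC algebra_simps)
    qed
    have Jinj: "x = 0" if "x \<in> M" "app J x = 0" for x
      using J_est[OF that(1)] that(2) \<mu> by (simp add: mult_le_0_iff)
    have SJ: "app S x = app J x" if "x \<in> M0" for x
      using Kzero[of x] that by (simp add: JS M0_def)
    have "app S ` M0 = app J ` M0" using SJ by (rule image_cong[OF refl])
    moreover have "closed (app J ` M0)"
      by (rule closed_image_estimate[of "c - cmod \<mu>"]) (use \<mu> M0 clM0 J_est in auto)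
    ultimately have clSM0: "closed (app S ` M0)" by simp
    have EM0: "cspan (E \<union> M0) = M"
      using ME complex_vector.span_minimal[of "E \<union> M0" M] EM M0(2) M(1) by auto
    have "app S ` M = cspan (app S ` E \<union> app S ` M0)"
      unfolding EM0[symmetric] app_span_image image_Un ..
    then show "closed (app (T - \<mu> *\<^sub>C 1) ` M)"
      using closed_cspan_Un[OF csubspace_image[OF M0(1)] clSM0, of "app S ` E"] E(1) by (simp add: S_def)
    \<comment> \<open>Independent null vectors of \<open>S\<close> stay independent modulo \<open>M0\<close>, where \<open>S\<close> is injective.\<close>
    have exch: "\<exists>F\<subseteq>E. card D + card F \<le> card E \<and> E \<subseteq> cspan (D \<union> F \<union> M0)"
      if D: "D \<subseteq> M \<inter> null_space S" "finite D" "complex_vector.independent D" for D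
    proof (rule exchange_mod[OF D(2) E(1)])
      show "D \<subseteq> cspan (E \<union> M0)" using D(1) ME by blast
      show "indep_mod M0 D"
        unfolding indep_mod_def
      proof (intro ballI notI)
        fix d assume d: "d \<in> D" and "d \<in> cspan ((D - {d}) \<union> M0)"
        then obtain s m where sm: "d = s + m" "s \<in> cspan (D - {d})" "m \<in> M0"
          unfolding complex_vector.span_Un cspan_subspace[OF M0(1)] by blast
        have "cspan (D - {d}) \<subseteq> null_space S"
          using D(1) by (intro complex_vector.span_minimal csubspace_null_space) auto
        then have "app S s = 0" using sm(2) by (auto simp: null_space_def)
        moreover have "app S (s + m) = 0" using sm(1) d D(1) by (auto simp: null_space_def)
        ultimately have "app S m = 0" by simp
        then have "m = 0" using sm(3) SJ[of m] Jinj[of m] M0(2) by auto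
        then show False using sm d D(3) unfolding complex_vector.dependent_def by auto
      qed
    qed
    show "alpha_on M (T - \<mu> *\<^sub>C 1) \<le> alpha_on M T"
      unfolding S_def[symmetric] enat_le_iff_all[of "alpha_on M S"] le_alpha_iff[OF M(1), of _ S] E(4)
    proof (intro allI impI)
      fix r assume "\<exists>D\<subseteq>M \<inter> null_space S. finite D \<and> card D = r \<and> complex_vector.independent D"
      then obtain D where D: "D \<subseteq> M \<inter> null_space S" "finite D" "card D = r" "complex_vector.independent D"
        by blast
      obtain F where "F \<subseteq> E" "card D + card F \<le> card E" using exch[OF D(1,2,4)] by metis
      then show "enat r \<le> enat (card E)" using D(3) by simp
    qed
    show "alpha_on M (T - \<mu> *\<^sub>C 1) \<le> beta_on M (T - \<mu> *\<^sub>C 1)"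
      unfolding S_def[symmetric] enat_le_iff_all[of "alpha_on M S"]
    proof (intro allI impI, rule ccontr)
      fix r assume r: "enat r \<le> alpha_on M S" and "\<not> enat r \<le> beta_on M S"
      \<comment> \<open>Fewer than \<open>r\<close> vectors \<open>B\<close> span \<open>M\<close> modulo \<open>S M\<close>, and \<open>S M\<close> is spanned modulo \<open>S M0\<close> by the
        images of at most \<open>card E - r\<close> vectors \<open>F\<close>, as \<open>r\<close> dimensions of \<open>M / M0\<close> are null vectors.
        But \<open>J\<close> maps \<open>E\<close> to \<open>card E\<close> vectors that are independent modulo \<open>J M0 = S M0\<close>.\<close>
      then have "beta_on M S < enat r" by simp
      then obtain B where B: "B \<subseteq> M" "finite B" "card B < r" "M \<subseteq> cspan (B \<union> app S ` M)"
        using beta_less_imp_spanning[OF M(1)] by blast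
      obtain D where D: "D \<subseteq> M \<inter> null_space S" "finite D" "card D = r" "complex_vector.independent D"
        using r unfolding le_alpha_iff[OF M(1)] by blast
      obtain F where F: "F \<subseteq> E" "card D + card F \<le> card E" "E \<subseteq> cspan (D \<union> F \<union> M0)"
        using exch[OF D(1,2,4)] by metis
      have finF: "finite F" using F(1) E(1) by (rule finite_subset)
      have "E \<union> M0 \<subseteq> cspan (D \<union> F \<union> M0)"
        using F(3) complex_vector.span_superset[of "D \<union> F \<union> M0"] by auto
      then have "M \<subseteq> cspan (D \<union> F \<union> M0)"
        using ME complex_vector.span_minimal[OF _ complex_vector.subspace_span] by blast
      then have "app S ` M \<subseteq> cspan (app S ` (D \<union> F \<union> M0))" unfolding app_span_image[symmetric] by blast
      also have "\<dots> \<subseteq> cspan (app S ` F \<union> app S ` M0)"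
        using D(1) complex_vector.span_zero[of "app S ` F \<union> app S ` M0"]
          complex_vector.span_superset[of "app S ` F \<union> app S ` M0"]
        by (intro complex_vector.span_minimal) (auto simp: image_Un null_space_def)
      also have "\<dots> \<subseteq> cspan ((B \<union> app S ` F) \<union> app S ` M0)"
        by (rule complex_vector.span_mono) auto
      finally have "B \<union> app S ` M \<subseteq> cspan ((B \<union> app S ` F) \<union> app S ` M0)"
        using complex_vector.span_superset[of "(B \<union> app S ` F) \<union> app S ` M0"] by auto
      then have span: "M \<subseteq> cspan ((B \<union> app S ` F) \<union> app S ` M0)"
        using B(4) complex_vector.span_minimal[OF _ complex_vector.subspace_span] by blast
      have injE: "inj_on (app J) M"
      proof (rule inj_onI)
        fix x y assume xy: "x \<in> M" "y \<in> M" and eq: "app J x = app J y"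
        have "x - y = 0"
          by (rule Jinj[OF complex_vector.subspace_diff[OF M(1) xy]]) (simp add: eq)
        then show "x = y" by simp
      qed
      have JM: "app J ` M \<subseteq> M"
      proof safe
        fix x assume "x \<in> M"
        then show "app J x \<in> M"
          unfolding JS using SM Kspan[of x] spanGM by (intro complex_vector.subspace_add[OF M(1)]) auto
      qed
      have "indep_mod (app S ` M0) (app J ` E)"
        unfolding indep_mod_def
      proof (intro ballI notI)
        fix y assume "y \<in> app J ` E" and y: "y \<in> cspan ((app J ` E - {y}) \<union> app S ` M0)"
        then obtain e where e: "e \<in> E" "y = app J e" by blast
        have "(app J ` E - {y}) \<union> app S ` M0 \<subseteq> app J ` ((E - {e}) \<union> M0)"
          using e SJ by auto
        from complex_vector.span_mono[THEN subsetD, OF this y]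
        have "y \<in> app J ` cspan ((E - {e}) \<union> M0)" unfolding app_span_image .
        then obtain z where z: "z \<in> cspan ((E - {e}) \<union> M0)" "app J e = app J z"
          unfolding e(2) by (elim imageE) simp
        have "cspan ((E - {e}) \<union> M0) \<subseteq> M" using EM M0(2) M(1) by (intro complex_vector.span_minimal) auto
        then have "e = z" using z(1) e(1) EM by (intro inj_onD[OF injE z(2)]) auto
        have "csubspace {x. f e x = 0}"
          using e(1) by (auto simp: complex_vector.subspace_def f_add f_scale f_zero)
        then have "cspan ((E - {e}) \<union> M0) \<subseteq> {x. f e x = 0}"
          using f(3)[OF e(1)] e(1) by (intro complex_vector.span_minimal) (auto simp: M0_def)
        then show False using z(1) \<open>e = z\<close> f(2)[OF e(1)] by auto
      qed
      then have "card (app J ` E) \<le> card (B \<union> app S ` F)"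
        using indep_mod_card_le[of "app J ` E" "B \<union> app S ` F" "app S ` M0"] span JM EM E(1) B(2) finF by auto
      moreover have "card (app J ` E) = card E" using injE EM by (intro card_image) (rule inj_on_subset)
      moreover have "card (B \<union> app S ` F) \<le> card B + card F"
        using card_Un_le[of B "app S ` F"] card_image_le[OF finF, of "app S"] by linarith
      ultimately show False using F(2) D(3) B(3) by simp
    qed
  qed
qed

text \<open>On the quotient by \<open>R(T^n)\<close> and on \<open>N(T^n)\<close> the operator \<open>T\<close> is nilpotent, so \<open>T - \<mu>\<close> is invertible
  there for \<open>\<mu> \<noteq> 0\<close>. Hence kernel, range and deficiency of \<open>T - \<mu>\<close> are visible on the invariant
  subspace \<open>R(T^n)\<close>.\<close>

lemma null_space_shift_subset:
  assumes "\<mu> \<noteq> 0" shows "null_space (T - \<mu> *\<^sub>C 1) \<subseteq> range (app (T ^ n))"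
proof
  fix x assume "x \<in> null_space (T - \<mu> *\<^sub>C 1)"
  then have Tx: "app T x = \<mu> *\<^sub>C x" by (simp add: null_space_def app_shift)
  show "x \<in> range (app (T ^ n))"
  proof (induction n)
    case (Suc n)
    then obtain z where z: "x = app (T ^ n) z" by blast
    have "x = inverse \<mu> *\<^sub>C app T x" using assms Tx by (simp add: scaleC_scaleC scaleC_one)
    also have "\<dots> = app (T ^ Suc n) (inverse \<mu> *\<^sub>C z)" unfolding app_power_Suc using z by simp
    finally show ?case by (rule range_eqI)
  qed simp
qed

lemma null_space_power_subset_range_shift:
  assumes "\<mu> \<noteq> 0" "app (T ^ n) x = 0" shows "x \<in> range (app (T - \<mu> *\<^sub>C 1))"
  using assms(2)
proof (induction n arbitrary: x)
  case 0
  then have "x = app (T - \<mu> *\<^sub>C 1) 0" by simp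
  then show ?case by (rule range_eqI)
next
  case (Suc n)
  have "app (T ^ n) (app T x) = 0" using Suc.prems by (simp add: app_power_commute app_times)
  then obtain z where z: "app T x = app (T - \<mu> *\<^sub>C 1) z" using Suc.IH by blast
  have "\<mu> *\<^sub>C x = app T x - app (T - \<mu> *\<^sub>C 1) x" by (simp add: app_shift)
  also have "\<dots> = app (T - \<mu> *\<^sub>C 1) (z - x)" using z by simp
  finally have "inverse \<mu> *\<^sub>C (\<mu> *\<^sub>C x) = app (T - \<mu> *\<^sub>C 1) (inverse \<mu> *\<^sub>C (z - x))"
    by (simp only: app_scaleC_right)
  then have "x = app (T - \<mu> *\<^sub>C 1) (inverse \<mu> *\<^sub>C (z - x))" using assms(1) by (simp add: scaleC_scaleC scaleC_one)
  then show ?case by (rule range_eqI)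
qed

lemma range_shift_Int_range_power:
  assumes "\<mu> \<noteq> 0" and x: "app (T - \<mu> *\<^sub>C 1) x \<in> range (app (T ^ n))"
  shows "x \<in> range (app (T ^ n))"
proof -
  have "x \<in> range (app (T ^ k))" if "k \<le> n" for k
    using that
  proof (induction k)
    case (Suc k)
    then obtain z where z: "x = app (T ^ k) z" by auto
    have "app (T - \<mu> *\<^sub>C 1) x \<in> range (app (T ^ Suc k))"
      using x range_power_antimono[OF Suc.prems, of T] by blast
    moreover have "app T x \<in> range (app (T ^ Suc k))" by (metis z app_power_Suc rangeI)
    ultimately have "app T x - app (T - \<mu> *\<^sub>C 1) x \<in> range (app (T ^ Suc k))"
      by (intro complex_vector.subspace_diff[OF csubspace_range])
    then have "\<mu> *\<^sub>C x \<in> range (app (T ^ Suc k))" by (simp add: app_shift)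
    then have "inverse \<mu> *\<^sub>C (\<mu> *\<^sub>C x) \<in> range (app (T ^ Suc k))"
      by (rule complex_vector.subspace_scale[OF csubspace_range])
    then show ?case using assms(1) by (simp add: scaleC_scaleC scaleC_one)
  qed simp
  then show ?thesis by blast
qed

lemma closed_range_shift:
  assumes \<mu>: "\<mu> \<noteq> 0" and cl: "closed (app (T - \<mu> *\<^sub>C 1) ` range (app (T ^ n)))"
  shows "closed (range (app (T - \<mu> *\<^sub>C 1)))"
proof -
  let ?S = "T - \<mu> *\<^sub>C 1"
  have comm: "app (T ^ n) (app ?S x) = app ?S (app (T ^ n) x)" for x
    by (simp add: app_shift app_power_commute)
  have "range (app ?S) = app (T ^ n) -` (app ?S ` range (app (T ^ n)))"
  proof (intro subset_antisym subsetI)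
    fix y assume "y \<in> range (app ?S)"
    then show "y \<in> app (T ^ n) -` (app ?S ` range (app (T ^ n)))" using comm by auto
  next
    fix y assume "y \<in> app (T ^ n) -` (app ?S ` range (app (T ^ n)))"
    then obtain z where "app (T ^ n) y = app ?S (app (T ^ n) z)" by blast
    then have "app (T ^ n) (y - app ?S z) = 0" by (simp only: app_diff_right comm) simp
    then have "y - app ?S z \<in> range (app ?S)" by (rule null_space_power_subset_range_shift[OF \<mu>])
    then have "(y - app ?S z) + app ?S z \<in> range (app ?S)"
      by (rule complex_vector.subspace_add[OF csubspace_range _ rangeI])
    then show "y \<in> range (app ?S)" by simp
  qed
  then show ?thesis using closed_vimage[OF cl continuous_on_app[of UNIV]] by simp
qed

lemma alpha_shift: "\<mu> \<noteq> 0 \<Longrightarrow> alpha (T - \<mu> *\<^sub>C 1) = alpha_on (range (app (T ^ n))) (T - \<mu> *\<^sub>C 1)"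
  using null_space_shift_subset[of \<mu> T n] unfolding alpha_on_def by (simp add: Int_absorb1)

lemma beta_shift_ge:
  assumes \<mu>: "\<mu> \<noteq> 0"
  shows "beta_on (range (app (T ^ n))) (T - \<mu> *\<^sub>C 1) \<le> beta_on UNIV (T - \<mu> *\<^sub>C 1)"
proof -
  let ?S = "T - \<mu> *\<^sub>C 1" and ?M = "range (app (T ^ n))"
  have ind: "indep_mod (range (app ?S)) E" if E: "E \<subseteq> ?M" "indep_mod (app ?S ` ?M) E" for E
    unfolding indep_mod_def
  proof (intro ballI notI)
    fix e assume e: "e \<in> E" and "e \<in> cspan ((E - {e}) \<union> range (app ?S))"
    then obtain s x where sx: "e = s + app ?S x" "s \<in> cspan (E - {e})"
      unfolding complex_vector.span_Un cspan_subspace[OF csubspace_range] by blast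
    have "cspan (E - {e}) \<subseteq> ?M" using E(1) by (intro complex_vector.span_minimal csubspace_range) auto
    then have "e - s \<in> ?M" using sx(2) e E(1) by (intro complex_vector.subspace_diff[OF csubspace_range]) auto
    then have "app ?S x \<in> ?M" using sx(1) by simp
    then have "x \<in> ?M" by (rule range_shift_Int_range_power[OF \<mu>])
    then have "app ?S x \<in> cspan (app ?S ` ?M)" by (intro complex_vector.span_base imageI)
    then have "e \<in> cspan ((E - {e}) \<union> app ?S ` ?M)" unfolding complex_vector.span_Un using sx by blast
    then show False using E(2) e unfolding indep_mod_def by blast
  qed
  show ?thesis
    unfolding enat_le_iff_all[of "beta_on ?M ?S"] le_beta_iff[OF csubspace_range]
      le_beta_iff[OF complex_vector.subspace_UNIV]
  proof (intro allI impI)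
    fix a assume "\<exists>E\<subseteq>?M. finite E \<and> card E = a \<and> indep_mod (app ?S ` ?M) E"
    then obtain E where "E \<subseteq> ?M" "finite E" "card E = a" "indep_mod (app ?S ` ?M) E" by blast
    then show "\<exists>E\<subseteq>UNIV. finite E \<and> card E = a \<and> indep_mod (range (app ?S)) E"
      using ind[of E] by (intro exI[of _ E]) simp
  qed
qed

text \<open>A null vector \<open>x0\<close> with an infinite chain of preimages \<open>T x(i+1) = x(i)\<close> of geometrically
  bounded norms continues to the null vector \<open>\<Sum>i. \<mu>^i x(i)\<close> of \<open>T - \<mu>\<close>. The open mapping theorem
  provides the bounds, and the chain never stops: a preimage in \<open>R(T^n)\<close> of an element of \<open>I\<close>, the
  intersection of all ranges, differs from one in \<open>R(T^k)\<close> by a null vector, hence lies in \<open>I\<close>.\<close>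

lemma null_vector_perturbation:
  fixes T :: "'a::complex_banach bop"
  assumes cl: "closed (range (app (T ^ n)))" "closed (range (app (T ^ Suc n)))"
    and sub: "\<And>k. null_space T \<inter> range (app (T ^ n)) \<subseteq> range (app (T ^ k))"
    and x0: "x0 \<in> null_space T \<inter> range (app (T ^ n))" "x0 \<noteq> 0"
  obtains \<delta> where "\<delta> > 0" "\<And>\<mu>. cmod \<mu> < \<delta> \<Longrightarrow> \<exists>x. x \<noteq> 0 \<and> app (T - \<mu> *\<^sub>C 1) x = 0"
proof -
  let ?M = "range (app (T ^ n))"
  define I where "I = (\<Inter>k. range (app (T ^ k)))"
  have "closed (app T ` ?M)" unfolding range_power_Suc by (rule cl(2))
  then obtain C where C: "C > 0" "\<And>y. y \<in> app T ` ?M \<Longrightarrow> \<exists>x\<in>?M. app T x = y \<and> norm x \<le> C * norm y"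
    using app_open_mapping[OF csubspace_range cl(1)] by blast
  have "\<exists>x\<in>I. app T x = y \<and> norm x \<le> C * norm y" if y: "y \<in> I" for y
  proof -
    have "y \<in> range (app (T ^ Suc n))" using y unfolding I_def by blast
    then obtain x where x: "x \<in> ?M" "app T x = y" "norm x \<le> C * norm y"
      using C(2) unfolding range_power_Suc by blast
    have "x \<in> range (app (T ^ k))" for k
    proof -
      define m where "m = max k n"
      have "y \<in> range (app (T ^ Suc m))" using y unfolding I_def by blast
      then obtain z where z: "y = app T (app (T ^ m) z)" unfolding app_power_Suc by blast
      have zm: "app (T ^ m) z \<in> ?M" using range_power_antimono[of n m T] by (auto simp: m_def)
      have "x - app (T ^ m) z \<in> null_space T \<inter> ?M"
        using x z complex_vector.subspace_diff[OF csubspace_range x(1) zm] by (simp add: null_space_def)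
      then have "x - app (T ^ m) z \<in> range (app (T ^ m))" using sub by blast
      then have "(x - app (T ^ m) z) + app (T ^ m) z \<in> range (app (T ^ m))"
        by (rule complex_vector.subspace_add[OF csubspace_range _ rangeI])
      then show ?thesis using range_power_antimono[of k m T] by (auto simp: m_def)
    qed
    then show ?thesis using x unfolding I_def by blast
  qed
  then obtain g where g: "\<And>y. y \<in> I \<Longrightarrow> g y \<in> I" "\<And>y. y \<in> I \<Longrightarrow> app T (g y) = y"
      "\<And>y. y \<in> I \<Longrightarrow> norm (g y) \<le> C * norm y" by metis
  define x where "x i = (g ^^ i) x0" for i
  have xS: "x (Suc i) = g (x i)" and x00: "x 0 = x0" for i by (simp_all add: x_def)
  have xI: "x i \<in> I" for i
  proof (induction i)
    case 0 show ?case using x0(1) sub by (auto simp: x00 I_def)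
  qed (simp add: xS g(1))
  have xn: "norm (x i) \<le> C ^ i * norm x0" for i
  proof (induction i)
    case (Suc i)
    have "norm (x (Suc i)) \<le> C * norm (x i)" unfolding xS by (rule g(3)[OF xI])
    also have "\<dots> \<le> C * (C ^ i * norm x0)" using Suc C(1) by (intro mult_left_mono) auto
    finally show ?case by (simp add: mult.assoc)
  qed (simp add: x00)
  show thesis
  proof (rule that[of "inverse (2 * C)"])
    show "inverse (2 * C) > 0" using C(1) by simp
    fix \<mu> assume "cmod \<mu> < inverse (2 * C)"
    define q where "q = cmod \<mu> * C"
    have q: "0 \<le> q" "q < 1/2"
      using \<open>cmod \<mu> < inverse (2 * C)\<close> C(1) by (auto simp: q_def field_simps)
    define t where "t i = \<mu> ^ i *\<^sub>C x i" for i
    have tn: "norm (t i) \<le> norm x0 * q ^ i" for i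
    proof -
      have "norm (t i) = cmod \<mu> ^ i * norm (x i)" by (simp add: t_def norm_scaleC norm_power)
      also have "\<dots> \<le> cmod \<mu> ^ i * (C ^ i * norm x0)" using xn by (intro mult_left_mono) auto
      finally show ?thesis by (simp add: q_def power_mult_distrib mult_ac)
    qed
    have sg: "summable (\<lambda>i. norm x0 * q ^ i)" using q by (intro summable_mult summable_geometric) simp
    have sn: "summable (\<lambda>i. norm (t i))"
      by (rule summable_comparison_test'[OF sg, of 0]) (use tn in auto)
    then have sm: "summable t" by (rule summable_norm_cancel)
    have T0: "app T (t 0) = 0" using x0(1) by (simp add: t_def x00 null_space_def)
    have TS: "app T (t (Suc i)) = \<mu> *\<^sub>C t i" for i
      using g(2)[OF xI[of i]] by (simp add: t_def xS scaleC_scaleC)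
    have sT: "summable (\<lambda>i. app T (t i))" by (rule bounded_linear.summable[OF app_bounded_linear sm])
    have "app T (suminf t) = (\<Sum>i. app T (t i))" by (rule bounded_linear.suminf[OF app_bounded_linear sm])
    also have "\<dots> = (\<Sum>i. app T (t (Suc i)))" using suminf_split_head[OF sT] T0 by simp
    also have "\<dots> = \<mu> *\<^sub>C suminf t"
      unfolding TS by (rule bounded_linear.suminf[OF bounded_linear_scaleC sm, symmetric])
    finally have null: "app (T - \<mu> *\<^sub>C 1) (suminf t) = 0" by (simp add: app_shift)
    have "suminf t \<noteq> 0"
    proof
      assume "suminf t = 0"
      then have "(\<Sum>i. t (Suc i)) = - x0"
        using suminf_split_head[OF sm] by (simp add: t_def x00 scaleC_one)
      moreover have sn': "summable (\<lambda>i. norm (t (Suc i)))" using sn by (rule summable_ignore_initial_segment[of _ 1, simplified])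
      ultimately have "norm x0 \<le> (\<Sum>i. norm (t (Suc i)))"
        using summable_norm[OF sn'] by simp
      also have "\<dots> \<le> (\<Sum>i. norm x0 * q ^ Suc i)"
        using sg by (intro suminf_le tn sn') (subst summable_Suc_iff)
      also have "\<dots> = norm x0 * q / (1 - q)"
        using q suminf_geometric[of q] by (simp add: suminf_mult summable_geometric flip: mult.assoc)
      finally have "norm x0 * (1 - q) \<le> norm x0 * q" using q by (simp add: field_simps)
      then have "1 - q \<le> q" using x0(2) by simp
      then show False using q by simp
    qed
    then show "\<exists>x. x \<noteq> 0 \<and> app (T - \<mu> *\<^sub>C 1) x = 0" using null by blast
  qed
qed

section \<open>The upper semi B-Weyl spectrum\<close>

lemma cdim_zero_iff:
  assumes "csubspace V"
  shows "cdim V = 0 \<longleftrightarrow> V = {0}"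
proof
  assume V: "cdim V = 0"
  then obtain E where E: "finite E" "V = cspan E" "cdim V = enat (card E)"
    using finite_cdim_basis[OF assms] by (metis enat_ord_simps(4) zero_enat_def enat.distinct(1))
  then have "E = {}" using V by (simp add: zero_enat_def)
  then show "V = {0}" using E(2) by simp
next
  assume V: "V = {0}"
  then have "cdim V < \<infinity>" using cdim_finite_span[of "{}" V] by simp
  then obtain E where E: "complex_vector.independent E" "V = cspan E" "cdim V = enat (card E)"
    using finite_cdim_basis[OF assms] by metis
  have "E \<subseteq> {0}" using E(2) V complex_vector.span_superset[of E] by simp
  moreover have "0 \<notin> E" using E(1) complex_vector.dependent_zero by metis
  ultimately have "E = {}" by auto
  then show "cdim V = 0" using E(3) by (simp add: zero_enat_def)
qed

lemma cdim_singleton_zero: "cdim {0} = 0"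
  using cdim_zero_iff[of "{0}"] by (simp add: complex_vector.subspace_def)

lemma semi_B_fredholm_at_iff:
  "semi_B_fredholm_at n T \<longleftrightarrow> closed (range (app (T ^ n))) \<and> closed (range (app (T ^ Suc n))) \<and>
     alpha_on (range (app (T ^ n))) T < \<infinity>"
  unfolding semi_B_fredholm_at_def upper_semi_fredholm_on_def
  using range_power_invariant[of T n] range_power_antimono[of n "Suc n" T]
  by (auto simp: closedin_closed_eq range_power_Suc simp del: power_Suc)

lemma alpha_range_antimono:
  assumes "n \<le> m"
  shows "alpha_on (range (app (T ^ m))) T \<le> alpha_on (range (app (T ^ n))) T"
  unfolding alpha_on_def
  using range_power_antimono[OF assms, of T]
  by (intro cdim_mono csubspace_M_null csubspace_range) auto

lemma semi_B_fredholm_at_mono: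
  fixes T :: "'a::complex_banach bop"
  assumes "semi_B_fredholm_at n T" "n \<le> m"
  shows "semi_B_fredholm_at m T"
  using assms(2)
proof (induction m rule: dec_induct)
  case base show ?case by (rule assms(1))
next
  case (step m)
  have m: "closed (range (app (T ^ m)))" "closed (range (app (T ^ Suc m)))"
      "alpha_on (range (app (T ^ m))) T < \<infinity>"
    using step.IH unfolding semi_B_fredholm_at_iff by auto
  have "closed (app T ` range (app (T ^ Suc m)))"
  proof (rule closed_image_subspace[OF csubspace_range m(1)])
    show "closed (app T ` range (app (T ^ m)))" unfolding range_power_Suc by (rule m(2))
    show "cdim (range (app (T ^ m)) \<inter> null_space T) < \<infinity>" using m(3) by (simp add: alpha_on_def)
  qed (use m range_power_antimono[of m "Suc m" T] in \<open>auto simp del: power_Suc intro: csubspace_range\<close>)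
  then have "closed (range (app (T ^ Suc (Suc m))))" unfolding range_power_Suc .
  moreover have "alpha_on (range (app (T ^ Suc m))) T < \<infinity>"
    using alpha_range_antimono[of m "Suc m" T] m(3) by (meson le_less_trans lessI less_imp_le)
  ultimately show ?case unfolding semi_B_fredholm_at_iff using m(2) by blast
qed

lemma alpha_le_beta_range_iff:
  assumes fin: "alpha_on (range (app (T ^ n))) T < \<infinity>" and "n \<le> m"
  shows "alpha_on (range (app (T ^ n))) T \<le> beta_on (range (app (T ^ n))) T \<longleftrightarrow>
    alpha_on (range (app (T ^ m))) T \<le> beta_on (range (app (T ^ m))) T"
  using assms(2)
proof (induction m rule: dec_induct)
  case (step m)
  have "alpha_on (range (app (T ^ m))) T < \<infinity>"
    using alpha_range_antimono[OF step.hyps(1), of T] fin by (rule le_less_trans)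
  then show ?case
    using step.IH alpha_le_beta_image_iff[OF csubspace_range range_power_invariant]
    unfolding range_power_Suc by blast
qed simp

text \<open>The index is evaluated at the least admissible exponent, but its sign is the same at every larger one.\<close>

lemma notin_sigma_SBF_iff:
  fixes T :: "'a::complex_banach bop"
  shows "\<mu> \<notin> sigma_SBF T \<longleftrightarrow> (\<exists>n. semi_B_fredholm_at n (T - \<mu> *\<^sub>C 1) \<and>
    alpha_on (range (app ((T - \<mu> *\<^sub>C 1) ^ n))) (T - \<mu> *\<^sub>C 1)
      \<le> beta_on (range (app ((T - \<mu> *\<^sub>C 1) ^ n))) (T - \<mu> *\<^sub>C 1))"
proof -
  define S where "S = T - \<mu> *\<^sub>C 1"
  let ?a = "\<lambda>n. alpha_on (range (app (S ^ n))) S" and ?b = "\<lambda>n. beta_on (range (app (S ^ n))) S"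
  define n0 where "n0 = (LEAST n. semi_B_fredholm_at n S)"
  have iff: "\<mu> \<notin> sigma_SBF T \<longleftrightarrow> (\<exists>n. semi_B_fredholm_at n S) \<and> \<not> 0 < index_on (range (app (S ^ n0))) S"
    by (simp add: sigma_SBF_def upper_semi_B_fredholm_def B_index_def S_def n0_def)
  have n0: "semi_B_fredholm_at n0 S" if "semi_B_fredholm_at n S" for n
    unfolding n0_def using that by (rule LeastI)
  have n0_le: "n0 \<le> n" if "semi_B_fredholm_at n S" for n
    unfolding n0_def using that by (rule Least_le)
  have fin: "?a n < \<infinity>" if "semi_B_fredholm_at n S" for n
    using that by (simp add: semi_B_fredholm_at_iff)
  show ?thesis
    unfolding iff S_def[symmetric]
    using n0 n0_le fin not_index_pos_iff[of "range (app (S ^ n0))" S] alpha_le_beta_range_iff[of S n0] by blast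
qed

lemma left_drazin_imp_notin_sigma_SBF:
  fixes T :: "'a::complex_banach bop"
  assumes "left_drazin (T - \<mu> *\<^sub>C 1)"
  shows "\<mu> \<notin> sigma_SBF T"
proof -
  let ?S = "T - \<mu> *\<^sub>C 1"
  obtain n where n: "closed (range (app (?S ^ n)))" "closed (range (app (?S ^ Suc n)))"
      "null_space ?S \<inter> range (app (?S ^ n)) = {0}"
    using assms unfolding left_drazin_def by blast
  have "alpha_on (range (app (?S ^ n))) ?S = 0"
    unfolding alpha_on_def using n(3) by (simp add: Int_commute cdim_singleton_zero)
  then show ?thesis unfolding notin_sigma_SBF_iff semi_B_fredholm_at_iff using n
    by (intro exI[of _ n]) (simp del: power_Suc)
qed

lemma bounded_below_imp_left_drazin: "bounded_below T \<Longrightarrow> left_drazin T"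
  unfolding bounded_below_def left_drazin_def by (intro exI[of _ 0]) simp

text \<open>On \<open>R(T^n)\<close> the operator has trivial kernel and closed range, which persists for \<open>T - \<mu>\<close>; for \<open>\<mu> \<noteq> 0\<close>
  the kernel of \<open>T - \<mu>\<close> lies in \<open>R(T^n)\<close> and closedness of the range can be tested there.\<close>

lemma left_drazin_punctured_disc:
  fixes T :: "'a::complex_banach bop"
  assumes "left_drazin T"
  obtains \<delta> where "\<delta> > 0" "\<And>\<mu>. \<mu> \<noteq> 0 \<Longrightarrow> cmod \<mu> < \<delta> \<Longrightarrow> bounded_below (T - \<mu> *\<^sub>C 1)"
proof -
  obtain n where n: "closed (range (app (T ^ n)))" "closed (range (app (T ^ Suc n)))"
      "null_space T \<inter> range (app (T ^ n)) = {0}"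
    using assms unfolding left_drazin_def by blast
  let ?M = "range (app (T ^ n))"
  have a0: "alpha_on ?M T = 0"
    unfolding alpha_on_def using n(3) by (simp add: Int_commute cdim_singleton_zero)
  have cl: "closed (app T ` ?M)" unfolding range_power_Suc by (rule n(2))
  obtain \<delta> where \<delta>: "\<delta> > 0" "\<And>\<mu>. cmod \<mu> < \<delta> \<Longrightarrow> closed (app (T - \<mu> *\<^sub>C 1) ` ?M)"
      "\<And>\<mu>. cmod \<mu> < \<delta> \<Longrightarrow> alpha_on ?M (T - \<mu> *\<^sub>C 1) \<le> alpha_on ?M T"
    using index_nonpos_perturbation[OF csubspace_range n(1) range_power_invariant cl] a0 by auto
  show thesis
  proof (rule that[OF \<delta>(1)])
    fix \<mu> :: complex assume \<mu>: "\<mu> \<noteq> 0" "cmod \<mu> < \<delta>"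
    have "alpha (T - \<mu> *\<^sub>C 1) = 0" using \<delta>(3)[OF \<mu>(2)] a0 alpha_shift[OF \<mu>(1), of T n] by simp
    then have "null_space (T - \<mu> *\<^sub>C 1) = {0}"
      using cdim_zero_iff[OF csubspace_null_space, of "T - \<mu> *\<^sub>C 1"] by (simp add: alpha_on_def)
    then show "bounded_below (T - \<mu> *\<^sub>C 1)"
      unfolding bounded_below_def using closed_range_shift[OF \<mu>(1) \<delta>(2)[OF \<mu>(2)]] by blast
  qed
qed

text \<open>Left Drazin invertibility at a point of \<open>\<sigma>\<^sub>a(T)\<close> makes the point isolated in \<open>\<sigma>\<^sub>a(T)\<close>.\<close>

lemma Pi_a_eq:
  fixes T :: "'a::complex_banach bop"
  shows "Pi_a T = {\<mu> \<in> sigma_a T. left_drazin (T - \<mu> *\<^sub>C 1)}"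
proof -
  have "\<mu> isolated_in sigma_a T" if \<mu>: "\<mu> \<in> sigma_a T" and ld: "left_drazin (T - \<mu> *\<^sub>C 1)" for \<mu>
  proof -
    obtain \<delta> where \<delta>: "\<delta> > 0" "\<And>\<nu>. \<nu> \<noteq> 0 \<Longrightarrow> cmod \<nu> < \<delta> \<Longrightarrow> bounded_below (T - \<mu> *\<^sub>C 1 - \<nu> *\<^sub>C 1)"
      using left_drazin_punctured_disc[OF ld] by blast
    have "y = \<mu>" if y: "y \<in> sigma_a T" "dist \<mu> y < \<delta>" for y
    proof (rule ccontr)
      assume "y \<noteq> \<mu>"
      then have "bounded_below (T - \<mu> *\<^sub>C 1 - (y - \<mu>) *\<^sub>C 1)"
        using y(2) by (intro \<delta>(2)) (auto simp: dist_norm norm_minus_commute)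
      then show False using y(1) unfolding shift_shift sigma_a_def by simp
    qed
    then show ?thesis unfolding isolated_in_dist_Ex_iff using \<mu> \<delta>(1) by blast
  qed
  moreover have "\<mu> isolated_in sigma_a T \<Longrightarrow> \<mu> \<in> sigma_a T" for \<mu> by (simp add: isolated_in_dist_Ex_iff)
  ultimately show ?thesis unfolding Pi_a_def left_drazin_iff_ascent by blast
qed

lemma notin_sigma_a_imp_left_drazin: "\<mu> \<notin> sigma_a T \<Longrightarrow> left_drazin (T - \<mu> *\<^sub>C 1)"
  unfolding sigma_a_def by (auto intro: bounded_below_imp_left_drazin)

lemma notin_sigma_aw_imp_notin_sigma_SBF:
  fixes T :: "'a::complex_banach bop"
  assumes "upper_semi_fredholm (T - \<mu> *\<^sub>C 1)" "\<not> 0 < index (T - \<mu> *\<^sub>C 1)"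
  shows "\<mu> \<notin> sigma_SBF T"
proof -
  have R0: "range (app ((T - \<mu> *\<^sub>C 1) ^ 0)) = UNIV" by simp
  have fin: "alpha (T - \<mu> *\<^sub>C 1) < \<infinity>" and cl: "closed (range (app (T - \<mu> *\<^sub>C 1)))"
    using assms(1) by (auto simp: upper_semi_fredholm_on_def closedin_closed_eq)
  have "alpha (T - \<mu> *\<^sub>C 1) \<le> beta_on UNIV (T - \<mu> *\<^sub>C 1)"
    using not_index_pos_iff[OF fin] assms(2) by blast
  then show ?thesis
    unfolding notin_sigma_SBF_iff semi_B_fredholm_at_iff
    by (intro exI[of _ 0]) (unfold R0, use fin cl in simp)
qed

text \<open>The kernel of a left Drazin invertible operator, when finite-dimensional, has a
  finite-dimensional complement \<open>L\<close> of its intersection with any \<open>R(T^m)\<close>, so closedness of the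
  ranges descends to \<open>R(T)\<close>. Nullity and deficiency are compared on a far range, where the
  nullity is zero.\<close>

lemma left_drazin_imp_semi_weyl:
  fixes T :: "'a::complex_banach bop"
  assumes ld: "left_drazin T" and fin: "alpha T < \<infinity>"
  shows "upper_semi_fredholm T" "\<not> 0 < index T"
proof -
  obtain n where n: "closed (range (app (T ^ Suc n)))" "null_space T \<inter> range (app (T ^ n)) = {0}"
    using ld unfolding left_drazin_def by blast
  have descend: "closed (range (app (T ^ m)))" if cl: "closed (range (app (T ^ Suc m)))" for m
  proof -
    let ?R = "range (app (T ^ m))" and ?N = "null_space T"
    have fN: "cdim ?N < \<infinity>" using fin by (simp add: alpha_on_def)
    have "cdim (?R \<inter> ?N) \<le> cdim ?N"
      by (intro cdim_mono csubspace_M_null csubspace_range csubspace_null_space) auto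
    then have "cdim (?R \<inter> ?N) < \<infinity>" using fN by (rule le_less_trans)
    then obtain I' where I': "finite I'" "complex_vector.independent I'" "?R \<inter> ?N = cspan I'"
      using finite_cdim_basis[OF csubspace_M_null[OF csubspace_range]] by metis
    have "I' \<subseteq> ?N" using I'(3) complex_vector.span_superset[of I'] by auto
    then obtain I where I: "I' \<subseteq> I" "I \<subseteq> ?N" "complex_vector.independent I" "?N \<subseteq> cspan I"
      using complex_vector.maximal_independent_subset_extend[OF _ I'(2)] by blast
    obtain J where "finite J" "?N = cspan J" using finite_cdim_basis[OF csubspace_null_space fN] by metis
    then have finI: "finite I" using complex_vector.independent_span_bound[of J I] I(2,3) by auto
    define L where "L = cspan (I - I')"
    have LN: "L \<subseteq> ?N" unfolding L_def by (intro complex_vector.span_minimal csubspace_null_space) (use I(2) in auto)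
    have ind: "indep_mod (cspan I') (I - I')"
      unfolding indep_mod_def
    proof (intro ballI notI)
      fix e assume e: "e \<in> I - I'" and "e \<in> cspan ((I - I' - {e}) \<union> cspan I')"
      moreover have "cspan ((I - I' - {e}) \<union> cspan I') \<subseteq> cspan (I - {e})"
      proof (rule complex_vector.span_minimal)
        have "cspan I' \<subseteq> cspan (I - {e})" using e I(1) by (intro complex_vector.span_mono) auto
        then show "(I - I' - {e}) \<union> cspan I' \<subseteq> cspan (I - {e})"
          using complex_vector.span_superset[of "I - {e}"] by auto
      qed simp
      ultimately show False using I(3) e unfolding complex_vector.dependent_def by blast
    qed
    show ?thesis
    proof (rule closed_range_power_descend[OF cl, of L])
      show "csubspace L" "closed L" using finI by (auto simp: L_def closed_cspan_finite)
      show "L \<subseteq> ?N" by (rule LN)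
      show "?R \<inter> L = {0}"
      proof -
        have "x = 0" if x: "x \<in> ?R" "x \<in> L" for x
        proof -
          obtain c where c: "x = (\<Sum>b\<in>I - I'. c b *\<^sub>C b)"
            using x(2) finI unfolding L_def by (auto simp: complex_vector.span_finite)
          have "x \<in> cspan I'" using x LN I'(3) by blast
          then have "\<forall>b\<in>I - I'. c b = 0"
            using ind indep_mod_iff_sum[OF complex_vector.subspace_span, of "I - I'" I'] finI c by auto
          then show ?thesis using c by simp
        qed
        moreover have "0 \<in> ?R" "0 \<in> L"
          using complex_vector.subspace_0[OF csubspace_range] by (auto simp: L_def complex_vector.span_zero)
        ultimately show ?thesis by blast
      qed
      have "I \<subseteq> cspan (L \<union> ?R)"
      proof
        fix i assume i: "i \<in> I"
        show "i \<in> cspan (L \<union> ?R)"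
        proof (rule complex_vector.span_base)
          show "i \<in> L \<union> ?R"
          proof (cases "i \<in> I'")
            case True
            then have "i \<in> ?R" using I'(3) complex_vector.span_superset[of I'] by auto
            then show ?thesis by simp
          next
            case False
            then have "i \<in> L" using i unfolding L_def by (intro complex_vector.span_base) simp
            then show ?thesis by simp
          qed
        qed
      qed
      then have "cspan I \<subseteq> cspan (L \<union> ?R)" by (rule complex_vector.span_minimal) simp
      then show "?N \<subseteq> cspan (L \<union> ?R)" using I(4) by blast
    qed
  qed
  have "closed (range (app (T ^ 1)))"
    by (rule inc_induct[of 1 "Suc n" "\<lambda>m. closed (range (app (T ^ m)))"])
      (use n(1) descend in \<open>auto simp del: power_Suc\<close>)
  then show "upper_semi_fredholm T"
    using fin by (simp add: upper_semi_fredholm_on_def closedin_closed_eq)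
  have R0: "range (app (T ^ 0)) = UNIV" by simp
  have "alpha_on (range (app (T ^ n))) T = 0"
    unfolding alpha_on_def using n(2) by (simp add: Int_commute cdim_singleton_zero)
  then have "alpha T \<le> beta_on UNIV T"
    using alpha_le_beta_range_iff[of T 0 n] fin unfolding R0 by simp
  then show "\<not> 0 < index T" using not_index_pos_iff[OF fin] by blast
qed

text \<open>The dimensions of \<open>N(T - \<mu>) \<inter> R((T - \<mu>)^n)\<close> decrease to a stable value. If it were
  positive, every point of a punctured disc around \<open>\<mu>\<close> would lie in \<open>\<sigma>\<^sub>a(T)\<close> by continuation of null
  vectors, yet outside \<open>\<sigma>\<^sub>a\<^sub>w(T)\<close> by stability of the index; for an operator with \<open>a\<close>-Browder's
  theorem these points would be isolated in \<open>\<sigma>\<^sub>a(T)\<close>.\<close>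

lemma a_Browder_imp_left_drazin:
  fixes T :: "'a::complex_banach bop"
  assumes aB: "a_Browder T" and SBF: "\<mu> \<notin> sigma_SBF T"
  shows "left_drazin (T - \<mu> *\<^sub>C 1)"
proof -
  define S where "S = T - \<mu> *\<^sub>C 1"
  let ?R = "\<lambda>n. range (app (S ^ n))"
  let ?a = "\<lambda>n. alpha_on (?R n) S" and ?b = "\<lambda>n. beta_on (?R n) S"
  obtain n0 where n0: "semi_B_fredholm_at n0 S" "?a n0 \<le> ?b n0"
    using SBF unfolding notin_sigma_SBF_iff S_def by blast
  obtain n where n: "n \<ge> n0" "\<And>k. k \<ge> n0 \<Longrightarrow> ?a n \<le> ?a k"
  proof -
    define m where "m = (LEAST m. \<exists>k\<ge>n0. ?a k = m)"
    have "\<exists>k\<ge>n0. ?a k = m" unfolding m_def by (rule LeastI[of _ "?a n0"]) auto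
    moreover have "m \<le> ?a k" if "k \<ge> n0" for k unfolding m_def using that by (intro Least_le) auto
    ultimately show thesis using that by metis
  qed
  have sB: "semi_B_fredholm_at n S" by (rule semi_B_fredholm_at_mono[OF n0(1) n(1)])
  then have cl: "closed (?R n)" "closed (?R (Suc n))" and fin: "?a n < \<infinity>"
    by (auto simp: semi_B_fredholm_at_iff)
  have "?a n0 < \<infinity>" using n0(1) by (simp add: semi_B_fredholm_at_iff)
  then have le: "?a n \<le> ?b n" using alpha_le_beta_range_iff[OF _ n(1)] n0(2) by blast
  have sub: "null_space S \<inter> ?R n \<subseteq> ?R k" for k
  proof (cases "k \<le> n")
    case True then show ?thesis using range_power_antimono[of k n S] by blast
  next
    case False
    then have kn: "n \<le> k" by simp
    have "?R k \<inter> null_space S = ?R n \<inter> null_space S"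
    proof (rule cdim_eq_subspace)
      show "?R k \<inter> null_space S \<subseteq> ?R n \<inter> null_space S" using range_power_antimono[OF kn, of S] by blast
      show "cdim (?R k \<inter> null_space S) = cdim (?R n \<inter> null_space S)"
        using alpha_range_antimono[OF kn, of S] n(2)[of k] n(1) kn by (simp add: alpha_on_def)
      show "cdim (?R n \<inter> null_space S) < \<infinity>" using fin by (simp add: alpha_on_def)
    qed (intro csubspace_M_null csubspace_range)+
    then show ?thesis by blast
  qed
  have "null_space S \<inter> ?R n = {0}"
  proof (rule ccontr)
    assume ne: "\<not> ?thesis"
    have "0 \<in> null_space S \<inter> ?R n"
      using complex_vector.subspace_0[OF csubspace_range] by (auto simp: null_space_def)
    then obtain x0 where x0: "x0 \<in> null_space S \<inter> ?R n" "x0 \<noteq> 0" using ne by blast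
    obtain \<delta>1 where \<delta>1: "\<delta>1 > 0" "\<And>\<nu>. cmod \<nu> < \<delta>1 \<Longrightarrow> \<exists>x. x \<noteq> 0 \<and> app (S - \<nu> *\<^sub>C 1) x = 0"
      by (rule null_vector_perturbation[OF cl sub x0]) (rule that)
    have cl': "closed (app S ` ?R n)" unfolding range_power_Suc by (rule cl(2))
    obtain \<delta>2 where \<delta>2: "\<delta>2 > 0" "\<And>\<nu>. cmod \<nu> < \<delta>2 \<Longrightarrow> closed (app (S - \<nu> *\<^sub>C 1) ` ?R n)"
      "\<And>\<nu>. cmod \<nu> < \<delta>2 \<Longrightarrow> alpha_on (?R n) (S - \<nu> *\<^sub>C 1) \<le> ?a n"
      "\<And>\<nu>. cmod \<nu> < \<delta>2 \<Longrightarrow> alpha_on (?R n) (S - \<nu> *\<^sub>C 1) \<le> beta_on (?R n) (S - \<nu> *\<^sub>C 1)"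
      by (rule index_nonpos_perturbation[OF csubspace_range cl(1) range_power_invariant cl' fin le]) (rule that)
    define \<delta> where "\<delta> = min \<delta>1 \<delta>2"
    have \<delta>: "\<delta> > 0" using \<delta>1(1) \<delta>2(1) by (simp add: \<delta>_def)
    have Pi: "\<mu> + \<nu> \<in> Pi_a0 T" if \<nu>: "\<nu> \<noteq> 0" "cmod \<nu> < \<delta>" for \<nu>
    proof -
      define U where "U = T - (\<mu> + \<nu>) *\<^sub>C 1"
      have U: "U = S - \<nu> *\<^sub>C 1" by (simp add: U_def S_def shift_shift)
      have lt: "cmod \<nu> < \<delta>1" "cmod \<nu> < \<delta>2" using \<nu>(2) by (auto simp: \<delta>_def)
      have aU: "alpha U = alpha_on (?R n) U" unfolding U by (rule alpha_shift[OF \<nu>(1)])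
      have clU: "closed (range (app U))"
        unfolding U by (rule closed_range_shift[OF \<nu>(1) \<delta>2(2)[OF lt(2)]])
      have finU: "alpha U < \<infinity>" using \<delta>2(3)[OF lt(2)] fin unfolding aU unfolding U by (rule le_less_trans)
      have "alpha U \<le> beta_on UNIV U"
        using \<delta>2(4)[OF lt(2)] beta_shift_ge[OF \<nu>(1), of S n] unfolding aU unfolding U by (rule order_trans)
      then have "\<not> 0 < index U" using not_index_pos_iff[OF finU] by blast
      moreover have "upper_semi_fredholm U"
        using clU finU by (simp add: upper_semi_fredholm_on_def closedin_closed_eq)
      ultimately have "\<mu> + \<nu> \<notin> sigma_aw T" by (simp add: sigma_aw_def U_def)
      moreover have "null_space U \<noteq> {0}" using \<delta>1(2)[OF lt(1)] unfolding U null_space_def by blast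
      then have "\<mu> + \<nu> \<in> sigma_a T" by (simp add: sigma_a_def bounded_below_def U_def)
      ultimately show ?thesis using aB unfolding a_Browder_def by blast
    qed
    let ?\<nu> = "complex_of_real (\<delta> / 2)"
    have "\<mu> + ?\<nu> \<in> Pi_a T" using Pi[of ?\<nu>] \<delta> by (simp add: Pi_a0_def)
    then obtain e where e: "e > 0" "\<And>y. y \<in> sigma_a T \<Longrightarrow> dist (\<mu> + ?\<nu>) y < e \<Longrightarrow> y = \<mu> + ?\<nu>"
      unfolding Pi_a_def isolated_in_dist_Ex_iff by blast
    define t where "t = min e \<delta> / 4"
    have t: "0 < t" "t < e" "\<delta> / 2 + t < \<delta>" using e(1) \<delta> by (auto simp: t_def min_def)
    let ?\<nu>' = "complex_of_real (\<delta> / 2 + t)"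
    have "cmod ?\<nu>' < \<delta>" using t \<delta> unfolding norm_of_real by simp
    moreover have "?\<nu>' \<noteq> 0" using t(1) \<delta> unfolding of_real_eq_0_iff by simp
    ultimately have "\<mu> + ?\<nu>' \<in> sigma_a T" using Pi[of ?\<nu>'] by (auto simp: Pi_a0_def Pi_a_eq)
    moreover have "dist (\<mu> + ?\<nu>) (\<mu> + ?\<nu>') < e"
    proof -
      have "dist (\<mu> + ?\<nu>) (\<mu> + ?\<nu>') = cmod (complex_of_real t)"
        unfolding dist_norm by (metis add_diff_cancel_left add_diff_cancel_left' norm_minus_commute of_real_add)
      then show ?thesis using t by simp
    qed
    ultimately have "?\<nu>' = ?\<nu>" using e(2) by (metis add_left_cancel)
    then have "\<delta> / 2 + t = \<delta> / 2" unfolding of_real_eq_iff .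
    then show False using t(1) by simp
  qed
  then show ?thesis using cl unfolding left_drazin_def S_def by blast
qed

text \<open>\<open>\<sigma>\<^bsub>SBF\<^esub>(T) \<subseteq> \<sigma>\<^sub>a(T) - \<Pi>\<^sup>a(T)\<close> holds for every \<open>T\<close>, so the equation says that each point of \<open>\<sigma>\<^sub>a(T)\<close>
  outside \<open>\<sigma>\<^bsub>SBF\<^esub>(T)\<close> is in \<open>\<Pi>\<^sup>a(T)\<close>. Its restriction to points of finite nullity is \<open>a\<close>-Browder's theorem.\<close>

theorem a_Browder_iff:
  fixes T :: "'a::complex_banach bop"
  shows "a_Browder T \<longleftrightarrow> sigma_SBF T = sigma_a T - Pi_a T"
proof -
  have sub: "sigma_SBF T \<subseteq> sigma_a T - Pi_a T"
    using left_drazin_imp_notin_sigma_SBF[of T] notin_sigma_a_imp_left_drazin[of _ T]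
    unfolding Pi_a_eq by blast
  show ?thesis
  proof
    assume "a_Browder T"
    then have "sigma_a T - Pi_a T \<subseteq> sigma_SBF T"
      using a_Browder_imp_left_drazin[of T] unfolding Pi_a_eq by blast
    then show "sigma_SBF T = sigma_a T - Pi_a T" using sub by blast
  next
    assume eq: "sigma_SBF T = sigma_a T - Pi_a T"
    have "\<mu> \<in> sigma_aw T \<longleftrightarrow> \<mu> \<notin> Pi_a0 T" if \<mu>: "\<mu> \<in> sigma_a T" for \<mu>
    proof
      assume "\<mu> \<in> sigma_aw T"
      then show "\<mu> \<notin> Pi_a0 T"
        using left_drazin_imp_semi_weyl[of "T - \<mu> *\<^sub>C 1"] unfolding sigma_aw_def Pi_a0_def Pi_a_eq by blast
    next
      assume n: "\<mu> \<notin> Pi_a0 T"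
      show "\<mu> \<in> sigma_aw T"
      proof (rule ccontr)
        assume "\<mu> \<notin> sigma_aw T"
        then have w: "upper_semi_fredholm (T - \<mu> *\<^sub>C 1)" "\<not> 0 < index (T - \<mu> *\<^sub>C 1)"
          using \<mu> by (auto simp: sigma_aw_def)
        then have "\<mu> \<in> Pi_a T" using notin_sigma_aw_imp_notin_sigma_SBF[OF w] eq \<mu> by blast
        then show False using n w(1) by (simp add: Pi_a0_def upper_semi_fredholm_on_def)
      qed
    qed
    moreover have "sigma_aw T \<subseteq> sigma_a T" by (auto simp: sigma_aw_def)
    ultimately show "a_Browder T" unfolding a_Browder_def by blast
  qed
qed

section \<open>Multiplication operators\<close>

lemma left_mult_shift: "left_mult A - \<mu> *\<^sub>C 1 = left_mult (A - \<mu> *\<^sub>C 1)"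
  by (rule bop_eqI) (simp add: app_shift app_left_mult left_diff_distrib scaleC_mult_bop)

lemma right_mult_shift: "right_mult A - \<mu> *\<^sub>C 1 = right_mult (A - \<mu> *\<^sub>C 1)"
  by (rule bop_eqI) (simp add: app_shift app_right_mult right_diff_distrib scaleC_mult_bop)

lemma app_left_mult_power: "app (left_mult A ^ n) T = A ^ n * T"
proof (induction n arbitrary: T)
  case (Suc n)
  show ?case unfolding app_power_Suc Suc app_left_mult by (simp add: mult.assoc)
qed simp

lemma app_right_mult_power: "app (right_mult A ^ n) T = T * A ^ n"
proof (induction n arbitrary: T)
  case (Suc n)
  show ?case unfolding app_power_Suc Suc app_right_mult by (simp only: mult.assoc power_Suc2)
qed simp

lemma ex_independent_family:
  assumes "cdim (UNIV :: 'a::complex_normed_vector set) = \<infinity>"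
  obtains E :: "'a::complex_normed_vector set"
    where "finite E" "card E = n" "complex_vector.independent E"
  using le_cdim_iff[OF complex_vector.subspace_UNIV, of n] assms by auto

text \<open>The members \<open>h e\<close> are indexed by \<open>e \<in> E\<close>, so their distinctness is part of the independence of the
  coefficients.\<close>

lemma cdim_infinite_if_families:
  assumes U: "csubspace U"
    and fam: "\<And>n. \<exists>(E :: 'i set) h. finite E \<and> card E = n \<and> (\<forall>e\<in>E. h e \<in> U) \<and>
      (\<forall>c. (\<Sum>e\<in>E. c e *\<^sub>C h e) = 0 \<longrightarrow> (\<forall>e\<in>E. c e = 0))"
  shows "cdim U = \<infinity>"
proof (rule ccontr)
  assume "cdim U \<noteq> \<infinity>"
  then have "cdim U < \<infinity>" by simp
  then obtain B where B: "finite B" "U = cspan B" using finite_cdim_basis[OF U] by metis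
  obtain E :: "'i set" and h where E: "finite E" "card E = Suc (card B)" "\<forall>e\<in>E. h e \<in> U"
      and ind: "\<forall>c. (\<Sum>e\<in>E. c e *\<^sub>C h e) = 0 \<longrightarrow> (\<forall>e\<in>E. c e = 0)"
    using fam[of "Suc (card B)"] by blast
  have inj: "inj_on h E"
  proof (rule inj_onI, rule ccontr)
    fix a b assume ab: "a \<in> E" "b \<in> E" "h a = h b" "a \<noteq> b"
    let ?c = "\<lambda>e. if e = a then 1 else if e = b then - 1 else (0::complex)"
    have "(\<Sum>e\<in>E. ?c e *\<^sub>C h e) = (\<Sum>e\<in>{a, b}. ?c e *\<^sub>C h e)"
      using ab E(1) by (intro sum.mono_neutral_right) auto
    also have "\<dots> = 0" using ab by (simp add: scaleC_one)
    finally have "\<forall>e\<in>E. ?c e = 0" by (rule ind[rule_format, THEN ballI])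
    then show False using ab(1) by force
  qed
  have "indep_mod {0} (h ` E)"
  proof -
    have "\<forall>b\<in>h ` E. c b = 0" if "(\<Sum>b\<in>h ` E. c b *\<^sub>C b) = 0" for c
      using spec[OF ind, of "c \<circ> h"] that inj by (simp add: sum.reindex)
    then show ?thesis using indep_mod_iff_sum[of "{0}" "h ` E"] E(1) by (simp add: complex_vector.subspace_def)
  qed
  then have "complex_vector.independent (h ` E)"
    unfolding indep_mod_empty[symmetric] by (rule indep_mod_antimono) simp
  moreover have "h ` E \<subseteq> cspan B" using E(3) B(2) by auto
  ultimately have "card (h ` E) \<le> card B" using complex_vector.independent_span_bound[OF B(1), of "h ` E"] by simp
  then show False using E(2) card_image[OF inj] by simp
qed

text \<open>A nonzero \<open>T\<close> in a right ideal \<open>U\<close> brings along all operators \<open>x \<mapsto> f x y\<close> with a fixed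
  nonzero vector \<open>y = T z\<close> and an arbitrary functional \<open>f\<close>.\<close>

lemma cdim_right_ideal:
  fixes U :: "'a::complex_banach bop set"
  assumes inf: "cdim (UNIV :: 'a set) = \<infinity>" and U: "csubspace U" "\<And>T S. T \<in> U \<Longrightarrow> T * S \<in> U"
    and T: "T \<in> U" "T \<noteq> 0"
  shows "cdim U = \<infinity>"
proof (rule cdim_infinite_if_families[OF U(1), where 'i = 'a])
  fix n
  obtain z where z: "app T z \<noteq> 0" using T(2) bop_eqI[of T 0] by (auto simp: app_zero_left)
  obtain E :: "'a set" where E: "finite E" "card E = n" "complex_vector.independent E"
    using ex_independent_family[OF inf] by blast
  obtain f where f: "\<And>e. e \<in> E \<Longrightarrow> cfunctional (f e)" "\<And>e. e \<in> E \<Longrightarrow> f e e = 1"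
      "\<And>e d. e \<in> E \<Longrightarrow> d \<in> E \<Longrightarrow> d \<noteq> e \<Longrightarrow> f e d = 0"
    using ex_biorthogonal[OF E(1,3)] by metis
  define h where "h e = T * rank_one z (f e)" for e
  have "c e = 0" if c: "(\<Sum>e\<in>E. c e *\<^sub>C h e) = 0" and e: "e \<in> E" for c e
  proof -
    have "0 = app (\<Sum>d\<in>E. c d *\<^sub>C h d) e" unfolding c by (simp add: app_zero_left)
    also have "\<dots> = (\<Sum>d\<in>E. c d *\<^sub>C (f d e *\<^sub>C app T z))"
      unfolding app_sum_left h_def by (rule sum.cong) (simp_all add: app_scaleC app_times app_rank_one f(1))
    also have "\<dots> = (\<Sum>d\<in>E. if d = e then c d *\<^sub>C app T z else 0)"
      by (rule sum.cong) (use f(2,3) e in \<open>auto simp: scaleC_one\<close>)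
    also have "\<dots> = c e *\<^sub>C app T z" using E(1) e by simp
    finally show ?thesis using z by simp
  qed
  then show "\<exists>(E :: 'a set) h. finite E \<and> card E = n \<and> (\<forall>e\<in>E. h e \<in> U) \<and>
      (\<forall>c. (\<Sum>e\<in>E. c e *\<^sub>C h e) = 0 \<longrightarrow> (\<forall>e\<in>E. c e = 0))"
    using E(1,2) U(2)[OF T(1)] by (intro exI[of _ E] exI[of _ h]) (auto simp: h_def)
qed

text \<open>A nonzero \<open>T\<close> in a left ideal \<open>U\<close> brings along the operators \<open>x \<mapsto> f (T x) e\<close> for a fixed functional
  with \<open>f (T z) = 1\<close> and arbitrary vectors \<open>e\<close>; they are told apart by their values at \<open>z\<close>.\<close>

lemma cdim_left_ideal:
  fixes U :: "'a::complex_banach bop set"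
  assumes inf: "cdim (UNIV :: 'a set) = \<infinity>" and U: "csubspace U" "\<And>T S. T \<in> U \<Longrightarrow> S * T \<in> U"
    and T: "T \<in> U" "T \<noteq> 0"
  shows "cdim U = \<infinity>"
proof (rule cdim_infinite_if_families[OF U(1), where 'i = 'a])
  fix n
  obtain z where z: "app T z \<noteq> 0" using T(2) bop_eqI[of T 0] by (auto simp: app_zero_left)
  obtain f where f: "cfunctional f" "f (app T z) = 1"
    using ex_separating_functional[of "{0}" "app T z"] z by (auto simp: complex_vector.subspace_def)
  obtain E :: "'a set" where E: "finite E" "card E = n" "complex_vector.independent E"
    using ex_independent_family[OF inf] by blast
  define h where "h e = rank_one e f * T" for e
  have "c e = 0" if c: "(\<Sum>e\<in>E. c e *\<^sub>C h e) = 0" and e: "e \<in> E" for c e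
  proof -
    have "0 = app (\<Sum>d\<in>E. c d *\<^sub>C h d) z" unfolding c by (simp add: app_zero_left)
    also have "\<dots> = (\<Sum>d\<in>E. c d *\<^sub>C d)"
      unfolding app_sum_left h_def
      by (rule sum.cong) (simp_all add: app_scaleC app_times app_rank_one f scaleC_one)
    finally show ?thesis using complex_vector.independentD[OF E(3,1) order_refl _ e] by simp
  qed
  then show "\<exists>(E :: 'a set) h. finite E \<and> card E = n \<and> (\<forall>e\<in>E. h e \<in> U) \<and>
      (\<forall>c. (\<Sum>e\<in>E. c e *\<^sub>C h e) = 0 \<longrightarrow> (\<forall>e\<in>E. c e = 0))"
    using E(1,2) U(2)[OF T(1)] by (intro exI[of _ E] exI[of _ h]) (auto simp: h_def)
qed

text \<open>Under the dichotomy a finite-dimensional space \<open>N(\<Phi> - \<mu>) \<inter> R((\<Phi> - \<mu>)^n)\<close> is zero, so that an upper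
  semi B-Fredholm operator \<open>\<Phi> - \<mu>\<close> is left Drazin invertible.\<close>

lemma sigma_SBF_if_dichotomy:
  fixes \<Phi> :: "'b::complex_banach bop"
  assumes dich: "\<And>\<mu> n x. x \<in> range (app ((\<Phi> - \<mu> *\<^sub>C 1) ^ n)) \<inter> null_space (\<Phi> - \<mu> *\<^sub>C 1) \<Longrightarrow> x \<noteq> 0 \<Longrightarrow>
      cdim (range (app ((\<Phi> - \<mu> *\<^sub>C 1) ^ n)) \<inter> null_space (\<Phi> - \<mu> *\<^sub>C 1)) = \<infinity>"
  shows "sigma_SBF \<Phi> = {\<mu>. \<not> left_drazin (\<Phi> - \<mu> *\<^sub>C 1)}" and "sigma_SBF \<Phi> = sigma_a \<Phi> - Pi_a \<Phi>"
    and "a_Browder \<Phi>"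
proof -
  have "left_drazin (\<Phi> - \<mu> *\<^sub>C 1)" if \<mu>: "\<mu> \<notin> sigma_SBF \<Phi>" for \<mu>
  proof -
    let ?S = "\<Phi> - \<mu> *\<^sub>C 1"
    obtain n where n: "semi_B_fredholm_at n ?S" using \<mu> unfolding notin_sigma_SBF_iff by blast
    then have fin: "cdim (range (app (?S ^ n)) \<inter> null_space ?S) \<noteq> \<infinity>"
      by (simp add: semi_B_fredholm_at_iff alpha_on_def)
    have "x = 0" if "x \<in> range (app (?S ^ n)) \<inter> null_space ?S" for x
      using dich[OF that] fin by (rule contrapos_np[rotated])
    moreover have "0 \<in> range (app (?S ^ n)) \<inter> null_space ?S"
      using complex_vector.subspace_0[OF csubspace_M_null[OF csubspace_range]] .
    ultimately have "null_space ?S \<inter> range (app (?S ^ n)) = {0}" by blast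
    then show ?thesis using n unfolding semi_B_fredholm_at_iff left_drazin_def by blast
  qed
  then show eq: "sigma_SBF \<Phi> = {\<mu>. \<not> left_drazin (\<Phi> - \<mu> *\<^sub>C 1)}"
    using left_drazin_imp_notin_sigma_SBF[of \<Phi>] by blast
  show eq': "sigma_SBF \<Phi> = sigma_a \<Phi> - Pi_a \<Phi>"
    unfolding eq Pi_a_eq using notin_sigma_a_imp_left_drazin[of _ \<Phi>] by blast
  show "a_Browder \<Phi>" unfolding a_Browder_iff by (rule eq')
qed

lemma left_mult_dichotomy:
  fixes A :: "'a::complex_banach bop"
  assumes inf: "cdim (UNIV :: 'a set) = \<infinity>"
    and T: "T \<in> range (app ((left_mult A - \<mu> *\<^sub>C 1) ^ n)) \<inter> null_space (left_mult A - \<mu> *\<^sub>C 1)" "T \<noteq> 0"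
  shows "cdim (range (app ((left_mult A - \<mu> *\<^sub>C 1) ^ n)) \<inter> null_space (left_mult A - \<mu> *\<^sub>C 1)) = \<infinity>"
proof (rule cdim_right_ideal[OF inf _ _ T])
  fix T S assume "T \<in> range (app ((left_mult A - \<mu> *\<^sub>C 1) ^ n)) \<inter> null_space (left_mult A - \<mu> *\<^sub>C 1)"
  then obtain V where V: "T = (A - \<mu> *\<^sub>C 1) ^ n * V" "(A - \<mu> *\<^sub>C 1) * T = 0"
    unfolding left_mult_shift by (auto simp: app_left_mult_power null_space_def app_left_mult)
  have "T * S = (A - \<mu> *\<^sub>C 1) ^ n * (V * S)" using V(1) by (simp add: mult.assoc)
  moreover have "(A - \<mu> *\<^sub>C 1) * (T * S) = 0" unfolding mult.assoc[symmetric] V(2) by simp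
  ultimately show "T * S \<in> range (app ((left_mult A - \<mu> *\<^sub>C 1) ^ n)) \<inter> null_space (left_mult A - \<mu> *\<^sub>C 1)"
    unfolding left_mult_shift null_space_def by (auto simp: app_left_mult_power app_left_mult)
qed (intro csubspace_M_null csubspace_range)

lemma right_mult_dichotomy:
  fixes A :: "'a::complex_banach bop"
  assumes inf: "cdim (UNIV :: 'a set) = \<infinity>"
    and T: "T \<in> range (app ((right_mult A - \<mu> *\<^sub>C 1) ^ n)) \<inter> null_space (right_mult A - \<mu> *\<^sub>C 1)" "T \<noteq> 0"
  shows "cdim (range (app ((right_mult A - \<mu> *\<^sub>C 1) ^ n)) \<inter> null_space (right_mult A - \<mu> *\<^sub>C 1)) = \<infinity>"
proof (rule cdim_left_ideal[OF inf _ _ T])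
  fix T S assume "T \<in> range (app ((right_mult A - \<mu> *\<^sub>C 1) ^ n)) \<inter> null_space (right_mult A - \<mu> *\<^sub>C 1)"
  then obtain V where V: "T = V * (A - \<mu> *\<^sub>C 1) ^ n" "T * (A - \<mu> *\<^sub>C 1) = 0"
    unfolding right_mult_shift by (auto simp: app_right_mult_power null_space_def app_right_mult)
  have "S * T = (S * V) * (A - \<mu> *\<^sub>C 1) ^ n" using V(1) by (simp add: mult.assoc)
  moreover have "(S * T) * (A - \<mu> *\<^sub>C 1) = 0" unfolding mult.assoc V(2) by simp
  ultimately show "S * T \<in> range (app ((right_mult A - \<mu> *\<^sub>C 1) ^ n)) \<inter> null_space (right_mult A - \<mu> *\<^sub>C 1)"
    unfolding right_mult_shift null_space_def by (auto simp: app_right_mult_power app_right_mult)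
qed (intro csubspace_M_null csubspace_range)

lemma bounded_below_iff_estimate:
  fixes T :: "'a::complex_banach bop"
  shows "bounded_below T \<longleftrightarrow> (\<exists>c>0. \<forall>x. c * norm x \<le> norm (app T x))"
proof
  assume "bounded_below T"
  then obtain c where "c > 0" "\<And>x. x \<in> UNIV \<Longrightarrow> c * norm x \<le> norm (app T x)"
    using bounded_below_estimate[OF complex_vector.subspace_UNIV closed_UNIV, of T]
    unfolding bounded_below_def by auto
  then show "\<exists>c>0. \<forall>x. c * norm x \<le> norm (app T x)" by blast
next
  assume "\<exists>c>0. \<forall>x. c * norm x \<le> norm (app T x)"
  then obtain c where c: "c > 0" "\<And>x. c * norm x \<le> norm (app T x)" by blast
  have "x = 0" if "app T x = 0" for x
    using c(2)[of x] c(1) that by (simp add: mult_le_0_iff)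
  then show "bounded_below T"
    unfolding bounded_below_def null_space_def
    using closed_image_estimate[OF c(1) complex_vector.subspace_UNIV closed_UNIV, of T] c(2) by auto
qed

lemma ex_functional:
  assumes "cdim (UNIV :: 'a::complex_banach set) = \<infinity>"
  obtains f :: "'a::complex_banach \<Rightarrow> complex" and u where "cfunctional f" "f u = 1"
proof -
  have "(UNIV :: 'a set) \<noteq> {0}" using assms cdim_singleton_zero[where 'a = 'a] by force
  then obtain u :: 'a where u: "u \<notin> {0}" by blast
  have "csubspace {0 :: 'a}" by (simp add: complex_vector.subspace_def)
  from ex_separating_functional[OF this _ u] obtain f where "cfunctional f" "f u = 1" by auto
  then show thesis by (rule that)
qed

lemma norm_rank_one_le:
  assumes "cfunctional f" "\<And>x. cmod (f x) \<le> K * norm x" "K \<ge> 0"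
  shows "norm (rank_one y f) \<le> K * norm y"
proof (rule norm_bop_le)
  show "norm (app (rank_one y f) x) \<le> K * norm y * norm x" for x
    using mult_right_mono[OF assms(2)[of x] norm_ge_zero[of y]]
    by (simp add: app_rank_one assms(1) norm_scaleC mult_ac)
qed (use assms(3) in simp)

lemma rank_one_diff: "cfunctional f \<Longrightarrow> rank_one x f - rank_one y f = rank_one (x - y) f"
  by (rule bop_eqI) (simp add: app_diff app_rank_one complex_vector.scale_right_diff_distrib)

text \<open>A lower bound for \<open>B\<close> applies to each vector \<open>T x\<close>. Conversely, left multiplication by \<open>B\<close> acts on
  the operators \<open>f \<otimes> x\<close> with fixed \<open>f\<close> as \<open>B\<close> acts on \<open>x\<close>.\<close>

lemma sigma_a_left_mult:
  fixes A :: "'a::complex_banach bop"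
  assumes inf: "cdim (UNIV :: 'a set) = \<infinity>"
  shows "sigma_a (left_mult A) = sigma_a A"
proof -
  have "bounded_below (left_mult B) \<longleftrightarrow> bounded_below B" for B :: "'a bop"
    unfolding bounded_below_iff_estimate app_left_mult
  proof
    assume "\<exists>c>0. \<forall>T. c * norm T \<le> norm (B * T)"
    then obtain c where c: "c > 0" "\<And>T. c * norm T \<le> norm (B * T)" by blast
    obtain f :: "'a \<Rightarrow> complex" and u where f: "cfunctional f" "f u = 1" using ex_functional[OF inf] by blast
    then obtain K where K: "K > 0" "\<And>x. cmod (f x) \<le> norm x * K"
      using bounded_linear.pos_bounded[of f] by (auto simp: cfunctional_def)
    have u: "norm u > 0" using f(2) K(2)[of u] by (cases "u = 0") auto
    have "c / (norm u * K) * norm x \<le> norm (app B x)" for x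
    proof -
      have "norm x = norm (app (rank_one x f) u)" by (simp add: app_rank_one f scaleC_one)
      also have "\<dots> \<le> norm (rank_one x f) * norm u" by (rule norm_app)
      finally have "c * norm x \<le> c * (norm (rank_one x f) * norm u)" using c(1) by (intro mult_left_mono) auto
      also have "\<dots> = (c * norm (rank_one x f)) * norm u" by simp
      also have "\<dots> \<le> norm (rank_one (app B x) f) * norm u"
        using c(2)[of "rank_one x f"] by (intro mult_right_mono) (auto simp: bop_mult_rank_one f(1))
      also have "\<dots> \<le> (K * norm (app B x)) * norm u"
        using K f(1) by (intro mult_right_mono norm_rank_one_le) (auto simp: mult.commute)
      finally show ?thesis using u K(1) by (simp add: field_simps)
    qed
    moreover have "c / (norm u * K) > 0" using c(1) u K(1) by simp
    ultimately show "\<exists>c>0. \<forall>x. c * norm x \<le> norm (app B x)" by blast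
  next
    assume "\<exists>c>0. \<forall>x. c * norm x \<le> norm (app B x)"
    then obtain c where c: "c > 0" "\<And>x. c * norm x \<le> norm (app B x)" by blast
    have "c * norm T \<le> norm (B * T)" for T
    proof -
      have "norm T \<le> norm (B * T) / c"
      proof (rule norm_bop_le)
        fix x
        have "c * norm (app T x) \<le> norm (app B (app T x))" by (rule c(2))
        also have "\<dots> \<le> norm (B * T) * norm x" using norm_app[of "B * T" x] by (simp add: app_times)
        finally show "norm (app T x) \<le> norm (B * T) / c * norm x" using c(1) by (simp add: field_simps)
      qed (use c(1) in simp)
      then show ?thesis using c(1) by (simp add: field_simps)
    qed
    then show "\<exists>c>0. \<forall>T. c * norm T \<le> norm (B * T)" using c(1) by blast
  qed
  then show ?thesis by (simp add: sigma_a_def left_mult_shift)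
qed

text \<open>The map \<open>y \<mapsto> f \<otimes> y\<close> is continuous and sends \<open>R(B)\<close> into the range of left multiplication; evaluation
  at \<open>u\<close> with \<open>f u = 1\<close> recovers a preimage of \<open>y\<close>.\<close>

lemma closed_range_if_left_mult:
  fixes B :: "'a::complex_banach bop"
  assumes inf: "cdim (UNIV :: 'a set) = \<infinity>" and cl: "closed (range ((*) B))"
  shows "closed (range (app B))"
proof -
  obtain f :: "'a \<Rightarrow> complex" and u where f: "cfunctional f" "f u = 1" using ex_functional[OF inf] by blast
  then obtain K where K: "K > 0" "\<And>x. cmod (f x) \<le> norm x * K"
    using bounded_linear.pos_bounded[of f] by (auto simp: cfunctional_def)
  have "y \<in> range (app B)" if v: "\<forall>n. v n \<in> range (app B)" and lim: "v \<longlonglongrightarrow> y" for v y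
  proof -
    have "rank_one (v n) f \<in> range ((*) B)" for n
    proof -
      obtain z where "v n = app B z" using v by blast
      then have "rank_one (v n) f = B * rank_one z f" by (simp add: bop_mult_rank_one f(1))
      then show ?thesis by (rule range_eqI)
    qed
    moreover have "(\<lambda>n. rank_one (v n) f) \<longlonglongrightarrow> rank_one y f"
    proof (rule LIM_zero_cancel, rule tendsto_norm_zero_cancel, rule tendsto_sandwich[OF _ _ tendsto_const])
      show "\<forall>\<^sub>F n in sequentially. norm (rank_one (v n) f - rank_one y f) \<le> K * norm (v n - y)"
        using K f(1) by (auto simp: rank_one_diff mult.commute intro!: always_eventually norm_rank_one_le)
      have "(\<lambda>n. K * norm (v n - y)) \<longlonglongrightarrow> K * norm (y - y)" by (intro tendsto_intros lim)
      then show "(\<lambda>n. K * norm (v n - y)) \<longlonglongrightarrow> 0" by simp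
    qed simp
    ultimately have "rank_one y f \<in> range ((*) B)" by (rule closed_sequentially[OF cl])
    then obtain T where "rank_one y f = B * T" by blast
    then have "app (rank_one y f) u = app B (app T u)" by (simp add: app_times)
    then have "y = app B (app T u)" by (simp add: app_rank_one f scaleC_one)
    then show ?thesis by (rule range_eqI)
  qed
  then show ?thesis unfolding closed_sequential_limits by blast
qed

lemma range_left_mult_power: "range (app (left_mult A ^ n)) = range ((*) (A ^ n))"
  by (auto simp: app_left_mult_power)

lemma left_drazin_if_left_mult:
  fixes B :: "'a::complex_banach bop"
  assumes inf: "cdim (UNIV :: 'a set) = \<infinity>" and ld: "left_drazin (left_mult B)"
  shows "left_drazin B"
proof -
  obtain n where n: "closed (range (app (left_mult B ^ n)))" "closed (range (app (left_mult B ^ Suc n)))"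
      "null_space (left_mult B) \<inter> range (app (left_mult B ^ n)) = {0}"
    using ld unfolding left_drazin_def by blast
  have cl: "closed (range (app (B ^ n)))" "closed (range (app (B ^ Suc n)))"
    using closed_range_if_left_mult[OF inf] n(1,2) unfolding range_left_mult_power by blast+
  obtain f :: "'a \<Rightarrow> complex" and u where f: "cfunctional f" "f u = 1" using ex_functional[OF inf] by blast
  have "app (B ^ n) x = 0" if "app B (app (B ^ n) x) = 0" for x
  proof -
    let ?T = "B ^ n * rank_one x f"
    have "B * ?T = 0"
      by (rule bop_eqI) (simp add: app_times app_rank_one f(1) that app_zero_left)
    then have "?T \<in> null_space (left_mult B) \<inter> range (app (left_mult B ^ n))"
      unfolding range_left_mult_power by (simp add: null_space_def app_left_mult)
    then have "?T = 0" using n(3) by blast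
    then have "app ?T u = 0" by (simp add: app_zero_left)
    then show ?thesis by (simp add: app_times app_rank_one f scaleC_one)
  qed
  moreover have "0 \<in> range (app (B ^ n))" by (rule complex_vector.subspace_0[OF csubspace_range])
  ultimately have "null_space B \<inter> range (app (B ^ n)) = {0}" by (auto simp: null_space_def)
  then show ?thesis using cl unfolding left_drazin_def by blast
qed

lemma Pi_a_left_mult_subset:
  fixes A :: "'a::complex_banach bop"
  assumes inf: "cdim (UNIV :: 'a set) = \<infinity>"
  shows "Pi_a (left_mult A) \<subseteq> Pi_a A"
  using left_drazin_if_left_mult[OF inf]
  unfolding Pi_a_eq sigma_a_left_mult[OF inf] left_mult_shift by blast

theorem a_Browder_left_right_mult:
  fixes A :: "'a::complex_banach bop"
  assumes inf: "cdim (UNIV :: 'a set) = \<infinity>"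
  shows "a_Browder (left_mult A)" "a_Browder (right_mult A)"
   by (rule sigma_SBF_if_dichotomy(3); rule left_mult_dichotomy[OF inf]; assumption)
    (rule sigma_SBF_if_dichotomy(3); rule right_mult_dichotomy[OF inf]; assumption)

text \<open>With \<open>\<Pi>\<^sup>a(L\<^sub>A) \<subseteq> \<Pi>\<^sup>a(A) \<subseteq> \<sigma>\<^sub>a(A)\<close> and \<open>\<sigma>\<^bsub>SBF\<^esub>(L\<^sub>A) = \<sigma>\<^sub>a(A) - \<Pi>\<^sup>a(L\<^sub>A)\<close>, equality of the two spectra
  forces \<open>\<Pi>\<^sup>a(A) \<subseteq> \<Pi>\<^sup>a(L\<^sub>A)\<close>, since \<open>\<Pi>\<^sup>a(A)\<close> is disjoint from \<open>\<sigma>\<^bsub>SBF\<^esub>(A)\<close>.\<close>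

theorem a_Browder_iff_sigma_SBF_left_mult:
  fixes A :: "'a::complex_banach bop"
  assumes inf: "cdim (UNIV :: 'a set) = \<infinity>"
  shows "a_Browder A \<and> Pi_a A = Pi_a (left_mult A) \<longleftrightarrow> sigma_SBF A = sigma_SBF (left_mult A)"
proof -
  have L: "sigma_SBF (left_mult A) = sigma_a A - Pi_a (left_mult A)"
    unfolding sigma_a_left_mult[OF inf, symmetric]
    by (rule sigma_SBF_if_dichotomy(2); rule left_mult_dichotomy[OF inf]; assumption)
  have sub: "Pi_a (left_mult A) \<subseteq> Pi_a A" "Pi_a A \<subseteq> sigma_a A"
    using Pi_a_left_mult_subset[OF inf] by (auto simp: Pi_a_eq)
  have "sigma_SBF A \<inter> Pi_a A = {}" using left_drazin_imp_notin_sigma_SBF[of A] unfolding Pi_a_eq by blast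
  then show ?thesis unfolding a_Browder_iff L using sub by blast
qed

section \<open>Hilbert spaces\<close>

context
  fixes ip :: "'a::complex_banach \<Rightarrow> 'a \<Rightarrow> complex"
  assumes hip: "hilbert_inner ip"
begin

lemma ip_add_left: "ip (x + y) z = ip x z + ip y z"
  and ip_scale_left: "ip (c *\<^sub>C x) y = c * ip x y"
  and ip_sym: "ip y x = cnj (ip x y)"
  and ip_self: "ip x x = complex_of_real ((norm x)\<^sup>2)"
  using hip unfolding hilbert_inner_def by blast+

lemma ip_add_right: "ip x (y + z) = ip x y + ip x z"
  by (metis complex_cnj_add ip_add_left ip_sym)

lemma ip_scale_right: "ip x (c *\<^sub>C y) = cnj c * ip x y"
  by (metis complex_cnj_mult ip_scale_left ip_sym)

lemma ip_zero_left [simp]: "ip 0 y = 0"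
  using ip_scale_left[of 0 0 y] by simp

lemma ip_zero_right [simp]: "ip x 0 = 0"
  using ip_sym[of 0 x] by simp

lemma ip_diff_left: "ip (x - y) z = ip x z - ip y z"
  using ip_add_left[of "x - y" y z] by simp

lemma ip_diff_right: "ip x (y - z) = ip x y - ip x z"
  using ip_add_right[of x "y - z" z] by simp

lemma ip_right_cancel: "(\<And>x. ip x y = ip x z) \<Longrightarrow> y = z"
  using ip_self[of "y - z"] by (simp add: ip_diff_right)

lemma norm_diff_scale_sq:
  "(norm (x - c *\<^sub>C y))\<^sup>2 = (norm x)\<^sup>2 - 2 * Re (cnj c * ip x y) + (cmod c)\<^sup>2 * (norm y)\<^sup>2"
proof -
  have "complex_of_real ((norm (x - c *\<^sub>C y))\<^sup>2) =
      ip x x - cnj c * ip x y - (c * cnj (ip x y) - c * cnj c * ip y y)"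
    unfolding ip_self[symmetric] ip_sym[of y x, symmetric]
    by (simp add: ip_diff_left ip_diff_right ip_scale_left ip_scale_right algebra_simps)
  also have "c * cnj (ip x y) = cnj (cnj c * ip x y)" by simp
  finally have "complex_of_real ((norm (x - c *\<^sub>C y))\<^sup>2) =
      ip x x - cnj c * ip x y - (cnj (cnj c * ip x y) - c * cnj c * ip y y)" .
  then have "(norm (x - c *\<^sub>C y))\<^sup>2 = Re (ip x x - cnj c * ip x y - (cnj (cnj c * ip x y) - c * cnj c * ip y y))"
    by (metis Re_complex_of_real)
  also have "c * cnj c = complex_of_real ((cmod c)\<^sup>2)" by (rule complex_norm_square[symmetric])
  also have "Re (ip x x - cnj c * ip x y - (cnj (cnj c * ip x y) - complex_of_real ((cmod c)\<^sup>2) * ip y y)) =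
      (norm x)\<^sup>2 - 2 * Re (cnj c * ip x y) + (cmod c)\<^sup>2 * (norm y)\<^sup>2"
    unfolding ip_self by (simp del: of_real_power)
  finally show ?thesis .
qed

text \<open>The component of \<open>x\<close> along \<open>y\<close> and the remainder are orthogonal, so Pythagoras applies.\<close>

lemma norm_diff_component_sq:
  assumes "y \<noteq> 0"
  shows "(norm (x - (ip x y / complex_of_real ((norm y)\<^sup>2)) *\<^sub>C y))\<^sup>2
    = (norm x)\<^sup>2 - (cmod (ip x y))\<^sup>2 / (norm y)\<^sup>2"
proof -
  define s where "s = (norm y)\<^sup>2"
  have s: "s > 0" using assms by (simp add: s_def)
  define c where "c = ip x y / complex_of_real s"
  have "cnj c * ip x y = (ip x y * cnj (ip x y)) / complex_of_real s" by (simp add: c_def)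
  also have "\<dots> = complex_of_real ((cmod (ip x y))\<^sup>2 / s)"
    using complex_norm_square[of "ip x y"] by simp
  finally have "Re (cnj c * ip x y) = (cmod (ip x y))\<^sup>2 / s" by (metis Re_complex_of_real)
  moreover have "(cmod c)\<^sup>2 * s = (cmod (ip x y))\<^sup>2 / s"
    using s by (simp add: c_def norm_divide power_divide power2_eq_square)
  ultimately show ?thesis
    using norm_diff_scale_sq[of x c y] unfolding s_def[symmetric] c_def[symmetric] by simp
qed

lemma ip_bound: "cmod (ip x y) \<le> norm x * norm y"
proof (cases "y = 0")
  case False
  have "0 \<le> (norm x)\<^sup>2 - (cmod (ip x y))\<^sup>2 / (norm y)\<^sup>2"
    unfolding norm_diff_component_sq[OF False, symmetric] by simp
  then have "(cmod (ip x y))\<^sup>2 \<le> (norm x * norm y)\<^sup>2"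
    using False by (simp add: power_mult_distrib field_simps)
  then show ?thesis by (rule power2_le_imp_le) simp
qed simp

lemma parallelogram:
  fixes x y :: 'a
  shows "(norm (x + y))\<^sup>2 + (norm (x - y))\<^sup>2 = 2 * (norm x)\<^sup>2 + 2 * (norm y)\<^sup>2"
proof -
  have "x + y = x - (- 1) *\<^sub>C y" "x - y = x - 1 *\<^sub>C y" by (simp_all add: scaleC_one)
  then show ?thesis using norm_diff_scale_sq[of x "- 1" y] norm_diff_scale_sq[of x 1 y] by simp
qed

text \<open>By the parallelogram law a sequence in \<open>N\<close> that minimises the distance to \<open>x\<close> is Cauchy.\<close>

lemma orthogonal_projection:
  fixes x :: 'a
  assumes N: "csubspace N" "closed N"
  obtains p where "p \<in> N" "\<And>m. m \<in> N \<Longrightarrow> ip (x - p) m = 0"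
proof -
  have N0: "N \<noteq> {}" using complex_vector.subspace_0[OF N(1)] by blast
  define d where "d = infdist x N"
  have d: "d \<ge> 0" "\<And>m. m \<in> N \<Longrightarrow> d \<le> norm (x - m)"
    using infdist_nonneg infdist_le unfolding d_def by (auto simp: dist_norm[symmetric])
  define r where "r k = 1 / real (Suc k)" for k
  have r: "r k > 0" for k by (simp add: r_def)
  have "\<exists>m\<in>N. norm (x - m) < d + r k" for k
    using infdist_approx[OF N0 r[of k], of x] unfolding d_def dist_norm by blast
  then obtain w where w: "\<And>k. w k \<in> N" "\<And>k. norm (x - w k) < d + r k" by metis
  have est: "(norm (w i - w j))\<^sup>2 \<le> 4 * (2 * d * r k + (r k)\<^sup>2)" if "k \<le> i" "k \<le> j" for i j k
  proof -
    have le: "(norm (x - w i))\<^sup>2 \<le> (d + r k)\<^sup>2" if "k \<le> i" for i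
    proof -
      have "r i \<le> r k" using that by (simp add: r_def frac_le)
      then have "norm (x - w i) \<le> d + r k" using w(2)[of i] by simp
      then show ?thesis by (rule power_mono) simp
    qed
    have mid: "(1/2 :: complex) *\<^sub>C (w i + w j) \<in> N"
      by (intro complex_vector.subspace_scale[OF N(1)] complex_vector.subspace_add[OF N(1)] w)
    have "(x - w i) + (x - w j) = 2 *\<^sub>C (x - (1/2 :: complex) *\<^sub>C (w i + w j))"
      by (simp add: complex_vector.scale_right_diff_distrib scaleC_scaleC scaleC_one
          scaleC_add_left[of 1 1 x, simplified])
    then have "norm ((x - w i) + (x - w j)) = 2 * norm (x - (1/2 :: complex) *\<^sub>C (w i + w j))"
      by (simp only: norm_scaleC) simp
    then have "2 * d \<le> norm ((x - w i) + (x - w j))" using d(2)[OF mid] by simp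
    then have "(2 * d)\<^sup>2 \<le> (norm ((x - w i) + (x - w j)))\<^sup>2" using d(1) by (intro power_mono) auto
    moreover have "(x - w i) - (x - w j) = w j - w i" by simp
    then have "(norm ((x - w i) + (x - w j)))\<^sup>2 + (norm (w j - w i))\<^sup>2
        = 2 * (norm (x - w i))\<^sup>2 + 2 * (norm (x - w j))\<^sup>2"
      using parallelogram[of "x - w i" "x - w j"] by (simp only:)
    ultimately have "(norm (w j - w i))\<^sup>2 \<le> 4 * (d + r k)\<^sup>2 - (2 * d)\<^sup>2"
      using le[OF that(1)] le[OF that(2)] by linarith
    then show ?thesis by (simp add: norm_minus_commute power2_eq_square algebra_simps)
  qed
  have r0: "r \<longlonglongrightarrow> 0" unfolding r_def by (rule LIMSEQ_Suc[OF lim_1_over_n])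
  have "(\<lambda>k. 4 * (2 * d * r k + (r k)\<^sup>2)) \<longlonglongrightarrow> 4 * (2 * d * 0 + 0\<^sup>2)" by (intro tendsto_intros r0)
  then have lim0: "(\<lambda>k. 4 * (2 * d * r k + (r k)\<^sup>2)) \<longlonglongrightarrow> 0" by simp
  have "Cauchy w"
  proof (rule CauchyI)
    fix e :: real assume e: "e > 0"
    then have "eventually (\<lambda>k. 4 * (2 * d * r k + (r k)\<^sup>2) < e\<^sup>2) sequentially"
      using order_tendstoD(2)[OF lim0, of "e\<^sup>2"] by simp
    then obtain k where k: "4 * (2 * d * r k + (r k)\<^sup>2) < e\<^sup>2" unfolding eventually_sequentially by blast
    have "norm (w i - w j) < e" if "k \<le> i" "k \<le> j" for i j
      using est[OF that] k e by (intro power_less_imp_less_base[of _ 2 e]) auto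
    then show "\<exists>M. \<forall>m\<ge>M. \<forall>n\<ge>M. norm (w m - w n) < e" by blast
  qed
  then obtain p where p: "w \<longlonglongrightarrow> p" using Cauchy_convergent convergent_def by blast
  have pN: "p \<in> N" by (rule closed_sequentially[OF N(2) w(1) p])
  have "norm (x - p) \<le> d"
  proof (rule tendsto_le[OF sequentially_bot])
    show "(\<lambda>k. norm (x - w k)) \<longlonglongrightarrow> norm (x - p)" by (intro tendsto_intros p)
    have "(\<lambda>k. d + r k) \<longlonglongrightarrow> d + 0" by (intro tendsto_intros r0)
    then show "(\<lambda>k. d + r k) \<longlonglongrightarrow> d" by simp
    show "\<forall>\<^sub>F k in sequentially. norm (x - w k) \<le> d + r k" using w(2) by (simp add: less_imp_le)
  qed
  have "ip (x - p) m = 0" if m: "m \<in> N" for m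
  proof (cases "m = 0")
    case False
    define c where "c = ip (x - p) m / complex_of_real ((norm m)\<^sup>2)"
    have "p + c *\<^sub>C m \<in> N"
      by (intro complex_vector.subspace_add[OF N(1)] complex_vector.subspace_scale[OF N(1)] pN m)
    then have "norm (x - p) \<le> norm (x - (p + c *\<^sub>C m))" using d(2) \<open>norm (x - p) \<le> d\<close> order_trans by blast
    also have "x - (p + c *\<^sub>C m) = (x - p) - c *\<^sub>C m" by simp
    finally have "(norm (x - p))\<^sup>2 \<le> (norm ((x - p) - c *\<^sub>C m))\<^sup>2" by (intro power_mono) auto
    then have "(cmod (ip (x - p) m))\<^sup>2 / (norm m)\<^sup>2 \<le> 0"
      unfolding c_def norm_diff_component_sq[OF False] by simp
    then show ?thesis using False by (simp add: divide_le_0_iff)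
  qed simp
  then show thesis using that pN by blast
qed

text \<open>A vector \<open>z\<close> orthogonal to the kernel of \<open>f\<close> represents \<open>f\<close> up to a scalar, as each \<open>x\<close> is a multiple
  of \<open>z\<close> modulo the kernel.\<close>

lemma riesz_representation:
  assumes f: "cfunctional f"
  obtains y where "\<And>x. f x = ip x y"
proof (cases "\<forall>x. f x = 0")
  case True
  then show ?thesis by (intro that[of 0]) simp
next
  case False
  then obtain u where u: "f u \<noteq> 0" by blast
  have blf: "bounded_linear f" and fs: "f (c *\<^sub>C x) = c * f x" for c x using f by (auto simp: cfunctional_def)
  have fa: "f (x + y) = f x + f y" and fd: "f (x - y) = f x - f y" and f0: "f 0 = 0" for x y
    using bounded_linear.linear[OF blf] by (auto simp: linear_add linear_diff linear_0)
  define N where "N = {x. f x = 0}"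
  have N: "csubspace N" by (auto simp: N_def complex_vector.subspace_def fa fs f0)
  have clN: "closed N"
    unfolding N_def by (rule closed_Collect_eq) (auto intro: linear_continuous_on[OF blf])
  obtain p where p: "p \<in> N" "\<And>m. m \<in> N \<Longrightarrow> ip (u - p) m = 0"
    using orthogonal_projection[OF N clN] by blast
  define z where "z = u - p"
  have fz: "f z \<noteq> 0" using u p(1) by (simp add: z_def fd N_def)
  then have z0: "z \<noteq> 0" using f0 by auto
  have "f x = ip x ((cnj (f z) / complex_of_real ((norm z)\<^sup>2)) *\<^sub>C z)" for x
  proof -
    have "x - (f x / f z) *\<^sub>C z \<in> N" using fz by (simp add: N_def fd fs)
    then have "ip (x - (f x / f z) *\<^sub>C z) z = 0" using p(2) ip_sym unfolding z_def by (metis complex_cnj_zero)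
    then have "ip x z = (f x / f z) * complex_of_real ((norm z)\<^sup>2)"
      by (simp add: ip_diff_left ip_scale_left ip_self)
    then show ?thesis using fz z0 by (simp add: ip_scale_right)
  qed
  then show ?thesis by (rule that)
qed

abbreviation adj :: "'a bop \<Rightarrow> 'a bop" where "adj \<equiv> hilbert_adjoint ip"

lemma adjI:
  assumes "\<And>x y. ip (app A x) y = ip x (app B y)" shows "adj A = B"
  unfolding hilbert_adjoint_def
proof (rule the_equality)
  show "\<forall>x y. ip (app A x) y = ip x (app B y)" using assms by blast
  fix C assume "\<forall>x y. ip (app A x) y = ip x (app C y)"
  then have "app C y = app B y" for y using assms by (intro ip_right_cancel) metis
  then show "C = B" by (rule bop_eqI)
qed

lemma ip_adj: "ip (app A x) y = ip x (app (adj A) y)"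
  and norm_adj_le: "norm (adj A) \<le> norm A"
proof -
  have "\<exists>g. \<forall>x. ip (app A x) y = ip x g" for y
  proof -
    have "cfunctional (\<lambda>x. ip (app A x) y)"
      unfolding cfunctional_def
    proof (intro conjI allI bounded_linear_intro[where K = "norm A * norm y"])
      fix x
      have "cmod (ip (app A x) y) \<le> norm (app A x) * norm y" by (rule ip_bound)
      also have "\<dots> \<le> (norm A * norm x) * norm y" by (intro mult_right_mono norm_app) simp
      finally show "norm (ip (app A x) y) \<le> norm x * (norm A * norm y)" by (simp add: mult_ac)
    qed (simp_all add: ip_add_left ip_scale_left scaleR_scaleC scaleR_conv_of_real)
    then show ?thesis by (rule riesz_representation) blast
  qed
  then obtain g where g: "\<And>x y. ip (app A x) y = ip x (g y)" by metis
  have g_add: "g (y + z) = g y + g z" for y z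
    by (rule ip_right_cancel) (simp add: ip_add_right flip: g)
  have g_scale: "g (c *\<^sub>C y) = c *\<^sub>C g y" for c y
    by (rule ip_right_cancel) (simp add: ip_scale_right flip: g)
  have g_bound: "norm (g y) \<le> norm y * norm A" for y
  proof -
    have "complex_of_real ((norm (g y))\<^sup>2) = ip (app A (g y)) y" by (simp add: g ip_self)
    then have "(norm (g y))\<^sup>2 = cmod (ip (app A (g y)) y)" by (metis norm_of_real abs_of_nonneg zero_le_power2)
    also have "\<dots> \<le> norm (app A (g y)) * norm y" by (rule ip_bound)
    also have "\<dots> \<le> (norm A * norm (g y)) * norm y" by (intro mult_right_mono norm_app) simp
    finally have "norm (g y) * norm (g y) \<le> norm (g y) * (norm y * norm A)" by (simp add: power2_eq_square mult_ac)
    then show ?thesis by (cases "norm (g y) = 0") (simp, simp add: mult_le_cancel_left)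
  qed
  have "bounded_linear g"
    by (rule bounded_linear_intro[OF g_add _ g_bound]) (simp add: scaleR_scaleC g_scale)
  then obtain B where B: "\<And>y. app B y = g y" using ex_bop g_scale by metis
  then have adj: "adj A = B" using adjI[of A B] g by simp
  then show "ip (app A x) y = ip x (app (adj A) y)" using B g by simp
  show "norm (adj A) \<le> norm A"
    unfolding adj by (rule norm_bop_le) (use B g_bound in \<open>simp_all add: mult.commute\<close>)
qed

lemma adj_adj: "adj (adj A) = A"
proof (rule adjI)
  show "ip (app (adj A) x) y = ip x (app A y)" for x y
    by (metis ip_adj ip_sym)
qed

lemma adj_mult: "adj (A * B) = adj B * adj A"
  by (rule adjI) (simp add: app_times ip_adj)

lemma adj_one: "adj 1 = 1"
  by (rule adjI) simp

lemma adj_add: "adj (A + B) = adj A + adj B"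
  by (rule adjI) (simp add: app_add_left ip_add_left ip_add_right ip_adj)

lemma adj_scale: "adj (c *\<^sub>C A) = cnj c *\<^sub>C adj A"
  by (rule adjI) (simp add: app_scaleC ip_scale_left ip_scale_right ip_adj)

lemma adj_shift: "adj (A - \<mu> *\<^sub>C 1) = adj A - cnj \<mu> *\<^sub>C 1"
  by (rule adjI) (simp add: app_shift ip_diff_left ip_diff_right ip_scale_left ip_scale_right ip_adj)

lemma adj_zero: "adj 0 = 0"
  by (rule adjI) (simp add: app_zero_left)

lemma adj_power: "adj (A ^ n) = adj A ^ n"
  by (induction n) (simp_all add: adj_one adj_mult power_commutes)

lemma inj_adj: "inj adj"
  by (metis adj_adj injI)

lemma closed_adj_image_iff: "closed (adj ` C) \<longleftrightarrow> closed C"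
proof -
  have "bounded_linear adj"
  proof (rule bounded_linear_intro[where K = 1])
    show "adj (r *\<^sub>R A) = r *\<^sub>R adj A" for r A by (simp add: scaleR_scaleC adj_scale)
  qed (simp_all add: adj_add norm_adj_le)
  then have cont: "continuous_on UNIV adj" by (rule linear_continuous_on)
  have img: "adj ` D = adj -` D" for D by (force simp: adj_adj image_iff)
  have "closed (adj ` D)" if "closed D" for D unfolding img using closed_vimage[OF that cont] .
  from this[of C] this[of "adj ` C"] show ?thesis by (auto simp: image_image adj_adj)
qed

text \<open>The conjugate-linear isometry \<open>T \<mapsto> T\<^sup>*\<close> of \<open>B(X)\<close> intertwines \<open>R\<^sub>B\<close> with \<open>L\<^bsub>B*\<^esub>\<close>.\<close>

lemma left_drazin_right_mult_iff: "left_drazin (right_mult B) \<longleftrightarrow> left_drazin (left_mult (adj B))"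
proof -
  have R: "range (app (left_mult (adj B) ^ n)) = adj ` range (app (right_mult B ^ n))" for n
  proof -
    have "adj B ^ n * T = adj (adj T * B ^ n)" for T by (simp add: adj_mult adj_adj adj_power)
    moreover have "adj (T * B ^ n) = adj B ^ n * adj T" for T by (simp add: adj_mult adj_power)
    ultimately show ?thesis unfolding app_left_mult_power app_right_mult_power by blast
  qed
  have N: "null_space (left_mult (adj B)) = adj ` null_space (right_mult B)"
  proof -
    have "adj B * T = 0 \<longleftrightarrow> adj T * B = 0" for T
      by (metis adj_adj adj_mult adj_zero)
    then have "adj B * T = 0 \<longleftrightarrow> T \<in> adj ` {T. T * B = 0}" for T by (force simp: adj_adj image_iff)
    then show ?thesis unfolding null_space_def app_left_mult app_right_mult by blast
  qed
  have Z: "adj ` X = {0} \<longleftrightarrow> X = {0}" for X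
    using inj_image_eq_iff[OF inj_adj, of X "{0}"] by (simp add: adj_zero)
  show ?thesis
    unfolding left_drazin_def R N image_Int[OF inj_adj, symmetric] Z closed_adj_image_iff ..
qed

text \<open>If \<open>B\<close> has closed range, an operator \<open>S\<close> factors as \<open>S = B T\<close> as soon as \<open>R(S) \<subseteq> R(B)\<close>: let
  \<open>T x\<close> be the solution of \<open>B (T x) = S x\<close> orthogonal to \<open>N(B)\<close>. Containment of ranges is a closed
  condition on \<open>S\<close>.\<close>

lemma closed_range_left_mult:
  fixes B :: "'a bop"
  assumes cl: "closed (range (app B))"
  shows "closed (range ((*) B))"
proof -
  obtain C where C: "C > 0" "\<And>y. y \<in> range (app B) \<Longrightarrow> \<exists>x\<in>UNIV. app B x = y \<and> norm x \<le> C * norm y"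
    using app_open_mapping[OF complex_vector.subspace_UNIV closed_UNIV cl] by blast
  have factor: "S \<in> range ((*) B)" if S: "\<And>x. app S x \<in> range (app B)" for S
  proof -
    let ?P = "\<lambda>z x. app B z = app S x \<and> (\<forall>m\<in>null_space B. ip z m = 0)"
    have ex: "\<exists>z. ?P z x \<and> norm z \<le> C * norm (app S x)" for x
    proof -
      obtain v where v: "app B v = app S x" "norm v \<le> C * norm (app S x)" using C(2) S by blast
      obtain p where p: "p \<in> null_space B" "\<And>m. m \<in> null_space B \<Longrightarrow> ip (v - p) m = 0"
        using orthogonal_projection[OF csubspace_null_space closed_null_space] by blast
      have "norm (v - p) \<le> norm v"
      proof -
        have "(norm v)\<^sup>2 = (norm (v - p))\<^sup>2 + (norm p)\<^sup>2"
          using norm_diff_scale_sq[of "v - p" "- 1" p] p by (simp add: scaleC_one)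
        then have "(norm (v - p))\<^sup>2 \<le> (norm v)\<^sup>2" by simp
        then show ?thesis by (rule power2_le_imp_le) simp
      qed
      then have "norm (v - p) \<le> C * norm (app S x)" using v(2) by simp
      moreover have "app B (v - p) = app S x" using v(1) p(1) by (simp add: null_space_def)
      ultimately show ?thesis using p(2) by blast
    qed
    then obtain t where t: "\<And>x. ?P (t x) x" "\<And>x. norm (t x) \<le> C * norm (app S x)" by metis
    have uniq: "z = w" if "?P z x" "?P w x" for z w x
    proof -
      have "z - w \<in> null_space B" using that by (simp add: null_space_def)
      then have "ip (z - w) (z - w) = 0" using that by (simp add: ip_diff_left)
      then show ?thesis by (simp add: ip_self)
    qed
    have t_add: "t (x + y) = t x + t y" for x y
      by (rule uniq[OF t(1)]) (use t(1) in \<open>auto simp: ip_add_left\<close>)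
    have t_scale: "t (c *\<^sub>C x) = c *\<^sub>C t x" for c x
      by (rule uniq[OF t(1)]) (use t(1) in \<open>auto simp: ip_scale_left\<close>)
    have "norm (t x) \<le> norm x * (C * norm S)" for x
    proof -
      have "norm (t x) \<le> C * norm (app S x)" by (rule t(2))
      also have "\<dots> \<le> C * (norm S * norm x)" using C(1) by (intro mult_left_mono norm_app) simp
      finally show ?thesis by (simp add: mult_ac)
    qed
    then have "bounded_linear t"
      by (intro bounded_linear_intro[where K = "C * norm S"]) (auto simp: t_add t_scale scaleR_scaleC)
    then obtain T where "\<And>x. app T x = t x" using ex_bop t_scale by metis
    then have "S = B * T" using t(1) by (intro bop_eqI) (simp add: app_times)
    then show ?thesis by (rule range_eqI)
  qed
  have "S \<in> range ((*) B)" if u: "\<forall>n. u n \<in> range ((*) B)" and lim: "u \<longlonglongrightarrow> S" for u S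
  proof (rule factor)
    fix x :: 'a
    have "(\<lambda>n. norm (u n - S) * norm x) \<longlonglongrightarrow> norm (S - S) * norm x" by (intro tendsto_intros lim)
    then have l0: "(\<lambda>n. norm (u n - S) * norm x) \<longlonglongrightarrow> 0" by simp
    have lim_x: "(\<lambda>n. app (u n) x) \<longlonglongrightarrow> app S x"
    proof (rule LIM_zero_cancel, rule tendsto_norm_zero_cancel, rule tendsto_sandwich[OF _ _ tendsto_const l0])
      show "\<forall>\<^sub>F n in sequentially. norm (app (u n) x - app S x) \<le> norm (u n - S) * norm x"
        using norm_app[of "u _ - S" x] by (simp add: app_diff)
    qed simp
    have "app (u n) x \<in> range (app B)" for n
    proof -
      obtain V where "u n = B * V" using u by blast
      then show ?thesis by (simp add: app_times)
    qed
    then show "app S x \<in> range (app B)" by (rule closed_sequentially[OF cl _ lim_x])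
  qed
  then show ?thesis unfolding closed_sequential_limits by blast
qed

lemma left_drazin_left_mult:
  fixes B :: "'a bop"
  assumes "left_drazin B" shows "left_drazin (left_mult B)"
proof -
  obtain n where n: "closed (range (app (B ^ n)))" "closed (range (app (B ^ Suc n)))"
      "null_space B \<inter> range (app (B ^ n)) = {0}"
    using assms unfolding left_drazin_def by blast
  have "B ^ n * T = 0" if "B * (B ^ n * T) = 0" for T
  proof (rule bop_eqI)
    fix x
    have "app B (app (B ^ n) (app T x)) = 0"
      using arg_cong[OF that, of "\<lambda>V. app V x"] by (simp add: app_times app_zero_left)
    then have "app (B ^ n) (app T x) \<in> null_space B \<inter> range (app (B ^ n))" by (simp add: null_space_def)
    then show "app (B ^ n * T) x = app 0 x" unfolding n(3) by (simp add: app_times app_zero_left)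
  qed
  moreover have "0 \<in> range (app (left_mult B ^ n))" by (rule complex_vector.subspace_0[OF csubspace_range])
  ultimately have "null_space (left_mult B) \<inter> range (app (left_mult B ^ n)) = {0}"
    unfolding null_space_def by (auto simp: app_left_mult_power app_left_mult)
  then show ?thesis
    using closed_range_left_mult n(1,2) unfolding left_drazin_def range_left_mult_power by blast
qed

text \<open>For operators on a Hilbert space \<open>\<Pi>\<^sup>a(B) = \<Pi>\<^sup>a(L\<^sub>B)\<close>, so the criterion for \<open>B = A\<^sup>*\<close> only compares
  \<open>\<sigma>\<^bsub>SBF\<^esub>(B)\<close> with \<open>\<sigma>\<^bsub>SBF\<^esub>(L\<^sub>B)\<close>, and the latter is the complex conjugate of \<open>\<sigma>\<^bsub>SBF\<^esub>(R\<^sub>A)\<close>.\<close>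

theorem a_Browder_adjoint_iff:
  assumes inf: "cdim (UNIV :: 'a set) = \<infinity>"
  shows "a_Browder (adj A) \<longleftrightarrow> sigma_SBF (adj A) = cnj ` sigma_SBF (right_mult A)"
proof -
  let ?B = "adj A"
  have "Pi_a ?B = Pi_a (left_mult ?B)"
    unfolding Pi_a_eq sigma_a_left_mult[OF inf] left_mult_shift
    using left_drazin_left_mult left_drazin_if_left_mult[OF inf] by blast
  then have "a_Browder ?B \<longleftrightarrow> sigma_SBF ?B = sigma_SBF (left_mult ?B)"
    using a_Browder_iff_sigma_SBF_left_mult[OF inf, of ?B] by blast
  also have "sigma_SBF (left_mult ?B) = {\<mu>. \<not> left_drazin (left_mult (?B - \<mu> *\<^sub>C 1))}"
    unfolding left_mult_shift[symmetric]
    by (rule sigma_SBF_if_dichotomy(1); rule left_mult_dichotomy[OF inf]; assumption)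
  also have "\<dots> = {\<mu>. \<not> left_drazin (right_mult (A - cnj \<mu> *\<^sub>C 1))}"
    by (simp add: left_drazin_right_mult_iff adj_shift)
  also have "\<dots> = cnj ` {\<mu>. \<not> left_drazin (right_mult (A - \<mu> *\<^sub>C 1))}"
    by (force simp: image_iff intro: exI[of _ "cnj _"])
  also have "{\<mu>. \<not> left_drazin (right_mult (A - \<mu> *\<^sub>C 1))} = sigma_SBF (right_mult A)"
    unfolding right_mult_shift[symmetric]
    by (rule sigma_SBF_if_dichotomy(1)[symmetric]; rule right_mult_dichotomy[OF inf]; assumption)
  finally show ?thesis .
qed

end

theorem theorem3p7:
  fixes A :: "'a::complex_banach bop"
  assumes "cdim (UNIV :: 'a set) = \<infinity>"
  shows "(a_Browder (left_mult A) \<and> a_Browder (right_mult A)) \<and>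
    (a_Browder A \<and> Pi_a A = Pi_a (left_mult A) \<longleftrightarrow> sigma_SBF A = sigma_SBF (left_mult A)) \<and>
    (\<forall>ip :: 'a \<Rightarrow> 'a \<Rightarrow> complex. hilbert_inner ip \<longrightarrow>
      (a_Browder (hilbert_adjoint ip A) \<longleftrightarrow>
       sigma_SBF (hilbert_adjoint ip A) = cnj ` sigma_SBF (right_mult A)))"
  using a_Browder_left_right_mult[OF assms] a_Browder_iff_sigma_SBF_left_mult[OF assms]
    a_Browder_adjoint_iff[OF _ assms] by blast

end
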